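(* Let $X$ be a $\delta$-hyperbolic graph and let $G$ be a group acting on $X$ by isometries such that the action satisfies WPD. Then the real vector space $\widetilde{QH}(G)$ is infinite dimensional.
   Context: Quasi-homomorphisms. For a discrete group $G$, a quasi-homomorphism is a function $h:G\to\mathbb R$ with $\sup_{\gamma_1,\gamma_2\in G}|h(\gamma_1\gamma_2)-h(\gamma_1)-h(\gamma_2)|<\infty$. Let $\mathcal V(G)$ be the real vector space of all quasi-homomorphisms on $G$, $BDD(G)$ the subspace of bounded functions, $HOM(G)$ the subspace of homomorphisms $G\to\mathbb R$. Define $\widetilde{QH}(G)=\mathcal V(G)/(BDD(G)+HOM(G))$ (it is isomorphic to the kernel of $H^2_b(G;\mathbb R)\to H^2(G;\mathbb R)$). Hyperbolic graphs. $X$ is a connected graph with the path metric $d$ in which each edge has length 1; it is $\delta$-hyperbolic if for any three geodesic arcs $\alpha,\beta,\gamma$ forming a triangle, $\alpha$ is contained in the $\delta$-neighborhood of $\beta\cup\gamma$. A $(K,L)$-quasi-geodesic is a map $\phi$ of a (finite or infinite) interval into $X$ with $\frac1K|s-t|-L\le d(\phi(s),\phi(t))\le K|s-t|+L$. An isometry $g$ of $X$ is hyperbolic if it admits an invariant bi-infinite quasi-geodesic along which $g$ acts as a nontrivial translation. WPD (weak proper discontinuity). The action of $G$ on $X$ satisfies WPD if: (a) $G$ is not virtually cyclic; (b) $G$ contains at least one element that acts on $X$ as a hyperbolic isometry; and (c) for every hyperbolic element $g\in G$, every $x\in X$ and every $C>0$ there exists $N>0$ such that the set $\{\gamma\in G: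 d(x,\gamma(x))\le C,\ d(g^N(x),\gamma g^N(x))\le C\}$ is finite. *)

theory Defs
  imports
    Complex_Main
    "HOL-Algebra.AbelCoset"
    "HOL-Algebra.Group_Action"
    "HOL-Algebra.Elementary_Groups"
    "Jordan_Normal_Form.VS_Connect"
begin

text \<open>As for \<^const>\<open>ring.func_space\<close>, the fields \<open>mult\<close> and \<open>one\<close> inherited
  from the record of rings carry no information.\<close>

definition quotient_space :: "('a, 'v, 'm) module_scheme \<Rightarrow> 'v set \<Rightarrow> ('a, 'v set) module"
  where "quotient_space V U =
    \<lparr>carrier = a_rcosets\<^bsub>V\<^esub> U,
     mult = (\<lambda>X Y. U),
     one = U,
     zero = U,
     add = set_add V,
     smult = (\<lambda>a X. \<Union>x\<in>X. U +>\<^bsub>V\<^esub> (a \<odot>\<^bsub>V\<^esub> x))\<rparr>"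

lemma vectorspace_quotient_space:
  assumes "subspace K U V"
  shows "vectorspace K (quotient_space V U)"
proof -
  interpret V: vectorspace K V using assms by (rule subspace.vs)
  have sub: "submodule K U V" using assms by (rule subspace.submod)
  have UV: "U \<subseteq> carrier V" using sub by (rule submodule.subset)
  have neg: "\<ominus>\<^bsub>V\<^esub> u \<in> U" if "u \<in> U" for u
  proof -
    have "(\<ominus>\<^bsub>K\<^esub> \<one>\<^bsub>K\<^esub>) \<odot>\<^bsub>V\<^esub> u \<in> U"
      using that sub by (intro submodule.smult_closed) auto
    then show ?thesis using V.smult_minus_1 that UV by auto
  qed
  have "subgroup U (add_monoid V)"
    using UV sub neg by (intro V.add.subgroupI)
      (auto simp: a_inv_def[symmetric] submodule.m_closed dest: submodule.zero_closed)
  then have "additive_subgroup U V" by (simp add: additive_subgroup_def)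
  then interpret U: abelian_subgroup U V
    by (intro abelian_subgroupI3) (auto intro: V.abelian_group_axioms)
  have smult: "(\<Union>x\<in>U +>\<^bsub>V\<^esub> v. U +>\<^bsub>V\<^esub> (a \<odot>\<^bsub>V\<^esub> x)) = U +>\<^bsub>V\<^esub> (a \<odot>\<^bsub>V\<^esub> v)"
    if a: "a \<in> carrier K" and v: "v \<in> carrier V" for a v
  proof -
    have "U +>\<^bsub>V\<^esub> (a \<odot>\<^bsub>V\<^esub> x) = U +>\<^bsub>V\<^esub> (a \<odot>\<^bsub>V\<^esub> v)" if x: "x \<in> U +>\<^bsub>V\<^esub> v" for x
    proof -
      obtain u where u: "u \<in> U" "x = u \<oplus>\<^bsub>V\<^esub> v"
        using x by (auto simp: a_r_coset_def')
      have "a \<odot>\<^bsub>V\<^esub> x = (a \<odot>\<^bsub>V\<^esub> u) \<oplus>\<^bsub>V\<^esub> (a \<odot>\<^bsub>V\<^esub> v)"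
        using u UV a v by (auto simp: V.smult_r_distr)
      moreover have "a \<odot>\<^bsub>V\<^esub> u \<in> U" using sub a u by (auto intro: submodule.smult_closed)
      ultimately have "a \<odot>\<^bsub>V\<^esub> x \<in> U +>\<^bsub>V\<^esub> (a \<odot>\<^bsub>V\<^esub> v)" by (auto simp: a_r_coset_def')
      then show ?thesis using U.a_repr_independence' a v by simp
    qed
    moreover have "v \<in> U +>\<^bsub>V\<^esub> v" using U.a_rcos_self v by simp
    ultimately show ?thesis by blast
  qed
  have car: "X \<in> carrier (quotient_space V U) \<longleftrightarrow> (\<exists>v\<in>carrier V. X = U +>\<^bsub>V\<^esub> v)" for X
    by (auto simp: quotient_space_def A_RCOSETS_def')
  have ab: "abelian_group (quotient_space V U)"
    by (rule comm_group_abelian_groupI)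
      (use U.a_factorgroup_is_comm_group in \<open>simp (no_asm_use) add: quotient_space_def A_FactGroup_def'
        comm_group_def comm_monoid_def comm_monoid_axioms_def group_def group_axioms_def
        Group.monoid_def Units_def\<close>)
  have "module K (quotient_space V U)"
  proof (rule moduleI[OF V.R.is_cring ab])
  qed (auto simp: car, auto simp: quotient_space_def smult U.a_rcos_sum
      V.smult_l_distr V.smult_r_distr V.smult_assoc1)
  then show ?thesis by (simp add: vectorspace_def V.field_axioms)
qed

text \<open>Functions on the group are elements of \<open>carrier G \<rightarrow>\<^sub>E UNIV\<close>, so that they are
  determined by their values on the carrier.\<close>

abbreviation real_functions :: "('g, 'm) monoid_scheme \<Rightarrow> (real, 'g \<Rightarrow> real) module"
  where "real_functions G \<equiv> ring.func_space (class_ring :: real ring) (carrier G)"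

definition quasi_homs :: "('g, 'm) monoid_scheme \<Rightarrow> ('g \<Rightarrow> real) set"
  where "quasi_homs G = {h \<in> carrier G \<rightarrow>\<^sub>E UNIV.
    bdd_above ((\<lambda>(x, y). \<bar>h (x \<otimes>\<^bsub>G\<^esub> y) - h x - h y\<bar>) ` (carrier G \<times> carrier G))}"

definition bounded_funs :: "('g, 'm) monoid_scheme \<Rightarrow> ('g \<Rightarrow> real) set"
  where "bounded_funs G = {h \<in> carrier G \<rightarrow>\<^sub>E UNIV. bdd_above ((\<lambda>x. \<bar>h x\<bar>) ` carrier G)}"

definition real_homs :: "('g, 'm) monoid_scheme \<Rightarrow> ('g \<Rightarrow> real) set"
  where "real_homs G = {h \<in> carrier G \<rightarrow>\<^sub>E UNIV.
    \<forall>x\<in>carrier G. \<forall>y\<in>carrier G. h (x \<otimes>\<^bsub>G\<^esub> y) = h x + h y}"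

definition quasi_hom_space :: "('g, 'm) monoid_scheme \<Rightarrow> (real, 'g \<Rightarrow> real) module"
  where "quasi_hom_space G = (real_functions G)\<lparr>carrier := quasi_homs G\<rparr>"

definition QH_tilde :: "('g, 'm) monoid_scheme \<Rightarrow> (real, ('g \<Rightarrow> real) set) module"
  where "QH_tilde G = quotient_space (quasi_hom_space G)
    (bounded_funs G <+>\<^bsub>quasi_hom_space G\<^esub> real_homs G)"

lemma vectorspace_real_functions: "vectorspace class_ring (real_functions G)"
proof -
  have "cring (class_ring :: real ring)"
    using class_field by (intro domain.axioms(1) field.axioms(1))
  then show ?thesis
    unfolding vectorspace_def using cring.func_space_is_module class_field by blast
qed

lemma quasi_homs_iff:
  "h \<in> quasi_homs G \<longleftrightarrow> h \<in> carrier G \<rightarrow>\<^sub>E UNIV \<and>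
    (\<exists>D. \<forall>x\<in>carrier G. \<forall>y\<in>carrier G. \<bar>h (x \<otimes>\<^bsub>G\<^esub> y) - h x - h y\<bar> \<le> D)"
  by (auto simp: quasi_homs_def bdd_above_def)

lemma bounded_funs_iff:
  "h \<in> bounded_funs G \<longleftrightarrow> h \<in> carrier G \<rightarrow>\<^sub>E UNIV \<and> (\<exists>D. \<forall>x\<in>carrier G. \<bar>h x\<bar> \<le> D)"
  by (auto simp: bounded_funs_def bdd_above_def)

lemma subspace_quasi_homs:
  assumes "group G"
  shows "subspace class_ring (quasi_homs G) (real_functions G)"
proof -
  interpret group G by fact
  have add: "restrict (\<lambda>x. f x + g x) (carrier G) \<in> quasi_homs G"
    if "f \<in> quasi_homs G" "g \<in> quasi_homs G" for f g
  proof -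
    obtain D where D: "\<bar>f (x \<otimes>\<^bsub>G\<^esub> y) - f x - f y\<bar> \<le> D"
      if "x \<in> carrier G" "y \<in> carrier G" for x y
      using \<open>f \<in> _\<close> by (auto simp: quasi_homs_iff)
    obtain D' where D': "\<bar>g (x \<otimes>\<^bsub>G\<^esub> y) - g x - g y\<bar> \<le> D'"
      if "x \<in> carrier G" "y \<in> carrier G" for x y
      using \<open>g \<in> _\<close> by (auto simp: quasi_homs_iff)
    have "\<bar>(f (x \<otimes>\<^bsub>G\<^esub> y) + g (x \<otimes>\<^bsub>G\<^esub> y)) - (f x + g x) - (f y + g y)\<bar> \<le> D + D'"
      if "x \<in> carrier G" "y \<in> carrier G" for x y
      using D[OF that] D'[OF that] by linarith
    then show ?thesis by (auto simp: quasi_homs_iff)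
  qed
  have smult: "restrict (\<lambda>x. c * f x) (carrier G) \<in> quasi_homs G"
    if "f \<in> quasi_homs G" for c f
  proof -
    obtain D where D: "\<bar>f (x \<otimes>\<^bsub>G\<^esub> y) - f x - f y\<bar> \<le> D"
      if "x \<in> carrier G" "y \<in> carrier G" for x y
      using \<open>f \<in> _\<close> by (auto simp: quasi_homs_iff)
    have "\<bar>c * f (x \<otimes>\<^bsub>G\<^esub> y) - c * f x - c * f y\<bar> \<le> \<bar>c\<bar> * D"
      if "x \<in> carrier G" "y \<in> carrier G" for x y
      using mult_left_mono[OF D[OF that], of "\<bar>c\<bar>"]
      by (simp add: abs_mult[symmetric] right_diff_distrib)
    then show ?thesis by (auto simp: quasi_homs_iff)
  qed
  have "submodule class_ring (quasi_homs G) (real_functions G)"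
  proof (rule submodule.intro)
    show "module class_ring (real_functions G)"
      using vectorspace_real_functions by (rule vectorspace.axioms(1))
    show "\<zero>\<^bsub>real_functions G\<^esub> \<in> quasi_homs G"
      by (auto simp: class_ring.func_space_def quasi_homs_iff)
  qed (use add smult in \<open>auto simp: class_ring.func_space_def quasi_homs_iff\<close>)
  then show ?thesis using vectorspace_real_functions by (rule subspace.intro[rotated])
qed

lemma vectorspace_quasi_hom_space:
  assumes "group G"
  shows "vectorspace class_ring (quasi_hom_space G)"
  unfolding quasi_hom_space_def
  using vectorspace_real_functions subspace_quasi_homs[OF assms]
  by (rule vectorspace.subspace_is_vs)

lemma subspace_bounded_funs:
  assumes "group G"
  shows "subspace class_ring (bounded_funs G) (quasi_hom_space G)"
proof -
  interpret group G by fact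
  have sub: "bounded_funs G \<subseteq> quasi_homs G"
  proof
    fix f assume f: "f \<in> bounded_funs G"
    then obtain D where D: "\<bar>f x\<bar> \<le> D" if "x \<in> carrier G" for x
      by (auto simp: bounded_funs_iff)
    have "\<bar>f (x \<otimes>\<^bsub>G\<^esub> y) - f x - f y\<bar> \<le> 3 * D"
      if "x \<in> carrier G" "y \<in> carrier G" for x y
      using D[of x] D[of y] D[of "x \<otimes>\<^bsub>G\<^esub> y"] that by fastforce
    then show "f \<in> quasi_homs G" using f by (auto simp: quasi_homs_iff bounded_funs_iff)
  qed
  have add: "restrict (\<lambda>x. f x + g x) (carrier G) \<in> bounded_funs G"
    if "f \<in> bounded_funs G" "g \<in> bounded_funs G" for f g
  proof -
    obtain D where D: "\<bar>f x\<bar> \<le> D" if "x \<in> carrier G" for x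
      using \<open>f \<in> _\<close> by (auto simp: bounded_funs_iff)
    obtain D' where D': "\<bar>g x\<bar> \<le> D'" if "x \<in> carrier G" for x
      using \<open>g \<in> _\<close> by (auto simp: bounded_funs_iff)
    have "\<bar>f x + g x\<bar> \<le> D + D'" if "x \<in> carrier G" for x
      using D[OF that] D'[OF that] by linarith
    then show ?thesis by (auto simp: bounded_funs_iff)
  qed
  have smult: "restrict (\<lambda>x. c * f x) (carrier G) \<in> bounded_funs G"
    if "f \<in> bounded_funs G" for c f
  proof -
    obtain D where D: "\<bar>f x\<bar> \<le> D" if "x \<in> carrier G" for x
      using \<open>f \<in> _\<close> by (auto simp: bounded_funs_iff)
    have "\<bar>c * f x\<bar> \<le> \<bar>c\<bar> * D" if "x \<in> carrier G" for x
      using mult_left_mono[OF D[OF that], of "\<bar>c\<bar>"] by (simp add: abs_mult)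
    then show ?thesis by (auto simp: bounded_funs_iff)
  qed
  have "submodule class_ring (bounded_funs G) (quasi_hom_space G)"
  proof (rule submodule.intro)
    show "module class_ring (quasi_hom_space G)"
      using vectorspace_quasi_hom_space[OF assms] by (rule vectorspace.axioms(1))
    show "\<zero>\<^bsub>quasi_hom_space G\<^esub> \<in> bounded_funs G"
      by (auto simp: quasi_hom_space_def class_ring.func_space_def bounded_funs_iff)
  qed (use sub add smult in \<open>auto simp: quasi_hom_space_def class_ring.func_space_def\<close>)
  then show ?thesis
    using vectorspace_quasi_hom_space[OF assms] by (rule subspace.intro[rotated])
qed

lemma subspace_real_homs:
  assumes "group G"
  shows "subspace class_ring (real_homs G) (quasi_hom_space G)"
proof -
  interpret group G by fact
  have "submodule class_ring (real_homs G) (quasi_hom_space G)"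
  proof (rule submodule.intro)
    show "module class_ring (quasi_hom_space G)"
      using vectorspace_quasi_hom_space[OF assms] by (rule vectorspace.axioms(1))
    show "real_homs G \<subseteq> carrier (quasi_hom_space G)"
      by (auto simp: quasi_hom_space_def quasi_homs_iff real_homs_def)
  qed (auto simp: quasi_hom_space_def class_ring.func_space_def real_homs_def algebra_simps)
  then show ?thesis
    using vectorspace_quasi_hom_space[OF assms] by (rule subspace.intro[rotated])
qed

lemma vectorspace_QH_tilde:
  assumes "group G"
  shows "vectorspace class_ring (QH_tilde G)"
proof -
  interpret vectorspace class_ring "quasi_hom_space G"
    using assms by (rule vectorspace_quasi_hom_space)
  have "bounded_funs G <+>\<^bsub>quasi_hom_space G\<^esub> real_homs G
      = submodule_sum (bounded_funs G) (real_homs G)"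
    unfolding submodule_sum_def set_add_def' by auto
  also have "submodule class_ring \<dots> (quasi_hom_space G)"
    using subspace_bounded_funs[OF assms] subspace_real_homs[OF assms]
    by (intro sum_is_submodule subspace.submod)
  finally show ?thesis
    unfolding QH_tilde_def
    by (intro vectorspace_quotient_space subspace.intro vectorspace_axioms)
qed

definition virtually_cyclic :: "('g, 'm) monoid_scheme \<Rightarrow> bool"
  where "virtually_cyclic G \<longleftrightarrow>
    (\<exists>H. subgroup H G \<and> cyclic_group (G\<lparr>carrier := H\<rparr>) \<and> finite (rcosets\<^bsub>G\<^esub> H))"

text \<open>\<open>edge_chain E \<chi> x y l\<close>: there is a piecewise linear path of length \<open>l\<close> from \<open>x\<close> to
  \<open>y\<close>, each linear piece of which runs inside one closed edge \<open>\<chi> e ` {0..1}\<close> of length 1.\<close>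

inductive edge_chain :: "'e set \<Rightarrow> ('e \<Rightarrow> real \<Rightarrow> 'x) \<Rightarrow> 'x \<Rightarrow> 'x \<Rightarrow> real \<Rightarrow> bool"
  for E :: "'e set" and \<chi> :: "'e \<Rightarrow> real \<Rightarrow> 'x"
  where
    nil: "edge_chain E \<chi> x x 0"
  | cons: "e \<in> E \<Longrightarrow> s \<in> {0..1} \<Longrightarrow> t \<in> {0..1} \<Longrightarrow> edge_chain E \<chi> (\<chi> e t) y l
      \<Longrightarrow> edge_chain E \<chi> (\<chi> e s) y (\<bar>s - t\<bar> + l)"

text \<open>A metric space that is a connected graph with vertex set \<open>V\<close> and edges indexed by \<open>E\<close>;
  \<open>\<chi> e\<close> is the characteristic map of the edge \<open>e\<close>. Loops and multiple edges are allowed. The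
  metric is the path metric, i.e. the infimum of the lengths of piecewise linear paths.\<close>

locale metric_graph =
  fixes V :: "'x::metric_space set" and E :: "'e set" and \<chi> :: "'e \<Rightarrow> real \<Rightarrow> 'x"
  assumes endpoints: "e \<in> E \<Longrightarrow> \<chi> e 0 \<in> V \<and> \<chi> e 1 \<in> V"
    and open_edges: "bij_betw (\<lambda>(e, t). \<chi> e t) (E \<times> {0<..<1}) (- V)"
    and chain_connected: "\<exists>l. edge_chain E \<chi> x y l"
    and path_metric: "dist x y = Inf {l. edge_chain E \<chi> x y l}"

definition geodesic_arc :: "'x::metric_space set \<Rightarrow> 'x \<Rightarrow> 'x \<Rightarrow> bool"
  where "geodesic_arc A x y \<longleftrightarrow>
    (\<exists>c l. 0 \<le> l \<and> c 0 = x \<and> c l = y \<and> A = c ` {0..l} \<and>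
      (\<forall>s\<in>{0..l}. \<forall>t\<in>{0..l}. dist (c s) (c t) = \<bar>s - t\<bar>))"

text \<open>The neighborhood is closed; a space satisfying the condition for open neighborhoods
  satisfies this one with the same \<open>\<delta>\<close>.\<close>

definition delta_hyperbolic :: "'x::metric_space itself \<Rightarrow> real \<Rightarrow> bool"
  where "delta_hyperbolic X \<delta> \<longleftrightarrow>
    (\<forall>(x::'x) y z A B C. geodesic_arc A x y \<longrightarrow> geodesic_arc B y z \<longrightarrow> geodesic_arc C z x \<longrightarrow>
      (\<forall>p\<in>A. \<exists>q\<in>B \<union> C. dist p q \<le> \<delta>))"

text \<open>\<open>K \<ge> 1\<close> excludes in particular \<open>K = 0\<close>, where \<open>1 / K = 0\<close>.\<close>

definition quasi_geodesic_on :: "real \<Rightarrow> real \<Rightarrow> real set \<Rightarrow> (real \<Rightarrow> 'x::metric_space) \<Rightarrow> bool"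
  where "quasi_geodesic_on K L I c \<longleftrightarrow> K \<ge> 1 \<and> L \<ge> 0 \<and>
    (\<forall>s\<in>I. \<forall>t\<in>I. 1 / K * \<bar>s - t\<bar> - L \<le> dist (c s) (c t) \<and> dist (c s) (c t) \<le> K * \<bar>s - t\<bar> + L)"

definition isometry :: "('x::metric_space \<Rightarrow> 'x) \<Rightarrow> bool"
  where "isometry f \<longleftrightarrow> bij f \<and> (\<forall>x y. dist (f x) (f y) = dist x y)"

definition hyperbolic_isometry :: "('x::metric_space \<Rightarrow> 'x) \<Rightarrow> bool"
  where "hyperbolic_isometry f \<longleftrightarrow> isometry f \<and>
    (\<exists>K L c \<tau>. quasi_geodesic_on K L UNIV c \<and> \<tau> \<noteq> 0 \<and> (\<forall>t. f (c t) = c (t + \<tau>)))"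

definition isometric_action :: "('g, 'm) monoid_scheme \<Rightarrow> ('g \<Rightarrow> 'x::metric_space \<Rightarrow> 'x) \<Rightarrow> bool"
  where "isometric_action G \<phi> \<longleftrightarrow> group_action G UNIV \<phi> \<and> (\<forall>g\<in>carrier G. isometry (\<phi> g))"

definition WPD :: "('g, 'm) monoid_scheme \<Rightarrow> ('g \<Rightarrow> 'x::metric_space \<Rightarrow> 'x) \<Rightarrow> bool"
  where "WPD G \<phi> \<longleftrightarrow>
    \<not> virtually_cyclic G \<and>
    (\<exists>g\<in>carrier G. hyperbolic_isometry (\<phi> g)) \<and>
    (\<forall>g\<in>carrier G. hyperbolic_isometry (\<phi> g) \<longrightarrow>
      (\<forall>x. \<forall>C>0. \<exists>N::nat. N > 0 \<and>
        finite {\<gamma> \<in> carrier G. dist x (\<phi> \<gamma> x) \<le> C \<and>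
          dist (\<phi> (g [^]\<^bsub>G\<^esub> N) x) (\<phi> \<gamma> (\<phi> (g [^]\<^bsub>G\<^esub> N) x)) \<le> C}))"

end

theory Submission
  imports Defs
begin

text \<open>Fix a hyperbolic element \<open>g\<close> with base point \<open>x0\<close>. By WPD and the pigeonhole principle, an
  element moving a long piece of the orbit \<open>g^i x0\<close> close to this orbit lies in the virtually cyclic
  group \<open>elementary\<close> of elements commuting with a power of \<open>g\<close> or inverting it. As \<open>G\<close> is not
  virtually cyclic, there is some \<open>h\<close> outside this group; then \<open>h\<close>-translates of the axis of \<open>g\<close>
  diverge from the axis, so words in long powers of \<open>g\<close> and \<open>h^(+-1)\<close> trace broken geodesics.

  A counting quasi-homomorphism is obtained from any \<open>G\<close>-invariant asymmetric distance \<open>d'\<close>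
  satisfying \<open>d'(x,m) + d'(m,z) \<le> d'(x,z) + const\<close> for \<open>m\<close> close to a geodesic from \<open>x\<close> to \<open>z\<close>:
  the function \<open>\<gamma> \<mapsto> d'(x0, \<gamma> x0) - d'(\<gamma> x0, x0)\<close> has bounded defect, since at the centre of a
  triangle all terms cancel. We take for \<open>d'\<close> the length of a shortest path, shortened by a fixed
  reward for each copy of a pattern traversed. Shortest paths are then quasi-geodesics with
  constants independent of the pattern.

  The pattern is the part \<open>g^(2n) h g^(-4n)\<close> of \<open>f n = g^n h g^n h^-1 g^(2n) h g^(-4n) h^-1\<close>. It
  occurs in all powers of \<open>f n\<close> but, since syllables have to match, neither in their inverses nor
  in powers of \<open>f m\<close> for \<open>m\<close> much smaller than \<open>n\<close>. Homomorphisms vanish on \<open>f n\<close>. So a sparse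
  sequence of values \<open>n\<close> yields a triangular, hence linearly independent system.\<close>

section \<open>Hyperbolic spaces\<close>

text \<open>Closeness to geodesics is expressed by Gromov products throughout:
  \<open>gprod x z m\<close> is half the extra length of a detour through \<open>m\<close>, so a
  bound on it says that \<open>m\<close> is almost on a geodesic from \<open>x\<close> to
  \<open>z\<close>, and no geodesic has to be chosen. The obstacle is the order of the constants. A
  word in \<open>g\<close> and \<open>h\<close> traces only a broken geodesic, and every corner
  loses some length, so the reward must exceed the total loss of one period. The reward in turn
  enlarges the quasi-geodesic constants, and with them the length of overlap that forces two
  translated axes into one coset. This is not circular: the loss at a corner is uniform in the
  exponents, the later constants depend on the reward but not on the length of the pattern, and the
  exponents are chosen last. The values are then decided by comparison with the ordinary distance: a
  path along powers of \<open>f n\<close> gains at least 1 per period, while a path without copies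
  is never shorter than the distance.\<close>

definition gprod :: "'x::metric_space \<Rightarrow> 'x \<Rightarrow> 'x \<Rightarrow> real"
  where "gprod x y w = (dist x w + dist y w - dist x y) / 2"

lemma gprod_commute: "gprod x y w = gprod y x w"
  by (simp add: gprod_def dist_commute)

lemma gprod_nonneg: "0 \<le> gprod x y w"
  using dist_triangle[of x y w] by (simp add: gprod_def dist_commute)

lemma gprod_le_dist: "gprod x y w \<le> dist x w" "gprod x y w \<le> dist y w"
  using dist_triangle[of y w x] dist_triangle[of x w y] by (simp_all add: gprod_def dist_commute)

lemma gprod_switch: "gprod x y w = dist w x - gprod w y x"
  by (simp add: gprod_def dist_commute field_simps)

lemma gprod_perturb:
  "\<bar>gprod x y w - gprod x' y w\<bar> \<le> dist x x'"
  "\<bar>gprod x y w - gprod x y' w\<bar> \<le> dist y y'"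
  "\<bar>gprod x y w - gprod x y w'\<bar> \<le> dist w w'"
proof -
  show "\<bar>gprod x y w - gprod x' y w\<bar> \<le> dist x x'"
    using dist_triangle[of x w x'] dist_triangle[of x' w x] dist_triangle[of x y x']
      dist_triangle[of x' y x] by (simp add: gprod_def dist_commute abs_if field_simps)
  show "\<bar>gprod x y w - gprod x y' w\<bar> \<le> dist y y'"
    using dist_triangle[of y w y'] dist_triangle[of y' w y] dist_triangle[of x y y']
      dist_triangle[of x y' y] by (simp add: gprod_def dist_commute abs_if field_simps)
  show "\<bar>gprod x y w - gprod x y w'\<bar> \<le> dist w w'"
    using dist_triangle[of x w w'] dist_triangle[of x w' w] dist_triangle[of y w w']
      dist_triangle[of y w' w] by (simp add: gprod_def dist_commute abs_if field_simps)
qed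

text \<open>The paths \<open>c\<close> are coarse geodesics; the constant 4 accounts for moving both endpoints of
  a geodesic between vertices by at most 1 each.\<close>

locale hyperbolic_space =
  fixes T :: "'x::metric_space itself" and \<delta> :: real
  assumes delta_ge_1: "1 \<le> \<delta>"
    and four_point: "dist x y + dist z w
      \<le> max (dist x z + dist y w) (dist x w + dist y z) + 2 * \<delta>"
    and coarse_geodesic: "\<exists>c n. c 0 = x \<and> c n = (y::'x) \<and>
      (\<forall>i j. i \<le> j \<longrightarrow> j \<le> n \<longrightarrow> dist (c i) (c j) \<le> real (j - i) \<and>
        real (j - i) \<le> dist (c i) (c j) + 4)"
begin

lemma gprod_hyp:
  fixes x y z w :: 'x
  shows "min (gprod x y w) (gprod y z w) - \<delta> \<le> gprod x z w"
  using four_point[of x z y w]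
  by (simp add: gprod_def dist_commute min_def max_def field_simps split: if_splits)

text \<open>The distance of each point to \<open>z\<close> is almost dictated by its distance to
  \<open>x\<close>; inserting this into the four-point condition leaves only the difference of the
  distances to \<open>x\<close>. Near a geodesic, position is thus determined by the distance from
  one end.\<close>

lemma dist_close_if_near_geodesic:
  fixes x z y y' :: 'x
  assumes "gprod x z y \<le> B" "gprod x z y' \<le> B"
  shows "dist y y' \<le> \<bar>dist x y - dist x y'\<bar> + 2 * B + 2 * \<delta>"
  using assms four_point[of y y' x z]
  by (simp add: gprod_def dist_commute max_def abs_if field_simps split: if_splits)

text \<open>With \<open>y1\<close> and \<open>y2\<close> ordered by their distance from
  \<open>x\<close>, \<open>dist y1 y2\<close> is almost the difference of these distances, so the
  detour over \<open>y1\<close>, \<open>y\<close>, \<open>y2\<close> is only slightly longer than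
  \<open>dist x z\<close>.\<close>

lemma gprod_between:
  fixes x z y1 y2 y :: 'x
  assumes B: "gprod x z y1 \<le> B" "gprod x z y2 \<le> B" and C: "gprod y1 y2 y \<le> C"
  shows "gprod x z y \<le> C + 2 * B + \<delta>"
proof -
  have *: "gprod x z y \<le> C + 2 * B + \<delta>"
    if "gprod x z y1 \<le> B" "gprod x z y2 \<le> B" "gprod y1 y2 y \<le> C" "dist x y1 \<le> dist x y2"
    for y1 y2
  proof -
    have "dist y1 y2 \<le> dist x y2 - dist x y1 + 2 * B + 2 * \<delta>"
      using dist_close_if_near_geodesic[OF that(1,2)] that(4) by simp
    then show ?thesis
      using that dist_triangle[of x y y1] dist_triangle[of y z y2]
      by (simp add: gprod_def dist_commute field_simps)
  qed
  show ?thesis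
  proof (cases "dist x y1 \<le> dist x y2")
    case True then show ?thesis using * assms by blast
  next
    case False then show ?thesis using *[of y2 y1] assms by (simp add: gprod_commute)
  qed
qed

text \<open>Halve the chain: by \<open>gprod_hyp\<close> the product of one half is larger by at
  most \<open>\<delta>\<close>, and \<open>k\<close> halvings isolate a single step.\<close>

lemma gprod_split:
  fixes a :: "nat \<Rightarrow> 'x"
  assumes "n \<le> 2 ^ k" "0 < n"
  shows "\<exists>i<n. gprod (a i) (a (Suc i)) y \<le> gprod (a 0) (a n) y + k * \<delta>"
  using assms
proof (induction k arbitrary: n a)
  case 0
  then have "n = 1" by simp
  then show ?case by auto
next
  case (Suc k)
  show ?case
  proof (cases "n \<le> 2 ^ k")
    case True
    from Suc.IH[OF True Suc.prems(2), of a] show ?thesis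
      using delta_ge_1 by (fastforce simp: algebra_simps)
  next
    case False
    define m :: nat where "m = 2 ^ k"
    have m: "m < n" "0 < m" "n - m \<le> 2 ^ k" "m \<le> 2 ^ k"
      using False Suc.prems by (auto simp: m_def)
    have "gprod (a 0) (a m) y \<le> gprod (a 0) (a n) y + \<delta> \<or>
        gprod (a m) (a n) y \<le> gprod (a 0) (a n) y + \<delta>"
      using gprod_hyp[of "a 0" "a m" y "a n"] by (auto simp: min_def split: if_splits)
    then show ?thesis
    proof
      assume *: "gprod (a 0) (a m) y \<le> gprod (a 0) (a n) y + \<delta>"
      obtain i where "i < m" "gprod (a i) (a (Suc i)) y \<le> gprod (a 0) (a m) y + k * \<delta>"
        using Suc.IH[OF m(4,2)] by blast
      then show ?thesis using * m by (intro exI[of _ i]) (auto simp: algebra_simps)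
    next
      assume *: "gprod (a m) (a n) y \<le> gprod (a 0) (a n) y + \<delta>"
      obtain i where "i < n - m"
        "gprod (a (m + i)) (a (Suc (m + i))) y \<le> gprod (a m) (a n) y + k * \<delta>"
        using Suc.IH[OF m(3), of "\<lambda>i. a (m + i)"] m by auto
      then show ?thesis using * m by (intro exI[of _ "m + i"]) (auto simp: algebra_simps)
    qed
  qed
qed

text \<open>The excess of the distance over the product grows only with the logarithm of the number
  of steps. This estimate drives the stability of quasi-geodesics.\<close>

lemma near_chain_log:
  fixes a :: "nat \<Rightarrow> 'x"
  assumes "n \<le> 2 ^ k" and step: "\<And>i. i < n \<Longrightarrow> dist (a i) (a (Suc i)) \<le> M" and "0 \<le> M"
  shows "\<exists>i\<le>n. dist y (a i) \<le> gprod (a 0) (a n) y + k * \<delta> + M"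
proof (cases "n = 0")
  case True
  then show ?thesis using delta_ge_1 \<open>0 \<le> M\<close> by (auto simp: gprod_def dist_commute)
next
  case False
  then obtain i where i: "i < n" "gprod (a i) (a (Suc i)) y \<le> gprod (a 0) (a n) y + k * \<delta>"
    using gprod_split[OF assms(1)] by blast
  have "dist y (a i) \<le> gprod (a i) (a (Suc i)) y + M"
    using step[OF i(1)] dist_triangle[of "a i" y "a (Suc i)"]
    by (simp add: gprod_def dist_commute field_simps)
  then show ?thesis using i by (intro exI[of _ i]) auto
qed

end

section \<open>Stability of quasi-geodesics\<close>

lemma eventually_linear_le_power2: "\<exists>k0::nat. \<forall>k\<ge>k0. A + B * real k \<le> 2 ^ k"
proof -
  have "(\<lambda>k. A * (1 / 2) ^ k + B * (real k / 2 ^ k)) \<longlonglongrightarrow> A * 0 + B * 0"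
    using lim_n_over_pown[of "2::real"]
    by (intro tendsto_intros LIMSEQ_power_zero) auto
  then have "\<forall>\<^sub>F k in sequentially. A * (1 / 2) ^ k + B * (real k / 2 ^ k) < 1"
    by (intro order_tendstoD) auto
  then obtain k0 :: nat where "\<forall>k\<ge>k0. A * (1 / 2) ^ k + B * (real k / 2 ^ k) < 1"
    by (auto simp: eventually_sequentially)
  moreover have "A + B * real k \<le> 2 ^ k"
    if "A * (1 / 2) ^ k + B * (real k / 2 ^ k) < 1" for k
    using that by (simp add: field_simps power_one_over)
  ultimately show ?thesis by blast
qed

text \<open>A discrete quasi-geodesic with a single constant. The upper bound is required of single
  steps only, since it sums up; the lower bound is solved for the index difference, which avoids
  dividing by \<open>K\<close>.\<close>

definition quasi_chain :: "real \<Rightarrow> (nat \<Rightarrow> 'x::metric_space) \<Rightarrow> nat \<Rightarrow> bool"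
  where "quasi_chain K a n \<longleftrightarrow> (\<forall>i<n. dist (a i) (a (Suc i)) \<le> K) \<and>
    (\<forall>i j. i \<le> j \<longrightarrow> j \<le> n \<longrightarrow> real (j - i) \<le> K * dist (a i) (a j) + K)"

lemma quasi_chain_sub:
  assumes "quasi_chain K a n" "i \<le> j" "j \<le> n"
  shows "quasi_chain K (\<lambda>k. a (i + k)) (j - i)"
proof -
  have "real (l - k) \<le> K * dist (a (i + k)) (a (i + l)) + K" if "k \<le> l" "l \<le> j - i" for k l
  proof -
    have "i + k \<le> i + l" "i + l \<le> n" using that assms by auto
    then have "real ((i + l) - (i + k)) \<le> K * dist (a (i + k)) (a (i + l)) + K"
      using assms(1) unfolding quasi_chain_def by blast
    then show ?thesis by simp
  qed
  then show ?thesis using assms unfolding quasi_chain_def by auto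
qed

lemma chain_dist_le:
  fixes a :: "nat \<Rightarrow> 'x::metric_space"
  assumes "\<And>i. i < n \<Longrightarrow> dist (a i) (a (Suc i)) \<le> K" "i \<le> j" "j \<le> n"
  shows "dist (a i) (a j) \<le> K * real (j - i)"
  using assms(2,3)
proof (induction j rule: dec_induct)
  case (step l)
  then have "dist (a i) (a (Suc l)) \<le> K * real (l - i) + K"
    using assms(1)[of l] dist_triangle[of "a i" "a (Suc l)" "a l"] by simp
  then show ?case using step by (simp add: Suc_diff_le algebra_simps)
qed simp

context hyperbolic_space
begin

definition coarse_geod :: "(nat \<Rightarrow> 'x) \<Rightarrow> nat \<Rightarrow> bool"
  where "coarse_geod c n \<longleftrightarrow> (\<forall>i j. i \<le> j \<longrightarrow> j \<le> n \<longrightarrow>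
    dist (c i) (c j) \<le> real (j - i) \<and> real (j - i) \<le> dist (c i) (c j) + 4)"

lemma coarse_geodE:
  fixes x y :: 'x
  obtains c n where "c 0 = x" "c n = y" "coarse_geod c n"
  using coarse_geodesic[of x y] unfolding coarse_geod_def by blast

lemma coarse_geodD:
  assumes "coarse_geod c n" "i \<le> j" "j \<le> n"
  shows "dist (c i) (c j) \<le> real j - real i" "real j - real i \<le> dist (c i) (c j) + 4"
  using assms unfolding coarse_geod_def by (auto simp: of_nat_diff)

lemma coarse_geod_gprod:
  assumes "coarse_geod c n" "i \<le> j" "j \<le> k" "k \<le> n"
  shows "gprod (c i) (c k) (c j) \<le> 2"
  using coarse_geodD[OF assms(1), of i j] coarse_geodD[OF assms(1), of j k]
    coarse_geodD[OF assms(1), of i k] assms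
  by (simp add: gprod_def dist_commute)

text \<open>In the application \<open>R\<close> is the largest distance from the coarse geodesic to
  the chain, attained at \<open>c s\<close>. Chain points \<open>a i\<close> and \<open>a j\<close>
  are taken near two points of \<open>c\<close> about \<open>2 * R\<close> away on either side, or
  near its ends. They still see \<open>c s\<close> almost between them, and the piece of chain
  joining them has length linear in \<open>R\<close>, so \<open>near_chain_log\<close> finds a chain
  point at distance logarithmic in \<open>R\<close>.\<close>

lemma morse_aux:
  fixes a c :: "nat \<Rightarrow> 'x"
  assumes K: "1 \<le> K" and a: "quasi_chain K a n"
    and c: "coarse_geod c m" "c 0 = a 0" "c m = a n"
    and s: "s \<le> m" and R: "\<And>i. i \<le> n \<Longrightarrow> R \<le> dist (c s) (a i)"
    and near: "\<And>t. t \<le> m \<Longrightarrow> \<exists>i\<le>n. dist (c t) (a i) \<le> R"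
    and k: "K * (6 * R + 13) \<le> 2 ^ k"
  shows "R \<le> 2 + 2 * \<delta> + K + k * \<delta>"
proof (cases "R \<le> 2 + 2 * \<delta>")
  case True
  then show ?thesis using K delta_ge_1 by (smt (verit) mult_nonneg_nonneg of_nat_0_le_iff)
next
  case False
  define y where "y = c s"
  \<comment> \<open>The 4 is the additive error of a coarse geodesic: from \<open>q\<close> steps
    on, \<open>c t\<close> has distance at least \<open>2 * R\<close> from \<open>y\<close>, so
    \<open>c t\<close> and a chain point within \<open>R\<close> of it have product at least
    \<open>R\<close> at \<open>y\<close>.\<close>
  define q where "q = nat \<lceil>2 * R + 4\<rceil>"
  have R0: "R \<ge> 0" using False delta_ge_1 by linarith
  have q: "2 * R + 4 \<le> q" "q \<le> 2 * R + 5" using R0 unfolding q_def by linarith+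
  define s1 where "s1 = s - q"
  define s2 where "s2 = min m (s + q)"
  have s12: "s1 \<le> s" "s \<le> s2" "s2 \<le> m" using s by (auto simp: s1_def s2_def)
  have near': "\<exists>i\<le>n. dist (c t) (a i) \<le> R \<and> R \<le> gprod (c t) (a i) y"
    if t: "t \<le> m" "t = 0 \<or> t = m \<or> real q \<le> \<bar>real t - real s\<bar>" for t
    using t(2)
  proof (elim disjE)
    assume "t = 0"
    then show ?thesis using R[of 0] R0 c
      by (intro exI[of _ 0]) (auto simp: gprod_def y_def dist_commute)
  next
    assume "t = m"
    then show ?thesis using R[of n] R0 c
      by (intro exI[of _ n]) (auto simp: gprod_def y_def dist_commute)
  next
    assume far: "real q \<le> \<bar>real t - real s\<bar>"
    obtain i where i: "i \<le> n" "dist (c t) (a i) \<le> R" using near t by blast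
    have "2 * R \<le> dist (c t) y"
    proof (cases "t \<le> s")
      case True
      then show ?thesis using coarse_geodD[OF c(1) True s] far q by (simp add: y_def)
    next
      case False
      then show ?thesis using coarse_geodD[OF c(1), of s t] t far q
        by (simp add: y_def dist_commute)
    qed
    then show ?thesis using i R[OF i(1)]
      by (intro exI[of _ i]) (auto simp: gprod_def y_def dist_commute)
  qed
  have "s1 = 0 \<or> real q \<le> \<bar>real s1 - real s\<bar>" by (auto simp: s1_def)
  then obtain i where i: "i \<le> n" "dist (c s1) (a i) \<le> R" "R \<le> gprod (c s1) (a i) y"
    using near'[of s1] s12 by auto
  have "s2 = m \<or> real q \<le> \<bar>real s2 - real s\<bar>" by (auto simp: s2_def min_def)
  then obtain j where j: "j \<le> n" "dist (c s2) (a j) \<le> R" "R \<le> gprod (c s2) (a j) y"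
    using near'[of s2] s12 by auto
  have "gprod (c s1) (c s2) y \<le> 2"
    unfolding y_def using coarse_geod_gprod[OF c(1)] s12 by blast
  then have ij: "gprod (a i) (a j) y \<le> 2 + 2 * \<delta>"
    using gprod_hyp[of "c s1" "a i" y "c s2"] gprod_hyp[of "a i" "a j" y "c s2"] i(3) j(3) False
      delta_ge_1 by (auto simp: gprod_commute min_def split: if_splits)
  have "dist (c s1) (c s2) \<le> 2 * q"
    using coarse_geodD[OF c(1), of s1 s2] s12 unfolding s1_def s2_def by linarith
  then have dij: "dist (a i) (a j) \<le> 6 * R + 10 \<and> dist (a j) (a i) \<le> 6 * R + 10"
    using i(2) j(2) dist_triangle[of "a i" "a j" "c s1"] dist_triangle[of "c s1" "a j" "c s2"] q
    by (simp add: dist_commute)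
  have *: "\<exists>l\<le>n. dist y (a l) \<le> 2 + 2 * \<delta> + k * \<delta> + K"
    if "i \<le> j" "j \<le> n" "gprod (a i) (a j) y \<le> 2 + 2 * \<delta>" "dist (a i) (a j) \<le> 6 * R + 10" for i j
  proof -
    have sub: "quasi_chain K (\<lambda>k. a (i + k)) (j - i)"
      using quasi_chain_sub[OF a that(1,2)] .
    have "real (j - i) \<le> K * dist (a i) (a j) + K"
      using a that unfolding quasi_chain_def by blast
    also have "\<dots> \<le> K * (6 * R + 10) + K" using that K by simp
    also have "\<dots> \<le> K * (6 * R + 13)" using K by (simp add: algebra_simps)
    finally have "real (j - i) \<le> 2 ^ k" using k by linarith
    then have "j - i \<le> 2 ^ k" by (metis of_nat_le_iff of_nat_numeral of_nat_power)
    then obtain l where "l \<le> j - i"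
      "dist y (a (i + l)) \<le> gprod (a i) (a (i + (j - i))) y + k * \<delta> + K"
      using near_chain_log[of "j - i" k "\<lambda>k. a (i + k)" K y] sub K
      unfolding quasi_chain_def by auto
    then show ?thesis using that by (intro exI[of _ "i + l"]) auto
  qed
  have "\<exists>l\<le>n. dist y (a l) \<le> 2 + 2 * \<delta> + k * \<delta> + K"
  proof (cases "i \<le> j")
    case True then show ?thesis using * ij dij j by blast
  next
    case False then show ?thesis using *[of j i] ij dij i by (simp add: gprod_commute)
  qed
  then show ?thesis using R unfolding y_def by fastforce
qed

text \<open>\<open>morse_aux\<close> bounds the largest distance \<open>R\<close> by a multiple of
  its own logarithm. Since \<open>2 ^ k\<close> outgrows the linear bound on the chain length from
  \<open>k0\<close> on, \<open>R\<close> cannot exceed \<open>c0 + k0 * \<delta>\<close>.\<close>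

lemma geodesic_near_quasi_chain:
  assumes K: "1 \<le> K"
  shows "\<exists>R\<ge>0. \<forall>(a::nat \<Rightarrow> 'x) n c m. quasi_chain K a n \<longrightarrow> coarse_geod c m \<longrightarrow>
    c 0 = a 0 \<longrightarrow> c m = a n \<longrightarrow> (\<forall>s\<le>m. \<exists>i\<le>n. dist (c s) (a i) \<le> R)"
proof -
  define c0 where "c0 = 2 + 2 * \<delta> + K"
  obtain k0 :: nat where k0: "\<And>k. k \<ge> k0 \<Longrightarrow>
      K * (6 * (c0 + \<delta>) + 13) + (6 * K * \<delta>) * real k \<le> 2 ^ k"
    using eventually_linear_le_power2 by blast
  show ?thesis
  proof (intro exI[of _ "c0 + k0 * \<delta>"] conjI allI impI)
    show "0 \<le> c0 + k0 * \<delta>" using K delta_ge_1 by (simp add: c0_def)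
    fix a c :: "nat \<Rightarrow> 'x" and n m s
    assume a: "quasi_chain K a n" and c: "coarse_geod c m" "c 0 = a 0" "c m = a n" and s: "s \<le> m"
    define \<rho> where "\<rho> t = Min ((\<lambda>i. dist (c t) (a i)) ` {..n})" for t
    have \<rho>_le: "\<rho> t \<le> dist (c t) (a i)" if "i \<le> n" for t i
      unfolding \<rho>_def using that by (intro Min_le) auto
    have \<rho>_ex: "\<exists>i\<le>n. dist (c t) (a i) = \<rho> t" for t
    proof -
      have "\<rho> t \<in> (\<lambda>i. dist (c t) (a i)) ` {..n}"
        unfolding \<rho>_def by (intro Min_in) auto
      then show ?thesis by auto
    qed
    define R where "R = Max (\<rho> ` {..m})"
    have "R \<in> \<rho> ` {..m}" unfolding R_def by (intro Max_in) auto
    then obtain t where t: "t \<le> m" "R = \<rho> t" by auto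
    have R_ge: "\<rho> t \<le> R" if "t \<le> m" for t unfolding R_def using that by (intro Max_ge) auto
    have aux: "R \<le> c0 + k * \<delta>" if "K * (6 * R + 13) \<le> 2 ^ k" for k
      unfolding c0_def
    proof (rule morse_aux[OF K a c t(1) _ _ that])
      show "R \<le> dist (c t) (a i)" if "i \<le> n" for i using \<rho>_le[OF that] t by simp
      show "\<exists>i\<le>n. dist (c t) (a i) \<le> R" if "t \<le> m" for t
        using \<rho>_ex[of t] R_ge[OF that] by auto
    qed
    have "R \<le> c0 + k0 * \<delta>"
    proof (rule ccontr)
      assume big: "\<not> R \<le> c0 + k0 * \<delta>"
      \<comment> \<open>The largest \<open>k\<close> with \<open>c0 + k * \<delta> < R\<close>. As
        \<open>k0 \<le> k\<close>, the power \<open>2 ^ k\<close> already covers the chain length,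
        and \<open>aux\<close> contradicts the choice.\<close>
      define k where "k = nat (\<lceil>(R - c0) / \<delta>\<rceil> - 1)"
      have "real k0 < (R - c0) / \<delta>" using big delta_ge_1 by (simp add: field_simps)
      then have "int k0 < \<lceil>(R - c0) / \<delta>\<rceil>" by linarith
      then have k: "k0 \<le> k" "real k < (R - c0) / \<delta>" "(R - c0) / \<delta> \<le> real k + 1"
        unfolding k_def by linarith+
      then have k': "c0 + k * \<delta> < R" "R \<le> c0 + \<delta> + k * \<delta>"
        using delta_ge_1 by (auto simp: field_simps)
      have "K * (6 * R + 13) \<le> K * (6 * (c0 + \<delta> + k * \<delta>) + 13)" using k' K by simp
      also have "\<dots> = K * (6 * (c0 + \<delta>) + 13) + (6 * K * \<delta>) * real k"
        by (simp add: algebra_simps)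
      also have "\<dots> \<le> 2 ^ k" using k0 k by blast
      finally show False using aux k' by fastforce
    qed
    then show "\<exists>i\<le>n. dist (c s) (a i) \<le> c0 + k0 * \<delta>"
      using \<rho>_ex[of s] R_ge[OF s] by force
  qed
qed

text \<open>The first claim is a converse of \<open>geodesic_near_quasi_chain\<close> and rests on
  connectedness: along \<open>c\<close> the nearby chain points must pass from indices up to
  \<open>k\<close> to indices from \<open>k\<close> on, and where this happens two chain points on
  either side of \<open>a k\<close> are close together. In the second claim \<open>y\<close> is
  compared with a point of \<open>c\<close> at almost the same distance from \<open>a 0\<close>; the
  product enters twice with factor 2, through the difference of these distances and through
  \<open>dist_close_if_near_geodesic\<close>.\<close>

theorem morse:
  assumes K: "1 \<le> K"
  shows "\<exists>C\<ge>0. \<forall>(a::nat \<Rightarrow> 'x) n. quasi_chain K a n \<longrightarrow>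
    (\<forall>k\<le>n. gprod (a 0) (a n) (a k) \<le> C) \<and>
    (\<forall>y. \<exists>k\<le>n. dist y (a k) \<le> 4 * gprod (a 0) (a n) y + C)"
proof -
  obtain R where R: "R \<ge> 0" "\<And>(a::nat \<Rightarrow> 'x) n c m s. quasi_chain K a n \<Longrightarrow> coarse_geod c m \<Longrightarrow>
      c 0 = a 0 \<Longrightarrow> c m = a n \<Longrightarrow> s \<le> m \<Longrightarrow> \<exists>i\<le>n. dist (c s) (a i) \<le> R"
    using geodesic_near_quasi_chain[OF K] by metis
  define C where "C = 9 + 2 * \<delta> + R + K * (K * (2 * R + 2))"
  show ?thesis
  proof (intro exI[of _ C] conjI allI impI)
    show "0 \<le> C" using R K delta_ge_1 by (simp add: C_def)
    fix a :: "nat \<Rightarrow> 'x" and n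
    assume a: "quasi_chain K a n"
    obtain c m where c: "coarse_geod c m" "c 0 = a 0" "c m = a n"
      using coarse_geodE[of "a 0" "a n"] by metis
    have c_gprod: "gprod (a 0) (a n) (c s) \<le> 2" if "s \<le> m" for s
      using coarse_geod_gprod[OF c(1), of 0 s m] that c by simp
    note near = R(2)[OF a c]
    show "gprod (a 0) (a n) (a k) \<le> C" if k: "k \<le> n" for k
    proof -
      have "\<exists>s i j. s \<le> m \<and> i \<le> k \<and> k \<le> j \<and> j \<le> n \<and> dist (c s) (a i) \<le> R \<and>
          dist (a i) (a j) \<le> 2 * R + 1"
      proof (cases "\<exists>i\<le>k. dist (c m) (a i) \<le> R")
        case True
        then obtain i where "i \<le> k" "dist (c m) (a i) \<le> R" by blast
        then show ?thesis using R(1) k c(3)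
          by (intro exI[of _ m] exI[of _ i] exI[of _ n]) (auto simp: dist_commute)
      next
        case False
        \<comment> \<open>The first place of \<open>c\<close> without a nearby chain point of index
          at most \<open>k\<close>: one step earlier there still is one, and here only later indices
          remain.\<close>
        define s where "s = (LEAST s. \<not> (\<exists>i\<le>k. dist (c s) (a i) \<le> R))"
        have s: "\<not> (\<exists>i\<le>k. dist (c s) (a i) \<le> R)" unfolding s_def using False by (rule LeastI)
        have sm: "s \<le> m" unfolding s_def using False by (rule Least_le)
        have s0: "s \<noteq> 0" using s c(2) R(1) by (metis dist_self le0)
        have "\<exists>i\<le>k. dist (c (s - 1)) (a i) \<le> R"
          using not_less_Least[of "s - 1" "\<lambda>s. \<not> (\<exists>i\<le>k. dist (c s) (a i) \<le> R)"] s0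
          unfolding s_def[symmetric] by auto
        then obtain i where i: "i \<le> k" "dist (c (s - 1)) (a i) \<le> R" by blast
        obtain j where j: "j \<le> n" "dist (c s) (a j) \<le> R" using near sm by blast
        have "k \<le> j" using j s by (meson nle_le)
        moreover have "dist (c (s - 1)) (c s) \<le> 1"
          using coarse_geodD[OF c(1), of "s - 1" s] sm s0 by (simp add: of_nat_diff)
        then have "dist (a i) (a j) \<le> 2 * R + 1"
          using i j dist_triangle[of "a i" "a j" "c s"] dist_triangle[of "a i" "c s" "c (s - 1)"]
          by (simp add: dist_commute)
        ultimately show ?thesis using i j sm
          by (intro exI[of _ "s - 1"] exI[of _ i] exI[of _ j]) auto
      qed
      then obtain s i j where *: "s \<le> m" "i \<le> k" "k \<le> j" "j \<le> n" "dist (c s) (a i) \<le> R"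
          "dist (a i) (a j) \<le> 2 * R + 1" by blast
      have "real (k - i) \<le> real (j - i)" using * by simp
      also have "\<dots> \<le> K * dist (a i) (a j) + K"
        using a * unfolding quasi_chain_def by (meson order_trans)
      also have "\<dots> \<le> K * (2 * R + 1) + K" using * K by simp
      finally have "real (k - i) \<le> K * (2 * R + 2)" by (simp add: algebra_simps)
      then have "K * real (k - i) \<le> K * (K * (2 * R + 2))" using K by simp
      moreover have "dist (a i) (a k) \<le> K * real (k - i)"
        using a * by (intro chain_dist_le[of n]) (auto simp: quasi_chain_def)
      ultimately have "dist (c s) (a k) \<le> R + K * (K * (2 * R + 2))"
        using * dist_triangle[of "c s" "a k" "a i"] by simp
      then show ?thesis
        using gprod_perturb(3)[of "a 0" "a n" "c s" "a k"] c_gprod[OF *(1)] delta_ge_1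
        unfolding C_def by linarith
    qed
    show "\<exists>k\<le>n. dist y (a k) \<le> 4 * gprod (a 0) (a n) y + C" for y
    proof -
      define B where "B = gprod (a 0) (a n) y"
      have B0: "0 \<le> B" unfolding B_def by (rule gprod_nonneg)
      have "\<exists>s\<le>m. \<bar>dist (a 0) y - dist (a 0) (c s)\<bar> \<le> 5 + 2 * B"
      proof (cases "dist (a 0) y \<le> m")
        case True
        define s where "s = nat \<lfloor>dist (a 0) y\<rfloor>"
        have s: "s \<le> dist (a 0) y" "dist (a 0) y < s + 1" unfolding s_def by (simp_all, linarith)
        then have "s \<le> m" using True by linarith
        then show ?thesis using coarse_geodD[OF c(1), of 0 s] s c(2) B0
          by (intro exI[of _ s]) auto
      next
        case False
        have "dist (a 0) y \<le> dist (a 0) (a n) + 2 * B"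
          using zero_le_dist[of "a n" y] by (simp add: B_def gprod_def field_simps)
        then show ?thesis using False c coarse_geodD[OF c(1), of 0 m] B0
          by (intro exI[of _ m]) auto
      qed
      then obtain s where s: "s \<le> m" "\<bar>dist (a 0) y - dist (a 0) (c s)\<bar> \<le> 5 + 2 * B" by blast
      have "dist y (c s) \<le> \<bar>dist (a 0) y - dist (a 0) (c s)\<bar> + 2 * (B + 2) + 2 * \<delta>"
        using c_gprod[OF s(1)] B0
        by (intro dist_close_if_near_geodesic[of "a 0" "a n"]) (auto simp: B_def)
      moreover obtain i where "i \<le> n" "dist (c s) (a i) \<le> R" using near s by blast
      moreover have "0 \<le> K * (K * (2 * R + 2))" using K R by simp
      ultimately show ?thesis using s dist_triangle[of y "a i" "c s"]
        by (intro exI[of _ i]) (auto simp: C_def B_def)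
    qed
  qed
qed

end

section \<open>Metric graphs\<close>

lemma edge_chain_nonneg: "edge_chain E \<chi> x y l \<Longrightarrow> 0 \<le> l"
  by (induction rule: edge_chain.induct) auto

context metric_graph
begin

text \<open>Walks along whole edges have integral length. This turns the infimum in
  \<open>path_metric\<close> into a minimum and so provides geodesics between vertices.\<close>

inductive vertex_walk :: "'x \<Rightarrow> 'x \<Rightarrow> nat \<Rightarrow> bool"
  where
    walk_nil: "v \<in> V \<Longrightarrow> vertex_walk v v 0"
  | walk_fwd: "e \<in> E \<Longrightarrow> vertex_walk (\<chi> e 1) y n \<Longrightarrow> vertex_walk (\<chi> e 0) y (Suc n)"
  | walk_bwd: "e \<in> E \<Longrightarrow> vertex_walk (\<chi> e 0) y n \<Longrightarrow> vertex_walk (\<chi> e 1) y (Suc n)"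

lemma vertex_walk_in_V: "vertex_walk u v n \<Longrightarrow> u \<in> V"
  by (induction rule: vertex_walk.induct) (auto simp: endpoints)

lemma dist_le_edge_chain:
  assumes "edge_chain E \<chi> x y l"
  shows "dist x y \<le> l"
proof -
  have "bdd_below {l. edge_chain E \<chi> x y l}"
    by (auto intro!: bdd_belowI[of _ 0] edge_chain_nonneg)
  then show ?thesis unfolding path_metric using assms by (intro cInf_lower) auto
qed

lemma dist_on_edge:
  assumes "e \<in> E" "s \<in> {0..1}" "t \<in> {0..1}"
  shows "dist (\<chi> e s) (\<chi> e t) \<le> \<bar>s - t\<bar>"
  using dist_le_edge_chain[OF edge_chain.cons[OF assms edge_chain.nil]] by simp

lemma interior_notin_V: "e \<in> E \<Longrightarrow> 0 < s \<Longrightarrow> s < 1 \<Longrightarrow> \<chi> e s \<notin> V"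
  using bij_betw_imp_surj_on[OF open_edges] by fastforce

lemma interior_inj:
  assumes "e \<in> E" "0 < s" "s < 1" "e' \<in> E" "s' \<in> {0..1}" "\<chi> e s = \<chi> e' s'"
  shows "e = e' \<and> s = s'"
proof -
  have "s' \<noteq> 0" "s' \<noteq> 1" using interior_notin_V[OF assms(1-3)] endpoints[OF assms(4)] assms(6) by auto
  then have "(e', s') \<in> E \<times> {0<..<1}" "(e, s) \<in> E \<times> {0<..<1}" using assms by auto
  then show ?thesis
    using bij_betw_imp_inj_on[OF open_edges] assms(6) unfolding inj_on_def by fastforce
qed

lemma not_in_V:
  assumes "x \<notin> V"
  obtains e s where "e \<in> E" "0 < s" "s < 1" "x = \<chi> e s"
proof -
  have "x \<in> (\<lambda>(e, t). \<chi> e t) ` (E \<times> {0<..<1})"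
    using bij_betw_imp_surj_on[OF open_edges] assms by auto
  then show ?thesis using that by auto
qed

lemma near_vertex: "\<exists>v\<in>V. dist x v \<le> 1"
proof (cases "x \<in> V")
  case True
  then show ?thesis by (intro bexI[of _ x]) auto
next
  case False
  then obtain e s where e: "e \<in> E" "0 < s" "s < 1" "x = \<chi> e s" by (rule not_in_V)
  then show ?thesis using dist_on_edge[of e s 0] endpoints by (intro bexI[of _ "\<chi> e 0"]) auto
qed

text \<open>\<open>r\<close> is the length still to be travelled inside one edge from
  \<open>x\<close> to the vertex \<open>v\<close>. The first disjunct serves the empty chain, where
  no edge at \<open>x\<close> is at hand.\<close>

definition edge_offset :: "'x \<Rightarrow> 'x \<Rightarrow> real \<Rightarrow> bool"
  where "edge_offset x v r \<longleftrightarrow> (x = v \<and> r = 0) \<or>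
    (\<exists>e\<in>E. \<exists>s\<in>{0..1}. x = \<chi> e s \<and> (v = \<chi> e 0 \<and> r = s \<or> v = \<chi> e 1 \<and> r = 1 - s))"

lemma walk_of_edge_offset:
  assumes "edge_offset x v r" "x \<in> V" "vertex_walk v y n"
  shows "\<exists>m. vertex_walk x y m \<and> real m \<le> r + real n"
proof -
  have ends: "s = 0 \<or> s = 1" if "e \<in> E" "s \<in> {0..1}" "x = \<chi> e s" for e s
    using interior_notin_V[of e s] that assms(2) by fastforce
  from assms(1) consider "x = v" "r = 0" | e where "e \<in> E" "x = \<chi> e 1" "v = \<chi> e 0" "r = 1"
    | e where "e \<in> E" "x = \<chi> e 0" "v = \<chi> e 1" "r = 1"
    unfolding edge_offset_def using ends by force
  then show ?thesis
  proof cases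
    case 1
    then show ?thesis using assms(3) by (intro exI[of _ n]) auto
  next
    case 2
    then show ?thesis using assms(3) walk_bwd by (intro exI[of _ "Suc n"]) auto
  next
    case 3
    then show ?thesis using assms(3) walk_fwd by (intro exI[of _ "Suc n"]) auto
  qed
qed

text \<open>A chain may turn around inside an edge, so the induction keeps the length inside the
  current edge apart as \<open>r\<close>. If the next point is interior, the vertex \<open>v\<close>
  is an end of the same edge and the offset changes by at most \<open>\<bar>s - t\<bar>\<close>; if
  it is an end of the edge, the remaining offset is first completed to a walk.\<close>

lemma walk_of_edge_chain:
  assumes "edge_chain E \<chi> x y l" "y \<in> V"
  shows "\<exists>v n r. vertex_walk v y n \<and> r + real n \<le> l \<and> edge_offset x v r"
  using assms
proof (induction rule: edge_chain.induct)
  case (nil x)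
  then show ?case
    by (intro exI[of _ x] exI[of _ 0]) (auto intro: walk_nil simp: edge_offset_def)
next
  case (cons e s t y l)
  obtain v n r where IH: "vertex_walk v y n" "r + real n \<le> l" "edge_offset (\<chi> e t) v r"
    using cons by blast
  have off: "edge_offset (\<chi> e s) (\<chi> e 0) s" "edge_offset (\<chi> e s) (\<chi> e 1) (1 - s)"
    unfolding edge_offset_def using cons.hyps(1,2) by blast+
  show ?case
  proof (cases "t = 0 \<or> t = 1")
    case True
    then have "\<chi> e t \<in> V" using endpoints cons by auto
    then obtain n' where n': "vertex_walk (\<chi> e t) y n'" "real n' \<le> l"
      using walk_of_edge_offset[OF IH(3) _ IH(1)] IH(2) by fastforce
    have "edge_offset (\<chi> e s) (\<chi> e t) \<bar>s - t\<bar>" using off True cons.hyps(2) by auto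
    then show ?thesis using n'
      by (intro exI[of _ "\<chi> e t"] exI[of _ n'] exI[of _ "\<bar>s - t\<bar>"]) auto
  next
    case False
    then have t: "0 < t" "t < 1" using cons by auto
    have "v \<in> V" using IH(1) vertex_walk_in_V by blast
    then have "v = \<chi> e 0 \<and> r = t \<or> v = \<chi> e 1 \<and> r = 1 - t"
      using IH(3) interior_inj[OF cons.hyps(1) t] interior_notin_V[OF cons.hyps(1) t]
      unfolding edge_offset_def by blast
    then show ?thesis
    proof
      assume "v = \<chi> e 0 \<and> r = t"
      then show ?thesis using IH off by (intro exI[of _ v] exI[of _ n] exI[of _ s]) auto
    next
      assume "v = \<chi> e 1 \<and> r = 1 - t"
      then show ?thesis using IH off by (intro exI[of _ v] exI[of _ n] exI[of _ "1 - s"]) auto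
    qed
  qed
qed

lemma walk_of_edge_chain_vertex:
  assumes "edge_chain E \<chi> x y l" "x \<in> V" "y \<in> V"
  shows "\<exists>n. vertex_walk x y n \<and> real n \<le> l"
  using walk_of_edge_chain[OF assms(1,3)] walk_of_edge_offset[OF _ assms(2)] by fastforce

lemma edge_chain_of_walk: "vertex_walk u v n \<Longrightarrow> edge_chain E \<chi> u v (real n)"
proof (induction rule: vertex_walk.induct)
  case (walk_fwd e y n)
  then show ?case using edge_chain.cons[of e E 0 1 \<chi> y "real n"] by (simp add: add.commute)
next
  case (walk_bwd e y n)
  then show ?case using edge_chain.cons[of e E 1 0 \<chi> y "real n"] by (simp add: add.commute)
qed (auto intro: edge_chain.nil simp: edge_chain.nil)

lemma shortest_walk:
  assumes "u \<in> V" "v \<in> V"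
  shows "\<exists>n. vertex_walk u v n \<and> dist u v = real n"
proof -
  obtain l where "edge_chain E \<chi> u v l" using chain_connected by blast
  then have ex: "\<exists>n. vertex_walk u v n" using walk_of_edge_chain_vertex assms by blast
  define n where "n = (LEAST n. vertex_walk u v n)"
  have n: "vertex_walk u v n" unfolding n_def using ex by (rule LeastI_ex)
  have "real n \<le> l" if l: "edge_chain E \<chi> u v l" for l
  proof -
    obtain m where m: "vertex_walk u v m" "real m \<le> l"
      using walk_of_edge_chain_vertex[OF l assms] by blast
    have "n \<le> m" unfolding n_def using m(1) by (rule Least_le)
    then show ?thesis using m by simp
  qed
  then have "dist u v = real n"
    unfolding path_metric using edge_chain_of_walk[OF n] by (intro cInf_eq_minimum) auto
  then show ?thesis using n by blast
qed

lemma walk_path: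
  "vertex_walk u v n \<Longrightarrow> \<exists>c. c 0 = u \<and> c (real n) = v \<and>
    (\<forall>s\<in>{0..real n}. \<forall>t\<in>{0..real n}. dist (c s) (c t) \<le> \<bar>s - t\<bar>)"
proof (induction rule: vertex_walk.induct)
  case (walk_nil v)
  then show ?case by (intro exI[of _ "\<lambda>_. v"]) auto
next
  have ext: "\<exists>c. c 0 = f 0 \<and> c (real (Suc n)) = y \<and>
      (\<forall>s\<in>{0..real (Suc n)}. \<forall>t\<in>{0..real (Suc n)}. dist (c s) (c t) \<le> \<bar>s - t\<bar>)"
    if c: "c 0 = f 1" "c (real n) = y"
      "\<forall>s\<in>{0..real n}. \<forall>t\<in>{0..real n}. dist (c s) (c t) \<le> \<bar>s - t\<bar>"
      and f: "\<And>s t. s \<in> {0..1} \<Longrightarrow> t \<in> {0..1} \<Longrightarrow> dist (f s) (f t) \<le> \<bar>s - t\<bar>"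
    for c f and y :: 'x and n :: nat
  proof -
    define c' where "c' s = (if s \<le> 1 then f s else c (s - 1))" for s :: real
    have *: "dist (c' s) (c' t) \<le> t - s" if "0 \<le> s" "s \<le> t" "t \<le> real n + 1" for s t
    proof (cases "t \<le> 1")
      case True then show ?thesis using that f[of s t] by (auto simp: c'_def)
    next
      case t: False
      show ?thesis
      proof (cases "s \<le> 1")
        case True
        have "dist (f s) (f 1) \<le> 1 - s" using f[of s 1] True that by auto
        moreover have "dist (f 1) (c (t - 1)) \<le> t - 1"
          using c(3)[rule_format, of 0 "t - 1"] c(1) t that by auto
        ultimately show ?thesis using True t dist_triangle[of "f s" "c (t - 1)" "f 1"]
          by (simp add: c'_def)
      next
        case False
        then show ?thesis using c(3)[rule_format, of "s - 1" "t - 1"] t that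
          by (auto simp: c'_def)
      qed
    qed
    have **: "dist (c' s) (c' t) \<le> \<bar>s - t\<bar>"
      if "s \<in> {0..real (Suc n)}" "t \<in> {0..real (Suc n)}" for s t
      using *[of s t] *[of t s] that by (cases "s \<le> t") (auto simp: dist_commute)
    moreover have "c' (real (Suc n)) = y" using c by (cases "n = 0") (auto simp: c'_def)
    ultimately show ?thesis by (intro exI[of _ c']) (auto simp: c'_def)
  qed
  {
    case (walk_fwd e y n)
    then show ?case using ext[of _ "\<chi> e" n y] dist_on_edge by auto
  next
    case (walk_bwd e y n)
    then obtain c where "c 0 = \<chi> e 0" "c (real n) = y"
      "\<forall>s\<in>{0..real n}. \<forall>t\<in>{0..real n}. dist (c s) (c t) \<le> \<bar>s - t\<bar>" by blast
    moreover have "dist (\<chi> e (1 - s)) (\<chi> e (1 - t)) \<le> \<bar>s - t\<bar>"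
      if "s \<in> {0..1}" "t \<in> {0..1}" for s t
      using dist_on_edge[of e "1 - s" "1 - t"] walk_bwd.hyps that by auto
    ultimately show ?case using ext[of c "\<lambda>s. \<chi> e (1 - s)" n y] by simp
  }
qed

text \<open>A path that does not increase distances and whose length equals the distance of its ends
  is isometric, because a shortening in between would shorten the whole.\<close>

lemma vertex_geodesic:
  assumes "u \<in> V" "v \<in> V"
  shows "\<exists>c n. c 0 = u \<and> c (real n) = v \<and>
    (\<forall>s\<in>{0..real n}. \<forall>t\<in>{0..real n}. dist (c s) (c t) = \<bar>s - t\<bar>)"
proof -
  obtain n where n: "vertex_walk u v n" "dist u v = real n" using shortest_walk assms by blast
  obtain c where c: "c 0 = u" "c (real n) = v"
    "\<forall>s\<in>{0..real n}. \<forall>t\<in>{0..real n}. dist (c s) (c t) \<le> \<bar>s - t\<bar>"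
    using walk_path[OF n(1)] by blast
  have "\<bar>s - t\<bar> \<le> dist (c s) (c t)" if "s \<in> {0..real n}" "t \<in> {0..real n}" for s t
    using c(3)[rule_format, of 0 s] c(3)[rule_format, of t "real n"]
      c(3)[rule_format, of 0 t] c(3)[rule_format, of s "real n"] that c(1,2) n(2)
      dist_triangle[of u v "c s"] dist_triangle[of "c s" v "c t"]
      dist_triangle[of u v "c t"] dist_triangle[of "c t" v "c s"]
    by (simp add: dist_commute abs_if split: if_splits)
  then show ?thesis using c by (intro exI[of _ c] exI[of _ n]) (auto intro: antisym)
qed

lemma geodesic_arc_image:
  fixes c :: "real \<Rightarrow> 'x"
  assumes "\<forall>s\<in>{0..real n}. \<forall>t\<in>{0..real n}. dist (c s) (c t) = \<bar>s - t\<bar>"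
  shows "geodesic_arc (c ` {0..real n}) (c 0) (c (real n))"
  unfolding geodesic_arc_def using assms by (intro exI[of _ c] exI[of _ "real n"]) auto

lemma geodesic_arc_sum:
  assumes "geodesic_arc A x y" "q \<in> A"
  shows "dist x q + dist q y = dist x y"
proof -
  obtain c l where c: "0 \<le> l" "c 0 = x" "c l = y" "A = c ` {0..l}"
    "\<And>s t. s \<in> {0..l} \<Longrightarrow> t \<in> {0..l} \<Longrightarrow> dist (c s) (c t) = \<bar>s - t\<bar>"
    using assms(1) unfolding geodesic_arc_def by blast
  obtain s where s: "s \<in> {0..l}" "q = c s" using assms(2) c by blast
  show ?thesis using c(5)[of 0 s] c(5)[of s l] c(5)[of 0 l] c s by auto
qed

lemma vertex_arc:
  assumes "u \<in> V" "v \<in> V"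
  shows "\<exists>A. geodesic_arc A u v \<and> u \<in> A \<and> v \<in> A"
proof -
  obtain c n where c: "c 0 = u" "c (real n) = v"
    "\<forall>s\<in>{0..real n}. \<forall>t\<in>{0..real n}. dist (c s) (c t) = \<bar>s - t\<bar>"
    using vertex_geodesic[OF assms] by blast
  show ?thesis using geodesic_arc_image[OF c(3)] c by (intro exI[of _ "c ` {0..real n}"]) force
qed

text \<open>Walking from \<open>y\<close> to \<open>z\<close>, take the first integer time at which
  the point is within \<open>\<delta>\<close> of the side \<open>B\<close>; one step earlier
  slimness puts it near \<open>D\<close>. Such a point is close to both sides ending at
  \<open>x\<close>, and adding the two triangle inequalities bounds its distance from
  \<open>x\<close> by the product.\<close>

lemma gprod_approx_on_arc:
  assumes hyp: "delta_hyperbolic TYPE('x) \<delta>" and "x \<in> V" "y \<in> V" "z \<in> V"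
  shows "\<exists>A p. geodesic_arc A y z \<and> p \<in> A \<and> dist x p \<le> gprod y z x + 2 * \<delta> + 1"
proof -
  obtain c n where c: "c 0 = y" "c (real n) = z"
    "\<forall>s\<in>{0..real n}. \<forall>t\<in>{0..real n}. dist (c s) (c t) = \<bar>s - t\<bar>"
    using vertex_geodesic assms by blast
  define A where "A = c ` {0..real n}"
  have A: "geodesic_arc A y z" unfolding A_def using geodesic_arc_image[OF c(3)] c by simp
  obtain B where B: "geodesic_arc B z x" "z \<in> B" using vertex_arc assms by blast
  obtain D where D: "geodesic_arc D x y" "y \<in> D" using vertex_arc assms by blast
  have slim: "\<exists>q\<in>B \<union> D. dist p q \<le> \<delta>" if "p \<in> A" for p
    using hyp A B(1) D(1) that unfolding delta_hyperbolic_def by blast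
  have "c 0 \<in> A" unfolding A_def by auto
  then have \<delta>0: "0 \<le> \<delta>" using slim[of "c 0"] by (meson dual_order.trans zero_le_dist)
  define P where "P i \<longleftrightarrow> (\<exists>q\<in>B. dist (c (real i)) q \<le> \<delta>)" for i :: nat
  define i where "i = (LEAST i. P i)"
  have Pn: "P n" unfolding P_def using B(2) c(2) \<delta>0 by (metis dist_self)
  have Pi: "P i" unfolding i_def using Pn by (rule LeastI)
  have i_le: "i \<le> n" unfolding i_def using Pn by (rule Least_le)
  obtain q2 where q2: "q2 \<in> B" "dist (c (real i)) q2 \<le> \<delta>" using Pi unfolding P_def by blast
  have "\<exists>q1\<in>D. dist (c (real i)) q1 \<le> \<delta> + 1"
  proof (cases "i = 0")
    case True
    then show ?thesis using D(2) c(1) \<delta>0 by (intro bexI[of _ y]) auto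
  next
    case False
    then have "\<not> P (i - 1)" using not_less_Least[of "i - 1" P] unfolding i_def[symmetric] by simp
    moreover have "c (real (i - 1)) \<in> A" unfolding A_def using i_le by auto
    ultimately obtain q1 where q1: "q1 \<in> D" "dist (c (real (i - 1))) q1 \<le> \<delta>"
      using slim unfolding P_def by blast
    have "dist (c (real i)) (c (real (i - 1))) = 1"
      using c(3) i_le False by (auto simp: of_nat_diff)
    then show ?thesis using q1 dist_triangle[of "c (real i)" q1 "c (real (i - 1))"]
      by (intro bexI[of _ q1]) auto
  qed
  then obtain q1 where q1: "q1 \<in> D" "dist (c (real i)) q1 \<le> \<delta> + 1" by blast
  define p where "p = c (real i)"
  have "p \<in> A" unfolding p_def A_def using i_le by auto
  moreover have "dist x p \<le> gprod y z x + 2 * \<delta> + 1"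
    using geodesic_arc_sum[OF B(1) q2(1)] geodesic_arc_sum[OF D(1) q1(1)] q1 q2
      dist_triangle[of x p q1] dist_triangle[of p y q1] dist_triangle[of x p q2]
      dist_triangle[of z p q2] dist_triangle[of y z p]
    unfolding p_def[symmetric] by (simp add: gprod_def dist_commute field_simps)
  ultimately show ?thesis using A by blast
qed

lemma gprod_le_dist_arc:
  assumes "geodesic_arc A x y" "q \<in> A"
  shows "gprod x y w \<le> dist w q"
  using geodesic_arc_sum[OF assms] dist_triangle[of x w q] dist_triangle[of y w q]
  by (simp add: gprod_def dist_commute)

text \<open>Some point \<open>p\<close> on a geodesic from \<open>x\<close> to \<open>z\<close> is
  no farther from \<open>w\<close> than the product plus \<open>2 * \<delta> + 1\<close>. Slimness
  moves it by \<open>\<delta>\<close> onto another side, and every point of that side is at least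
  the product of its ends away from \<open>w\<close>.\<close>

lemma gprod_hyp_vertices:
  assumes hyp: "delta_hyperbolic TYPE('x) \<delta>" and V: "x \<in> V" "y \<in> V" "z \<in> V" "w \<in> V"
  shows "min (gprod x y w) (gprod y z w) - (3 * \<delta> + 1) \<le> gprod x z w"
proof -
  obtain A p where A: "geodesic_arc A x z" "p \<in> A" "dist w p \<le> gprod x z w + 2 * \<delta> + 1"
    using gprod_approx_on_arc[OF hyp] V by blast
  obtain B where B: "geodesic_arc B z y" using vertex_arc V by blast
  obtain D where D: "geodesic_arc D y x" using vertex_arc V by blast
  obtain q where q: "q \<in> B \<union> D" "dist p q \<le> \<delta>"
    using hyp A B D unfolding delta_hyperbolic_def by blast
  have "min (gprod x y w) (gprod y z w) \<le> dist w q"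
    using q gprod_le_dist_arc[OF B, of q w] gprod_le_dist_arc[OF D, of q w]
    by (auto simp: gprod_commute)
  then show ?thesis using A q dist_triangle[of w q p] by linarith
qed

text \<open>Moving four points to vertices changes each distance by at most 2, hence each side of
  the four-point condition by at most 4, for which the constant leaves room. The absolute value
  keeps the constant at least 1 whatever the sign of \<open>\<delta>\<close>.\<close>

lemma hyperbolic_space_metric_graph:
  assumes hyp: "delta_hyperbolic TYPE('x) \<delta>"
  shows "hyperbolic_space TYPE('x) (3 * \<bar>\<delta>\<bar> + 8)"
proof
  show "1 \<le> 3 * \<bar>\<delta>\<bar> + 8" by simp
  show "dist x y + dist z w \<le> max (dist x z + dist y w) (dist x w + dist y z)
      + 2 * (3 * \<bar>\<delta>\<bar> + 8)" for x y z w :: 'x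
  proof -
    obtain x' y' z' w' where *: "x' \<in> V" "y' \<in> V" "z' \<in> V" "w' \<in> V"
      "dist x x' \<le> 1" "dist y y' \<le> 1" "dist z z' \<le> 1" "dist w w' \<le> 1"
      using near_vertex by metis
    have d: "\<bar>dist a b - dist a' b'\<bar> \<le> 2" if "dist a a' \<le> 1" "dist b b' \<le> 1" for a b a' b' :: 'x
      using that dist_triangle[of a b a'] dist_triangle[of a' b b'] dist_triangle[of a' b' a]
        dist_triangle[of a b' b] by (simp add: dist_commute abs_if)
    have "dist x' y' + dist z' w' \<le> max (dist x' z' + dist y' w') (dist x' w' + dist y' z')
        + 2 * (3 * \<delta> + 1)"
      using gprod_hyp_vertices[OF hyp *(1,3,2,4)]
      by (simp add: gprod_def dist_commute min_def max_def field_simps split: if_splits)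
    then show ?thesis
      using d[OF *(5,6)] d[OF *(7,8)] d[OF *(5,7)] d[OF *(6,8)] d[OF *(5,8)] d[OF *(6,7)]
      by (simp add: max_def abs_if split: if_splits)
  qed
  show "\<exists>c n. c 0 = x \<and> c n = y \<and> (\<forall>i j. i \<le> j \<longrightarrow> j \<le> n \<longrightarrow>
      dist (c i) (c j) \<le> real (j - i) \<and> real (j - i) \<le> dist (c i) (c j) + 4)" for x y :: 'x
  proof -
    obtain u v where uv: "u \<in> V" "v \<in> V" "dist x u \<le> 1" "dist y v \<le> 1" using near_vertex by metis
    obtain c n where c: "c 0 = u" "c (real n) = v"
      "\<And>s t. s \<in> {0..real n} \<Longrightarrow> t \<in> {0..real n} \<Longrightarrow> dist (c s) (c t) = \<bar>s - t\<bar>"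
      using vertex_geodesic[OF uv(1,2)] by blast
    \<comment> \<open>The geodesic between the vertices is traversed with its index shifted by one,
      with \<open>x\<close> put in front and \<open>y\<close> behind. Its length \<open>n\<close>
      differs from \<open>dist x y\<close> by at most 2, so \<open>n + 2\<close> steps exceed the
      distance by at most 4.\<close>
    define c' where "c' i = (if i = 0 then x else if i \<le> n + 1 then c (real (i - 1)) else y)"
      for i :: nat
    have x: "dist x (c (real k)) \<le> real k + 1" "real k \<le> dist x (c (real k)) + 1" if "k \<le> n" for k
      using c(3)[of 0 "real k"] that uv(3) c(1) dist_triangle[of x "c (real k)" u]
        dist_triangle[of u "c (real k)" x] by (auto simp: dist_commute)
    have y: "dist (c (real k)) y \<le> real n - real k + 1" "real n - real k \<le> dist (c (real k)) y + 1"
      if "k \<le> n" for k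
      using c(3)[of "real k" "real n"] that uv(4) c(2) dist_triangle[of "c (real k)" y v]
        dist_triangle[of "c (real k)" v y] by (auto simp: dist_commute)
    have xy: "dist x y \<le> real n + 2" "real n \<le> dist x y + 2"
      using x[of n] c(2) uv(4) dist_triangle[of x y v] dist_triangle[of x v y]
      by (auto simp: dist_commute)
    have mid: "dist (c (real k)) (c (real l)) = real l - real k" if "k \<le> l" "l \<le> n" for k l
      using c(3)[of "real k" "real l"] that by auto
    have "dist (c' i) (c' j) \<le> real (j - i) \<and> real (j - i) \<le> dist (c' i) (c' j) + 4"
      if "i \<le> j" "j \<le> n + 2" for i j
    proof -
      have "i = j \<or> (i = 0 \<and> 0 < j \<and> j \<le> n + 1) \<or> (i = 0 \<and> j = n + 2)
          \<or> (0 < i \<and> i \<le> n + 1 \<and> i \<le> j \<and> j \<le> n + 1)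
          \<or> (0 < i \<and> i \<le> n + 1 \<and> j = n + 2)" using that by presburger
      then consider "i = j" | "i = 0" "0 < j" "j \<le> n + 1" | "i = 0" "j = n + 2"
        | "0 < i" "i \<le> n + 1" "i \<le> j" "j \<le> n + 1" | "0 < i" "i \<le> n + 1" "j = n + 2"
        by blast
      then show ?thesis
      proof cases
        case 2
        then have "j - 1 \<le> n" "real (j - 1) = real j - 1" by (auto simp: of_nat_diff)
        then show ?thesis using x[of "j - 1"] 2 by (auto simp: c'_def)
      next
        case 3
        then show ?thesis using xy by (auto simp: c'_def)
      next
        case 4
        then have "i - 1 \<le> j - 1" "j - 1 \<le> n" "real (j - 1) = real j - 1"
          "real (i - 1) = real i - 1" by (auto simp: of_nat_diff)
        then show ?thesis using mid[of "i - 1" "j - 1"] 4 by (auto simp: c'_def of_nat_diff)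
      next
        case 5
        then have "i - 1 \<le> n" "real (i - 1) = real i - 1" by (auto simp: of_nat_diff)
        then show ?thesis using y[of "i - 1"] 5 by (auto simp: c'_def of_nat_diff)
      qed simp
    qed
    then show ?thesis by (intro exI[of _ c'] exI[of _ "n + 2"]) (auto simp: c'_def)
  qed
qed

end

section \<open>Broken geodesics: from local to global\<close>

context hyperbolic_space
begin

text \<open>A long edge hides the past: if the product at \<open>b (Suc k)\<close> is small, then
  from the next corner \<open>b i\<close> and \<open>b (Suc k)\<close> are seen in the same
  direction. The turn at that corner therefore also bounds the product with \<open>b i\<close>, at
  the cost of one \<open>\<delta>\<close> that does not accumulate.\<close>

lemma broken_geodesic_forward:
  fixes b :: "nat \<Rightarrow> 'x"
  assumes corner: "\<And>k. Suc k < n \<Longrightarrow> gprod (b k) (b (Suc (Suc k))) (b (Suc k)) \<le> C"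
    and long: "\<And>k. k < n \<Longrightarrow> 2 * C + 3 * \<delta> < dist (b k) (b (Suc k))"
    and "i \<le> k" "Suc k < n"
  shows "gprod (b i) (b (Suc (Suc k))) (b (Suc k)) \<le> C + \<delta>"
  using assms(3,4)
proof (induction k rule: dec_induct)
  case base
  then show ?case using corner[of i] delta_ge_1 by simp
next
  case (step k)
  have "gprod (b i) (b (Suc (Suc k))) (b (Suc k)) \<le> C + \<delta>" using step by simp
  then have "C + 2 * \<delta> < gprod (b (Suc k)) (b i) (b (Suc (Suc k)))"
    using long[of "Suc k"] step.prems
      gprod_switch[of "b (Suc k)" "b i" "b (Suc (Suc k))"]
    by (simp add: gprod_commute dist_commute)
  then show ?case
    using gprod_hyp[of "b (Suc k)" "b i" "b (Suc (Suc k))" "b (Suc (Suc (Suc k)))"]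
      corner[of "Suc k"] step.prems delta_ge_1 by (simp add: min_def split: if_splits)
qed

lemma broken_geodesic_backward:
  fixes b :: "nat \<Rightarrow> 'x"
  assumes corner: "\<And>k. Suc k < n \<Longrightarrow> gprod (b k) (b (Suc (Suc k))) (b (Suc k)) \<le> C"
    and long: "\<And>k. k < n \<Longrightarrow> 2 * C + 3 * \<delta> < dist (b k) (b (Suc k))"
    and "Suc k \<le> j" "Suc j \<le> n"
  shows "gprod (b k) (b (Suc j)) (b (Suc k)) \<le> C + \<delta>"
  using assms(3,4)
proof (induction "j - Suc k" arbitrary: k)
  case 0
  then show ?case using corner[of k] delta_ge_1 by (auto simp: le_Suc_eq)
next
  case (Suc d)
  have "gprod (b (Suc k)) (b (Suc j)) (b (Suc (Suc k))) \<le> C + \<delta>"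
    using Suc by simp
  then have "C + 2 * \<delta> < gprod (b (Suc (Suc k))) (b (Suc j)) (b (Suc k))"
    using long[of "Suc k"] Suc gprod_switch[of "b (Suc (Suc k))" "b (Suc j)" "b (Suc k)"]
    by (simp add: gprod_commute dist_commute)
  then show ?case
    using gprod_hyp[of "b k" "b (Suc j)" "b (Suc k)" "b (Suc (Suc k))"]
      corner[of k] Suc delta_ge_1 by (simp add: min_def gprod_commute split: if_splits)
qed

text \<open>At an inner corner the forward estimate reaches only one vertex beyond
  \<open>b k\<close>. The backward estimate shows that \<open>b (Suc k)\<close> and
  \<open>b j\<close> are seen from \<open>b k\<close> in the same direction, and a second
  \<open>\<delta>\<close> joins the two.\<close>

lemma broken_geodesic:
  fixes b :: "nat \<Rightarrow> 'x"
  assumes corner: "\<And>k. Suc k < n \<Longrightarrow> gprod (b k) (b (Suc (Suc k))) (b (Suc k)) \<le> C"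
    and long: "\<And>k. k < n \<Longrightarrow> 2 * C + 3 * \<delta> < dist (b k) (b (Suc k))"
    and "0 \<le> C" "i \<le> k" "k \<le> j" "j \<le> n"
  shows "gprod (b i) (b j) (b k) \<le> C + 2 * \<delta>"
proof -
  consider "k = i \<or> k = j" | "i < k" "Suc k = j" | "i < k" "Suc k < j"
    using assms(4,5) by linarith
  then show ?thesis
  proof cases
    case 1
    then show ?thesis using \<open>0 \<le> C\<close> delta_ge_1 by (auto simp: gprod_def dist_commute)
  next
    case 2
    then obtain k' where "k = Suc k'" by (cases k) auto
    then have "gprod (b i) (b (Suc (Suc k'))) (b (Suc k')) \<le> C + \<delta>"
      using 2 assms(6) by (intro broken_geodesic_forward[where b = b, OF corner long]) auto
    then show ?thesis using 2(2) \<open>k = Suc k'\<close> delta_ge_1 by simp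
  next
    case 3
    then obtain k' j' where k: "k = Suc k'" "j = Suc j'" by (metis less_imp_Suc_add)
    have "gprod (b i) (b (Suc k)) (b k) \<le> C + \<delta>"
      unfolding k(1) using 3 assms(6) k
      by (intro broken_geodesic_forward[where b = b, OF corner long]) auto
    moreover have "gprod (b k) (b j) (b (Suc k)) \<le> C + \<delta>"
      unfolding k(2) using 3 assms(6) k
      by (intro broken_geodesic_backward[where b = b, OF corner long]) auto
    then have "C + 2 * \<delta> < gprod (b j) (b (Suc k)) (b k)"
      using long[of k] 3(2) assms(6) gprod_switch[of "b (Suc k)" "b j" "b k"]
      by (simp add: gprod_commute)
    ultimately show ?thesis
      using gprod_hyp[of "b i" "b j" "b k" "b (Suc k)"] by (simp add: min_def split: if_splits)
  qed
qed

lemma broken_geodesic_length: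
  fixes b :: "nat \<Rightarrow> 'x"
  assumes corner: "\<And>k. Suc k < n \<Longrightarrow> gprod (b k) (b (Suc (Suc k))) (b (Suc k)) \<le> C"
    and long: "\<And>k. k < n \<Longrightarrow> 2 * C + 3 * \<delta> < dist (b k) (b (Suc k))"
    and "0 \<le> C" "j \<le> n"
  shows "(\<Sum>k<j. dist (b k) (b (Suc k)) - 2 * (C + 2 * \<delta>)) \<le> dist (b 0) (b j)"
  using \<open>j \<le> n\<close>
proof (induction j)
  case (Suc j)
  have "gprod (b 0) (b (Suc j)) (b j) \<le> C + 2 * \<delta>"
    using Suc.prems by (intro broken_geodesic[where b = b, OF corner long \<open>0 \<le> C\<close>]) auto
  then show ?case using Suc by (simp add: gprod_def dist_commute field_simps)
qed simp

end

section \<open>Hyperbolic elements\<close>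

locale hyperbolic_action = hyperbolic_space T \<delta> + group G
  for T :: "'x::metric_space itself" and \<delta> :: real and G (structure) +
  fixes \<phi> :: "'g \<Rightarrow> 'x \<Rightarrow> 'x"
  assumes act_one: "\<phi> \<one> x = x"
    and act_mult: "a \<in> carrier G \<Longrightarrow> b \<in> carrier G \<Longrightarrow> \<phi> (a \<otimes> b) x = \<phi> a (\<phi> b x)"
    and act_dist: "a \<in> carrier G \<Longrightarrow> dist (\<phi> a x) (\<phi> a y) = dist x y"
begin

lemma act_gprod: "a \<in> carrier G \<Longrightarrow> gprod (\<phi> a x) (\<phi> a y) (\<phi> a z) = gprod x y z"
  by (simp add: gprod_def act_dist)

lemma act_inv [simp]:
  assumes "a \<in> carrier G"
  shows "\<phi> (inv a) (\<phi> a x) = x" "\<phi> a (\<phi> (inv a) x) = x"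
  using assms act_mult[of "inv a" a x] act_mult[of a "inv a" x] by (simp_all add: act_one)

lemma act_dist_inv:
  "a \<in> carrier G \<Longrightarrow> dist (\<phi> (inv a) x) y = dist x (\<phi> a y)"
  using act_dist[of a "\<phi> (inv a) x" y] by simp

lemma inv_intertwine:
  assumes "a \<in> carrier G" "x \<in> carrier G" "y \<in> carrier G" "a \<otimes> x = y \<otimes> a"
  shows "inv a \<otimes> y = x \<otimes> inv a"
proof -
  have "inv a \<otimes> y = inv a \<otimes> (y \<otimes> a) \<otimes> inv a" using assms(1-3) by (simp add: m_assoc)
  also have "\<dots> = inv a \<otimes> (a \<otimes> x) \<otimes> inv a" using assms(4) by simp
  also have "\<dots> = x \<otimes> inv a" using assms(1-3) by (simp add: m_assoc[symmetric])
  finally show ?thesis .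
qed

lemma intertwine_pow:
  assumes "a \<in> carrier G" "b \<in> carrier G" "c \<in> carrier G" "c \<otimes> a = b \<otimes> c"
  shows "c \<otimes> a [^] (m::int) = b [^] m \<otimes> c"
proof -
  have nat: "c \<otimes> a [^] (m::nat) = b [^] m \<otimes> c"
    if "a \<in> carrier G" "b \<in> carrier G" "c \<otimes> a = b \<otimes> c" for m a b
  proof (induction m)
    case (Suc m)
    have "c \<otimes> a [^] Suc m = (c \<otimes> a [^] m) \<otimes> a" using that assms by (simp add: m_assoc)
    also have "\<dots> = b [^] m \<otimes> (c \<otimes> a)" using that assms Suc by (simp add: m_assoc)
    also have "\<dots> = b [^] Suc m \<otimes> c" using that assms by (simp add: m_assoc)
    finally show ?case .
  qed (use assms in auto)
  have inv: "c \<otimes> inv a = inv b \<otimes> c"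
  proof -
    have "inv b \<otimes> (c \<otimes> a) \<otimes> inv a = inv b \<otimes> (b \<otimes> c) \<otimes> inv a" using assms by simp
    moreover have "inv b \<otimes> (c \<otimes> a) \<otimes> inv a = inv b \<otimes> c"
      using assms(1-3) by (simp add: m_assoc)
    moreover have "inv b \<otimes> (b \<otimes> c) \<otimes> inv a = c \<otimes> inv a"
      using assms(1-3) by (simp add: m_assoc[symmetric])
    ultimately show ?thesis by simp
  qed
  show ?thesis
  proof (cases m rule: int_cases2)
    case (nonneg n)
    then show ?thesis using nat[OF assms(1,2,4)] by (simp add: int_pow_int)
  next
    case (nonpos n)
    then show ?thesis using nat[OF _ _ inv] assms by (simp add: int_pow_neg int_pow_int nat_pow_inv)
  qed
qed

end

text \<open>The orbit of \<open>x0\<close> under the powers of \<open>g\<close> stands for the axis,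
  which keeps everything discrete. \<open>axis_gprod\<close> is the stability of this
  quasi-geodesic, and \<open>wpd\<close> is the finiteness condition for \<open>g\<close> at the
  point \<open>x0\<close>.\<close>

locale hyperbolic_axis = hyperbolic_action T \<delta> G \<phi>
  for T :: "'x::metric_space itself" and \<delta> :: real and G (structure)
    and \<phi> :: "'g \<Rightarrow> 'x \<Rightarrow> 'x" +
  fixes g :: 'g and x0 :: 'x and K C :: real
  assumes g_in: "g \<in> carrier G" and K_ge_1: "1 \<le> K" and C_nonneg: "0 \<le> C"
    and axis_lipschitz:
      "dist (\<phi> (g [^] (i::int)) x0) (\<phi> (g [^] (j::int)) x0) \<le> K * \<bar>real_of_int i - real_of_int j\<bar>"
    and axis_growth:
      "\<bar>real_of_int i - real_of_int j\<bar> \<le> K * dist (\<phi> (g [^] i) x0) (\<phi> (g [^] j) x0) + K"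
    and axis_gprod: "i \<le> j \<Longrightarrow> j \<le> k \<Longrightarrow>
      gprod (\<phi> (g [^] i) x0) (\<phi> (g [^] (k::int)) x0) (\<phi> (g [^] j) x0) \<le> C"
    and wpd: "0 < B \<Longrightarrow> \<exists>N::nat. 0 < N \<and> finite {u \<in> carrier G.
      dist x0 (\<phi> u x0) \<le> B \<and> dist (\<phi> (g [^] N) x0) (\<phi> u (\<phi> (g [^] N) x0)) \<le> B}"
begin

definition pt :: "int \<Rightarrow> 'x" where "pt i = \<phi> (g [^] i) x0"

lemma pt_0 [simp]: "pt 0 = x0" by (simp add: pt_def act_one)

lemma act_pt [simp]: "\<phi> (g [^] i) (pt j) = pt (i + j)"
  using act_mult[of "g [^] i" "g [^] j" x0] g_in by (simp add: pt_def int_pow_mult)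

lemma pt_lipschitz: "dist (pt i) (pt j) \<le> K * \<bar>real_of_int i - real_of_int j\<bar>"
  using axis_lipschitz by (simp add: pt_def)

lemma pt_growth: "\<bar>real_of_int i - real_of_int j\<bar> \<le> K * dist (pt i) (pt j) + K"
  using axis_growth by (simp add: pt_def)

lemma pt_gprod: "i \<le> j \<Longrightarrow> j \<le> k \<Longrightarrow> gprod (pt i) (pt k) (pt j) \<le> C"
  using axis_gprod by (simp add: pt_def)

lemma dist_pt: "dist (pt i) (pt j) = dist x0 (pt (j - i))"
  using act_dist[of "g [^] i" x0 "pt (j - i)"] g_in act_pt[of i 0] act_pt[of i "j - i"] by simp

lemma dist_pt_minus: "dist x0 (pt (- i)) = dist x0 (pt i)"
  using dist_pt[of i 0] by (simp add: dist_commute)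

lemma g_pow_simps:
  "g [^] (i::int) \<otimes> g [^] j = g [^] (i + j)"
  "a \<in> carrier G \<Longrightarrow> g [^] (i::int) \<otimes> (g [^] j \<otimes> a) = g [^] (i + j) \<otimes> a"
  using g_in by (simp_all add: int_pow_mult m_assoc)

text \<open>\<open>\<epsilon>\<close> tells whether \<open>u\<close> keeps or reverses the direction
  of the axis. Quantifying over all multiples of \<open>k\<close> lets elements with different
  \<open>k\<close> be combined over the product of the two.\<close>

definition elementary :: "'g set"
  where "elementary = {u \<in> carrier G. \<exists>k>0. \<exists>\<epsilon>\<in>{1, -1}.
    \<forall>m::int. u \<otimes> g [^] (k * m) = g [^] (\<epsilon> * k * m) \<otimes> u}"

lemma elementaryI:
  assumes "u \<in> carrier G" "(k::int) \<noteq> 0" "u \<otimes> g [^] k = g [^] k \<otimes> u \<or> u \<otimes> g [^] k = g [^] (- k) \<otimes> u"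
  shows "u \<in> elementary"
proof -
  obtain \<epsilon> :: int where e: "\<epsilon> \<in> {1, -1}" "u \<otimes> g [^] k = g [^] (\<epsilon> * k) \<otimes> u"
  proof -
    from assms(3) show thesis using that[of 1] that[of "-1"] by auto
  qed
  have *: "u \<otimes> g [^] (k * m) = g [^] (\<epsilon> * k * m) \<otimes> u" for m
    using intertwine_pow[OF _ _ assms(1) e(2), of m] g_in by (simp add: int_pow_pow)
  have "u \<otimes> g [^] (\<bar>k\<bar> * m) = g [^] (\<epsilon> * \<bar>k\<bar> * m) \<otimes> u" for m
    using *[of "sgn k * m"] by (simp add: abs_sgn mult.assoc)
  then show ?thesis unfolding elementary_def using assms e(1)
    by (intro CollectI conjI exI[of _ "\<bar>k\<bar>"] bexI[of _ \<epsilon>]) auto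
qed

lemma elementary_closed: "elementary \<subseteq> carrier G"
  by (auto simp: elementary_def)

lemma g_pow_elementary: "g [^] (i::int) \<in> elementary"
  using g_in by (intro elementaryI[of _ 1]) (auto simp: g_pow_simps add.commute simp del: int_pow_1)

lemma elementary_mult:
  assumes "a \<in> elementary" "b \<in> elementary"
  shows "a \<otimes> b \<in> elementary"
proof -
  obtain k \<epsilon> :: int where a: "a \<in> carrier G" "0 < k" "\<epsilon> \<in> {1, -1::int}"
    "\<And>m::int. a \<otimes> g [^] (k * m) = g [^] (\<epsilon> * k * m) \<otimes> a"
    using assms(1) unfolding elementary_def by blast
  obtain l \<eta> :: int where b: "b \<in> carrier G" "0 < l" "\<eta> \<in> {1, -1::int}"
    "\<And>m::int. b \<otimes> g [^] (l * m) = g [^] (\<eta> * l * m) \<otimes> b"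
    using assms(2) unfolding elementary_def by blast
  have "(a \<otimes> b) \<otimes> g [^] ((k * l) * m) = g [^] ((\<epsilon> * \<eta>) * (k * l) * m) \<otimes> (a \<otimes> b)" for m
  proof -
    have "(a \<otimes> b) \<otimes> g [^] ((k * l) * m) = a \<otimes> (b \<otimes> g [^] (l * (k * m)))"
      using a(1) b(1) g_in by (simp add: m_assoc ac_simps)
    also have "\<dots> = (a \<otimes> g [^] (k * (\<eta> * l * m))) \<otimes> b"
      unfolding b(4) using a(1) b(1) g_in by (simp add: m_assoc ac_simps)
    also have "\<dots> = g [^] (\<epsilon> * k * (\<eta> * l * m)) \<otimes> (a \<otimes> b)"
      unfolding a(4) using a(1) b(1) g_in by (simp add: m_assoc)
    finally show ?thesis by (simp add: ac_simps)
  qed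
  moreover have "\<epsilon> * \<eta> \<in> {1, -1}" using a(3) b(3) by auto
  ultimately show ?thesis unfolding elementary_def using a b
    by (intro CollectI conjI exI[of _ "k * l"] bexI[of _ "\<epsilon> * \<eta>"]) auto
qed

lemma elementary_inv:
  assumes "a \<in> elementary"
  shows "inv a \<in> elementary"
proof -
  obtain k \<epsilon> :: int where a: "a \<in> carrier G" "0 < k" "\<epsilon> \<in> {1, -1::int}"
    "\<And>m::int. a \<otimes> g [^] (k * m) = g [^] (\<epsilon> * k * m) \<otimes> a"
    using assms unfolding elementary_def by blast
  have "inv a \<otimes> g [^] (k * m) = g [^] (\<epsilon> * k * m) \<otimes> inv a" for m
  proof -
    have e: "\<epsilon> * k * (\<epsilon> * m) = k * m" "k * (\<epsilon> * m) = \<epsilon> * k * m" using a(3) by auto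
    have "a \<otimes> g [^] (\<epsilon> * k * m) = g [^] (k * m) \<otimes> a"
      using a(4)[of "\<epsilon> * m"] unfolding e .
    then show ?thesis using inv_intertwine[of a "g [^] (\<epsilon> * k * m)" "g [^] (k * m)"] a(1) g_in by simp
  qed
  then show ?thesis unfolding elementary_def using a
    by (intro CollectI conjI exI[of _ k] bexI[of _ \<epsilon>]) auto
qed

text \<open>Both points lie near a geodesic from \<open>x0\<close> to \<open>pt l\<close> and have
  almost the same distance from \<open>x0\<close>, as \<open>u\<close> is an isometry that hardly
  moves \<open>x0\<close>. The sign \<open>s\<close> admits elements that run against the
  axis.\<close>

lemma fellow_travel:
  assumes u: "u \<in> carrier G" and B: "dist x0 (\<phi> u x0) \<le> B" "dist (pt l) (\<phi> u (pt l')) \<le> B"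
    and s: "s \<in> {1, -1}" and m: "0 \<le> m" "m \<le> l" "m \<le> s * l'"
  shows "dist (pt m) (\<phi> u (pt (s * m))) \<le> 5 * B + 2 * C + 2 * \<delta>"
proof -
  have B0: "0 \<le> B" using B(1) zero_le_dist order_trans by blast
  define y where "y = \<phi> u (pt (s * m))"
  have 1: "gprod x0 (pt l) (pt m) \<le> C" using pt_gprod[of 0 m l] m by simp
  have "gprod x0 (pt l') (pt (s * m)) \<le> C"
    using s pt_gprod[of 0 m l'] pt_gprod[of l' "- m" 0] m by (auto simp: gprod_commute)
  then have "gprod (\<phi> u x0) (\<phi> u (pt l')) y \<le> C" unfolding y_def using act_gprod[OF u] by simp
  then have 2: "gprod x0 (pt l) y \<le> C + 2 * B"
    using gprod_perturb(1)[of x0 "pt l" y "\<phi> u x0"]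
      gprod_perturb(2)[of "\<phi> u x0" "pt l" y "\<phi> u (pt l')"] B by linarith
  have "dist x0 (pt m) = dist x0 (pt (s * m))" using s dist_pt_minus by auto
  also have "\<dots> = dist (\<phi> u x0) y" unfolding y_def using act_dist[OF u] by simp
  finally have "\<bar>dist x0 (pt m) - dist x0 y\<bar> \<le> B"
    using B(1) dist_triangle[of x0 y "\<phi> u x0"] dist_triangle[of "\<phi> u x0" y x0]
    by (simp add: dist_commute abs_if)
  then show ?thesis
    using dist_close_if_near_geodesic[of x0 "pt l" "pt m" "C + 2 * B" y] 1 2 B0
    unfolding y_def by simp
qed

text \<open>Along a long common stretch all the \<open>\<eta> m\<close> move axis points to bounded
  distance from the axis points prescribed by \<open>s\<close>. Only finitely many elements nearly
  fix both \<open>x0\<close> and \<open>pt (int N)\<close>, so two of them coincide, and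
  \<open>\<eta> m = \<eta> m'\<close> says that \<open>u\<close> conjugates
  \<open>g [^] (s * (m' - m))\<close> to \<open>g [^] (m' - m)\<close>.\<close>

lemma overlap_elementary_aux:
  "\<exists>L>0. \<forall>u\<in>carrier G. \<forall>l l'. dist x0 (\<phi> u x0) \<le> B \<longrightarrow> dist (pt l) (\<phi> u (pt l')) \<le> B \<longrightarrow>
    L \<le> real_of_int l \<longrightarrow> u \<in> elementary"
proof (cases "0 \<le> B")
  case False
  then have "\<not> dist x0 y \<le> B" for y using zero_le_dist[of x0 y] by linarith
  then show ?thesis by (intro exI[of _ 1]) auto
next
  case B0: True
  define B' where "B' = 5 * B + 2 * C + 2 * \<delta>"
  have B'_pos: "0 < B'" using B0 C_nonneg delta_ge_1 by (simp add: B'_def)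
  obtain N :: nat where N: "0 < N" "finite {u \<in> carrier G.
      dist x0 (\<phi> u x0) \<le> 2 * B' \<and> dist (\<phi> (g [^] N) x0) (\<phi> u (\<phi> (g [^] N) x0)) \<le> 2 * B'}"
    using wpd[of "2 * B'"] B'_pos by auto
  define F where "F = {u \<in> carrier G.
      dist x0 (\<phi> u x0) \<le> 2 * B' \<and> dist (pt (int N)) (\<phi> u (pt (int N))) \<le> 2 * B'}"
  have F: "finite F" using N(2) unfolding F_def pt_def by (simp add: int_pow_int)
  \<comment> \<open>Room for \<open>card F + 1\<close> shifts, which start at \<open>int N\<close>,
    and beyond each of them for the second test point, \<open>int N\<close> further on.\<close>
  define L1 where "L1 = int (card F) + 2 * int N + 2"
  \<comment> \<open>The second entry forces \<open>\<bar>l'\<bar>\<close> to be at least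
    \<open>L1\<close> as well: for a smaller \<open>l'\<close> the point \<open>pt l'\<close>, and
    with it \<open>pt l\<close>, would be too close to \<open>x0\<close>.\<close>
  define L where "L = max (real_of_int L1) (K * (2 * B + K * real_of_int L1) + K + 1)"
  have "0 < L" unfolding L_def L1_def by simp
  moreover have "u \<in> elementary" if u: "u \<in> carrier G" and d: "dist x0 (\<phi> u x0) \<le> B"
      "dist (pt l) (\<phi> u (pt l')) \<le> B" and l: "L \<le> real_of_int l" for u l l'
  proof -
    have lL: "L1 \<le> l" using l unfolding L_def by simp
    have l'L: "L1 \<le> \<bar>l'\<bar>"
    proof (rule ccontr)
      assume "\<not> L1 \<le> \<bar>l'\<bar>"
      then have "real_of_int \<bar>l'\<bar> \<le> real_of_int L1" by linarith
      then have "K * \<bar>real_of_int l'\<bar> \<le> K * real_of_int L1"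
        using K_ge_1 by (intro mult_left_mono) auto
      then have "dist x0 (pt l') \<le> K * real_of_int L1" using pt_lipschitz[of 0 l'] by simp
      moreover have "dist x0 (pt l) \<le> 2 * B + dist x0 (pt l')"
        using d dist_triangle[of x0 "pt l" "\<phi> u x0"] act_dist[OF u, of x0 "pt l'"]
          dist_triangle[of "\<phi> u x0" "pt l" "\<phi> u (pt l')"] by (simp add: dist_commute)
      ultimately have "K * dist x0 (pt l) \<le> K * (2 * B + K * real_of_int L1)"
        using K_ge_1 by (intro mult_left_mono) auto
      moreover have "real_of_int l \<le> K * dist x0 (pt l) + K" using pt_growth[of 0 l] by simp
      ultimately show False using l unfolding L_def by simp
    qed
    define s where "s = sgn l'"
    have s: "s \<in> {1, -1}" "s * l' = \<bar>l'\<bar>"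
      using l'L by (auto simp: s_def L1_def sgn_if)
    have ft: "dist (pt m) (\<phi> u (pt (s * m))) \<le> B'" if "0 \<le> m" "m \<le> L1" for m
      unfolding B'_def using fellow_travel[OF u d s(1), of m] that lL l'L s(2) by simp
    define \<eta> where "\<eta> m = g [^] (- m) \<otimes> (u \<otimes> g [^] (s * m))" for m :: int
    have \<eta>_in: "\<eta> m \<in> carrier G" for m unfolding \<eta>_def using u g_in by simp
    have \<eta>_dist: "dist (pt p) (\<phi> (\<eta> m) (pt (s * p))) \<le> B'" if "0 \<le> m + p" "m + p \<le> L1" for m p
    proof -
      have "\<phi> (\<eta> m) (pt (s * p)) = \<phi> (g [^] (- m)) (\<phi> u (pt (s * (m + p))))"
        unfolding \<eta>_def using u g_in by (simp add: act_mult distrib_left)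
      then show ?thesis
        using act_dist[of "g [^] (- m)" "pt (m + p)" "\<phi> u (pt (s * (m + p)))"] g_in
          ft[OF that] by simp
    qed
    have ss: "s * (s * p) = p" for p using s(1) by auto
    \<comment> \<open>If \<open>s = -1\<close>, the element \<open>\<eta> m\<close> reverses the
      axis and need not nearly fix \<open>pt (int N)\<close>. Composing with the fixed
      \<open>\<eta> (int N)\<close> restores the direction; cancelling it afterwards recovers
      \<open>\<eta> m\<close>.\<close>
    define \<theta> where "\<theta> m = \<eta> m \<otimes> \<eta> (int N)" for m
    have \<theta>_dist: "dist (pt p) (\<phi> (\<theta> m) (pt p)) \<le> 2 * B'"
      if "0 \<le> m + p" "m + p \<le> L1" "0 \<le> int N + s * p" "int N + s * p \<le> L1" for m p
    proof -
      have "dist (\<phi> (\<eta> m) (pt (s * p))) (\<phi> (\<eta> m) (\<phi> (\<eta> (int N)) (pt p))) \<le> B'"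
        using act_dist[OF \<eta>_in] \<eta>_dist[of "int N" "s * p"] that by (simp add: ss)
      then show ?thesis
        using \<eta>_dist[of m p] that dist_triangle[of "pt p" "\<phi> (\<theta> m) (pt p)" "\<phi> (\<eta> m) (pt (s * p))"]
        by (simp add: \<theta>_def act_mult \<eta>_in)
    qed
    have "\<theta> (m + int N) \<in> F" if "m \<in> {0..int (card F)}" for m
    proof -
      have "0 \<le> m" "m + int N + int N \<le> L1" "m + int N \<le> L1" "int N \<le> L1"
        "0 \<le> int N + s * int N" "int N + s * int N \<le> L1"
        using that s(1) by (auto simp: L1_def)
      then show ?thesis
        using \<eta>_in \<theta>_dist[of "m + int N" 0] \<theta>_dist[of "m + int N" "int N"]
        unfolding F_def by (simp add: \<theta>_def)
    qed
    then have "(\<lambda>m. \<theta> (m + int N)) ` {0..int (card F)} \<subseteq> F" by blast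
    then have "card ((\<lambda>m. \<theta> (m + int N)) ` {0..int (card F)}) \<le> card F"
      using F by (rule card_mono[rotated])
    then have "\<not> inj_on (\<lambda>m. \<theta> (m + int N)) {0..int (card F)}"
      using card_image[of "\<lambda>m. \<theta> (m + int N)" "{0..int (card F)}"] by auto
    then obtain p p' where p: "p \<noteq> p'" "\<theta> (p + int N) = \<theta> (p' + int N)"
      unfolding inj_on_def by blast
    define m m' where "m = p + int N" and "m' = p' + int N"
    have m: "m \<noteq> m'" "\<theta> m = \<theta> m'" using p by (auto simp: m_def m'_def)
    then have "\<eta> m = \<eta> m'" unfolding \<theta>_def using right_cancel[OF \<eta>_in \<eta>_in \<eta>_in] by blast
    then have "g [^] m' \<otimes> \<eta> m \<otimes> g [^] (- (s * m)) = g [^] m' \<otimes> \<eta> m' \<otimes> g [^] (- (s * m))" by simp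
    moreover have "g [^] m' \<otimes> \<eta> m \<otimes> g [^] (- (s * m)) = g [^] (m' - m) \<otimes> u"
      unfolding \<eta>_def using u g_in by (simp add: m_assoc g_pow_simps)
    moreover have "g [^] m' \<otimes> \<eta> m' \<otimes> g [^] (- (s * m)) = u \<otimes> g [^] (s * m' - s * m)"
      unfolding \<eta>_def using u g_in by (simp add: m_assoc g_pow_simps)
    ultimately show ?thesis
      using m s(1) by (intro elementaryI[OF u, of "s * m' - s * m"]) auto
  qed
  ultimately show ?thesis by blast
qed

text \<open>Multiplying \<open>u\<close> by powers of \<open>g\<close> on both sides moves
  \<open>pt i\<close> and \<open>pt i'\<close> to \<open>x0\<close> without affecting membership in
  \<open>elementary\<close>.\<close>

lemma overlap_elementary:
  "\<exists>L>0. \<forall>u\<in>carrier G. \<forall>i j i' j'. dist (pt i) (\<phi> u (pt i')) \<le> B \<longrightarrow>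
    dist (pt j) (\<phi> u (pt j')) \<le> B \<longrightarrow> L \<le> \<bar>real_of_int i - real_of_int j\<bar> \<longrightarrow> u \<in> elementary"
proof -
  obtain L where L: "0 < L" "\<And>u l l'. u \<in> carrier G \<Longrightarrow> dist x0 (\<phi> u x0) \<le> B \<Longrightarrow>
      dist (pt l) (\<phi> u (pt l')) \<le> B \<Longrightarrow> L \<le> real_of_int l \<Longrightarrow> u \<in> elementary"
    using overlap_elementary_aux[of B] by blast
  have *: "u \<in> elementary" if u: "u \<in> carrier G" and d: "dist (pt i) (\<phi> u (pt i')) \<le> B"
      "dist (pt j) (\<phi> u (pt j')) \<le> B" and l: "L \<le> real_of_int (j - i)" for u i j i' j'
  proof -
    define u' where "u' = g [^] (- i) \<otimes> (u \<otimes> g [^] i')"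
    have u': "u' \<in> carrier G" unfolding u'_def using u g_in by simp
    have act: "\<phi> u' (pt k) = \<phi> (g [^] (- i)) (\<phi> u (pt (i' + k)))" for k
      unfolding u'_def using u g_in by (simp add: act_mult)
    have "dist x0 (\<phi> u' x0) \<le> B"
      using act_dist[of "g [^] (- i)" "pt i" "\<phi> u (pt i')"] g_in d(1) act[of 0] by simp
    moreover have "dist (pt (j - i)) (\<phi> u' (pt (j' - i'))) \<le> B"
      using act_dist[of "g [^] (- i)" "pt j" "\<phi> u (pt j')"] g_in d(2) act[of "j' - i'"] by simp
    ultimately have "u' \<in> elementary" using L(2)[OF u'] l by blast
    then have "g [^] i \<otimes> (u' \<otimes> g [^] (- i')) \<in> elementary"
      by (intro elementary_mult g_pow_elementary)
    moreover have "g [^] i \<otimes> (u' \<otimes> g [^] (- i')) = u"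
      unfolding u'_def using u g_in
      by (simp add: m_assoc g_pow_simps)
    ultimately show ?thesis by simp
  qed
  have "u \<in> elementary" if "u \<in> carrier G" "dist (pt i) (\<phi> u (pt i')) \<le> B"
      "dist (pt j) (\<phi> u (pt j')) \<le> B" "L \<le> \<bar>real_of_int i - real_of_int j\<bar>" for u i j i' j'
    using *[OF that(1,2,3)] *[OF that(1,3,2)] that(4) by (cases "i \<le> j") auto
  then show ?thesis using L(1) by blast
qed

end

lemma nat_intermediate_value:
  fixes f :: "nat \<Rightarrow> real"
  assumes "\<And>k. k < n \<Longrightarrow> \<bar>f (Suc k) - f k\<bar> \<le> K" "0 \<le> K" "f 0 \<le> t" "t \<le> f n"
  shows "\<exists>k\<le>n. \<bar>f k - t\<bar> \<le> K"
proof -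
  define k where "k = (LEAST k. t \<le> f k)"
  have k: "t \<le> f k" unfolding k_def using assms(4) by (rule LeastI)
  have kn: "k \<le> n" unfolding k_def using assms(4) by (rule Least_le)
  show ?thesis
  proof (cases k)
    case 0
    then show ?thesis using k assms by (intro exI[of _ 0]) auto
  next
    case (Suc l)
    then have "f l < t" using not_less_Least[of l "\<lambda>k. t \<le> f k"] unfolding k_def by simp
    then show ?thesis using k kn Suc assms(1)[of l] by (intro exI[of _ k]) auto
  qed
qed

context hyperbolic_action
begin

text \<open>With \<open>x0 = c 0\<close> the orbit is the invariant quasi-geodesic \<open>c\<close>
  sampled at the multiples of \<open>\<tau>\<close>. Its additive error can be absorbed into the
  Lipschitz constant because distinct indices differ by at least 1.\<close>

lemma hyperbolic_axis_exists:
  assumes g: "g \<in> carrier G" and hyp: "hyperbolic_isometry (\<phi> g)"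
    and wpd: "\<And>x C. 0 < C \<Longrightarrow> \<exists>N::nat. 0 < N \<and> finite {u \<in> carrier G. dist x (\<phi> u x) \<le> C \<and>
          dist (\<phi> (g [^] N) x) (\<phi> u (\<phi> (g [^] N) x)) \<le> C}"
  shows "\<exists>x0 K C. hyperbolic_axis \<delta> G \<phi> g x0 K C"
proof -
  obtain K' L c \<tau> where qg: "quasi_geodesic_on K' L UNIV c" and \<tau>: "\<tau> \<noteq> 0"
    and shift: "\<And>t. \<phi> g (c t) = c (t + \<tau>)"
    using hyp unfolding hyperbolic_isometry_def by blast
  have K': "1 \<le> K'" and L: "0 \<le> L"
    and lo: "\<bar>s - t\<bar> \<le> K' * (dist (c s) (c t) + L)"
    and up: "dist (c s) (c t) \<le> K' * \<bar>s - t\<bar> + L" for s t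
  proof -
    have "1 / K' * \<bar>s - t\<bar> - L \<le> dist (c s) (c t)" "1 \<le> K'"
      using qg by (auto simp: quasi_geodesic_on_def)
    then show "\<bar>s - t\<bar> \<le> K' * (dist (c s) (c t) + L)" by (simp add: field_simps)
  qed (use qg in \<open>auto simp: quasi_geodesic_on_def\<close>)
  have nat: "\<phi> (g [^] (n::nat)) (c t) = c (t + n * \<tau>)" for n t
  proof (induction n arbitrary: t)
    case (Suc n)
    have "\<phi> (g [^] Suc n) (c t) = \<phi> (g [^] n) (\<phi> g (c t))" using g by (simp add: act_mult)
    then show ?case using Suc shift by (simp add: algebra_simps)
  qed (simp add: act_one)
  have int: "\<phi> (g [^] (n::int)) (c t) = c (t + n * \<tau>)" for n t
  proof (cases n rule: int_cases2)
    case (nonneg m)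
    then show ?thesis using nat by (simp add: int_pow_int)
  next
    case (nonpos m)
    have "\<phi> (g [^] m) (c (t + n * \<tau>)) = c t" using nat[of m "t + n * \<tau>"] nonpos by simp
    then have "\<phi> (inv (g [^] m)) (c t) = c (t + n * \<tau>)"
      using g act_inv(1)[of "g [^] m" "c (t + n * \<tau>)"] by simp
    then show ?thesis using nonpos g by (simp add: int_pow_neg int_pow_int)
  qed
  define x0 where "x0 = c 0"
  have pt: "\<phi> (g [^] (n::int)) x0 = c (n * \<tau>)" for n using int[of n 0] by (simp add: x0_def)
  define K where "K = 1 + K' * \<bar>\<tau>\<bar> + L + K' / \<bar>\<tau>\<bar> + K' * L / \<bar>\<tau>\<bar>"
  have K_ge: "1 \<le> K" "K' * \<bar>\<tau>\<bar> + L \<le> K" "K' / \<bar>\<tau>\<bar> \<le> K" "K' * L / \<bar>\<tau>\<bar> \<le> K"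
    unfolding K_def using K' L by auto
  have lip: "dist (\<phi> (g [^] i) x0) (\<phi> (g [^] j) x0) \<le> K * \<bar>real_of_int i - real_of_int j\<bar>"
    for i j :: int
  proof (cases "i = j")
    case False
    then have 1: "1 \<le> \<bar>real_of_int i - real_of_int j\<bar>" by linarith
    have "dist (c (i * \<tau>)) (c (j * \<tau>)) \<le> K' * \<bar>i * \<tau> - j * \<tau>\<bar> + L" by (rule up)
    also have "\<bar>i * \<tau> - j * \<tau>\<bar> = \<bar>real_of_int i - real_of_int j\<bar> * \<bar>\<tau>\<bar>"
      by (simp add: abs_mult[symmetric] left_diff_distrib)
    also have "K' * (\<bar>real_of_int i - real_of_int j\<bar> * \<bar>\<tau>\<bar>) + L
        \<le> (K' * \<bar>\<tau>\<bar> + L) * \<bar>real_of_int i - real_of_int j\<bar>"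
      using mult_left_mono[OF 1 L] by (simp add: algebra_simps)
    also have "\<dots> \<le> K * \<bar>real_of_int i - real_of_int j\<bar>" using K_ge by (intro mult_right_mono) auto
    finally show ?thesis unfolding pt .
  qed simp
  have grow: "\<bar>real_of_int i - real_of_int j\<bar> \<le> K * dist (\<phi> (g [^] i) x0) (\<phi> (g [^] j) x0) + K"
    for i j :: int
  proof -
    define d where "d = dist (c (i * \<tau>)) (c (j * \<tau>))"
    have "\<bar>real_of_int i - real_of_int j\<bar> * \<bar>\<tau>\<bar> = \<bar>i * \<tau> - j * \<tau>\<bar>"
      by (simp add: abs_mult[symmetric] left_diff_distrib)
    also have "\<dots> \<le> K' * (d + L)" unfolding d_def by (rule lo)
    finally have "\<bar>real_of_int i - real_of_int j\<bar> \<le> K' * (d + L) / \<bar>\<tau>\<bar>"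
      using \<tau> by (simp add: field_simps)
    also have "\<dots> = K' / \<bar>\<tau>\<bar> * d + K' * L / \<bar>\<tau>\<bar>"
      by (simp add: distrib_left add_divide_distrib)
    also have "\<dots> \<le> K * d + K"
      using K_ge by (intro add_mono mult_right_mono) (auto simp: d_def)
    finally show ?thesis unfolding pt d_def .
  qed
  obtain C where C: "0 \<le> C" "\<And>(a::nat \<Rightarrow> 'x) n k. quasi_chain K a n \<Longrightarrow> k \<le> n \<Longrightarrow>
      gprod (a 0) (a n) (a k) \<le> C"
    using morse[OF K_ge(1)] by blast
  have gp: "gprod (\<phi> (g [^] i) x0) (\<phi> (g [^] k) x0) (\<phi> (g [^] j) x0) \<le> C"
    if ij: "i \<le> j" "j \<le> k" for i j k :: int
  proof -
    define a where "a l = \<phi> (g [^] (i + int l)) x0" for l :: nat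
    have "quasi_chain K a (nat (k - i))"
      unfolding quasi_chain_def a_def
    proof (intro conjI allI impI)
      fix l m :: nat assume "l \<le> m"
      then show "real (m - l) \<le> K * dist (\<phi> (g [^] (i + int l)) x0) (\<phi> (g [^] (i + int m)) x0) + K"
        using grow[of "i + int l" "i + int m"] by (simp add: of_nat_diff)
    next
      fix l show "dist (\<phi> (g [^] (i + int l)) x0) (\<phi> (g [^] (i + int (Suc l))) x0) \<le> K"
        using lip[of "i + int l" "i + int (Suc l)"] by simp
    qed
    from C(2)[OF this, of "nat (j - i)"] show ?thesis using ij by (simp add: a_def)
  qed
  have "hyperbolic_axis \<delta> G \<phi> g x0 K C"
    by unfold_locales (use g K_ge C lip grow gp wpd[of _ x0] in auto)
  then show ?thesis by blast
qed

end

section \<open>Translates of the axis, and the size of \<open>elementary\<close>\<close>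

context hyperbolic_axis
begin

text \<open>An intermediate value argument along the axis: consecutive orbit points are at most
  \<open>K\<close> apart, so some distance from \<open>x\<close> hits \<open>t\<close> up to
  \<open>K\<close>. \<open>gprod_between\<close> keeps all intermediate points near the
  geodesic.\<close>

lemma axis_point_at_distance:
  assumes a: "a \<in> carrier G" and B: "gprod x z (\<phi> a (pt i1)) \<le> B" "gprod x z (\<phi> a (pt i2)) \<le> B"
    and t: "dist x (\<phi> a (pt i1)) \<le> t" "t \<le> dist x (\<phi> a (pt i2))"
  shows "\<exists>i. \<bar>dist x (\<phi> a (pt i)) - t\<bar> \<le> K \<and> gprod x z (\<phi> a (pt i)) \<le> C + 2 * B + \<delta>"
proof -
  define s where "s = (if i1 \<le> i2 then 1 else -1 :: int)"
  define n where "n = nat \<bar>i2 - i1\<bar>"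
  define f where "f k = dist x (\<phi> a (pt (i1 + s * int k)))" for k
  have end_n: "i1 + s * int n = i2" by (auto simp: s_def n_def)
  have "\<bar>f (Suc k) - f k\<bar> \<le> K" for k
  proof -
    have "dist (\<phi> a (pt (i1 + s * int k))) (\<phi> a (pt (i1 + s * int (Suc k)))) \<le> K"
      using pt_lipschitz[of "i1 + s * int k" "i1 + s * int (Suc k)"] act_dist[OF a]
      by (simp add: s_def algebra_simps split: if_splits)
    then show ?thesis
      unfolding f_def
      using dist_triangle[of x "\<phi> a (pt (i1 + s * int k))" "\<phi> a (pt (i1 + s * int (Suc k)))"]
        dist_triangle[of x "\<phi> a (pt (i1 + s * int (Suc k)))" "\<phi> a (pt (i1 + s * int k))"]
      by (simp add: dist_commute abs_if)
  qed
  then obtain k where k: "k \<le> n" "\<bar>f k - t\<bar> \<le> K"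
    using nat_intermediate_value[of n f K t] K_ge_1 t end_n by (auto simp: f_def)
  define i where "i = i1 + s * int k"
  have "gprod (pt i1) (pt i2) (pt i) \<le> C"
  proof (cases "i1 \<le> i2")
    case True
    then show ?thesis using k by (intro pt_gprod) (auto simp: i_def s_def n_def)
  next
    case False
    then have "gprod (pt i2) (pt i1) (pt i) \<le> C"
      using k by (intro pt_gprod) (auto simp: i_def s_def n_def)
    then show ?thesis by (simp add: gprod_commute)
  qed
  then have "gprod x z (\<phi> a (pt i)) \<le> C + 2 * B + \<delta>"
    using B by (intro gprod_between[of _ _ "\<phi> a (pt i1)" _ "\<phi> a (pt i2)"])
      (auto simp: act_gprod[OF a])
  then show ?thesis using k unfolding f_def i_def by blast
qed

text \<open>Each segment of a translated axis occupies, along a geodesic from \<open>x\<close> to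
  \<open>z\<close>, the interval between the distances of its ends from \<open>x\<close>.
  \<open>L\<close> is a length of common interval that forces \<open>a\<close> and \<open>b\<close>
  into one left coset of \<open>elementary\<close>.\<close>

definition overlap_bound :: "real \<Rightarrow> real \<Rightarrow> bool"
  where "overlap_bound B L \<longleftrightarrow> (\<forall>a\<in>carrier G. \<forall>b\<in>carrier G. \<forall>x z i1 i2 j1 j2.
    gprod x z (\<phi> a (pt i1)) \<le> B \<longrightarrow> gprod x z (\<phi> a (pt i2)) \<le> B \<longrightarrow>
    gprod x z (\<phi> b (pt j1)) \<le> B \<longrightarrow> gprod x z (\<phi> b (pt j2)) \<le> B \<longrightarrow>
    L \<le> min (dist x (\<phi> a (pt i2))) (dist x (\<phi> b (pt j2)))
      - max (dist x (\<phi> a (pt i1))) (dist x (\<phi> b (pt j1))) \<longrightarrow> inv a \<otimes> b \<in> elementary)"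

text \<open>At both ends of the common interval each axis has a point at about the given distance
  from \<open>x\<close>, and equal distances near one geodesic mean close points. So
  \<open>overlap_elementary\<close> applies to \<open>inv a \<otimes> b\<close>. A distance of
  \<open>K * L\<close> forces an index gap of at least \<open>L\<close>, and \<open>2 * K\<close>
  pays for the two approximate choices.\<close>

lemma overlap_along_geodesic: "\<exists>L>0. overlap_bound B L"
proof -
  define B1 where "B1 = C + 2 * B + \<delta>"
  define B2 where "B2 = 2 * K + 2 * B1 + 2 * \<delta>"
  obtain L where L: "0 < L" "\<And>u i j i' j'. u \<in> carrier G \<Longrightarrow> dist (pt i) (\<phi> u (pt i')) \<le> B2 \<Longrightarrow>
      dist (pt j) (\<phi> u (pt j')) \<le> B2 \<Longrightarrow> L \<le> \<bar>real_of_int i - real_of_int j\<bar> \<Longrightarrow> u \<in> elementary"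
    using overlap_elementary[of B2] by blast
  have "inv a \<otimes> b \<in> elementary"
    if ab: "a \<in> carrier G" "b \<in> carrier G"
      and gp: "gprod x z (\<phi> a (pt i1)) \<le> B" "gprod x z (\<phi> a (pt i2)) \<le> B"
        "gprod x z (\<phi> b (pt j1)) \<le> B" "gprod x z (\<phi> b (pt j2)) \<le> B"
      and ov: "K * L + 2 * K \<le> min (dist x (\<phi> a (pt i2))) (dist x (\<phi> b (pt j2)))
        - max (dist x (\<phi> a (pt i1))) (dist x (\<phi> b (pt j1)))" for a b x z i1 i2 j1 j2
  proof -
    define t1 where "t1 = max (dist x (\<phi> a (pt i1))) (dist x (\<phi> b (pt j1)))"
    define t2 where "t2 = min (dist x (\<phi> a (pt i2))) (dist x (\<phi> b (pt j2)))"
    have "0 \<le> K * L" using K_ge_1 L(1) by simp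
    then have t12: "K * L + 2 * K \<le> t2 - t1" "t1 \<le> t2"
      using ov K_ge_1 unfolding t1_def t2_def by linarith+
    have pts: "\<exists>i j. \<bar>dist x (\<phi> a (pt i)) - t\<bar> \<le> K \<and> dist (pt i) (\<phi> (inv a \<otimes> b) (pt j)) \<le> B2"
      if t: "t1 \<le> t" "t \<le> t2" for t
    proof -
      obtain i where i: "\<bar>dist x (\<phi> a (pt i)) - t\<bar> \<le> K" "gprod x z (\<phi> a (pt i)) \<le> B1"
        using axis_point_at_distance[OF ab(1) gp(1,2), of t] t
        unfolding t1_def t2_def B1_def by auto
      obtain j where j: "\<bar>dist x (\<phi> b (pt j)) - t\<bar> \<le> K" "gprod x z (\<phi> b (pt j)) \<le> B1"
        using axis_point_at_distance[OF ab(2) gp(3,4), of t] t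
        unfolding t1_def t2_def B1_def by auto
      have "dist (\<phi> a (pt i)) (\<phi> b (pt j)) \<le> B2"
        using dist_close_if_near_geodesic[OF i(2) j(2)] i(1) j(1) unfolding B2_def by linarith
      moreover have "dist (pt i) (\<phi> (inv a \<otimes> b) (pt j)) = dist (\<phi> a (pt i)) (\<phi> b (pt j))"
        using ab act_dist_inv[of a "\<phi> b (pt j)" "pt i"] by (simp add: act_mult dist_commute)
      ultimately show ?thesis using i by (intro exI[of _ i] exI[of _ j]) auto
    qed
    obtain i j where 1: "\<bar>dist x (\<phi> a (pt i)) - t1\<bar> \<le> K" "dist (pt i) (\<phi> (inv a \<otimes> b) (pt j)) \<le> B2"
      using pts[of t1] t12 by auto
    obtain i' j' where 2: "\<bar>dist x (\<phi> a (pt i')) - t2\<bar> \<le> K"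
      "dist (pt i') (\<phi> (inv a \<otimes> b) (pt j')) \<le> B2"
      using pts[of t2] t12 by auto
    have "K * L \<le> dist (\<phi> a (pt i)) (\<phi> a (pt i'))"
      using 1(1) 2(1) t12 dist_triangle[of x "\<phi> a (pt i')" "\<phi> a (pt i)"] by linarith
    also have "\<dots> \<le> K * \<bar>real_of_int i - real_of_int i'\<bar>"
      using pt_lipschitz act_dist[OF ab(1)] by simp
    finally have "L \<le> \<bar>real_of_int i - real_of_int i'\<bar>" using K_ge_1 by simp
    then show ?thesis using L(2)[OF _ 1(2) 2(2)] ab by simp
  qed
  moreover have "0 < K * L + 2 * K" using K_ge_1 L(1) by (simp add: add_pos_pos)
  ultimately show ?thesis unfolding overlap_bound_def by blast
qed

text \<open>A large product means that the axis and its translate by \<open>h\<close> leave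
  \<open>x0\<close> together, over a length of about the product. Such an overlap would make
  \<open>inv \<one> \<otimes> h\<close> elementary.\<close>

lemma corner_bounded:
  assumes h: "h \<in> carrier G" "h \<notin> elementary"
  shows "\<exists>C1\<ge>0. \<forall>n m. gprod (pt n) (\<phi> h (pt m)) x0 \<le> C1"
proof -
  define H where "H = dist x0 (\<phi> h x0)"
  have H0: "0 \<le> H" by (simp add: H_def)
  define B where "B = 2 * K + C + 2 * H + 2 * \<delta>"
  have B0: "0 \<le> B" "H \<le> B" using K_ge_1 C_nonneg H0 delta_ge_1 by (auto simp: B_def)
  obtain L where L: "0 < L" "overlap_bound B L" using overlap_along_geodesic by blast
  have "gprod (pt n) (\<phi> h (pt m)) x0 \<le> L + K + H" for n m
  proof (rule ccontr)
    assume big: "\<not> gprod (pt n) (\<phi> h (pt m)) x0 \<le> L + K + H"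
    define S where "S = gprod (pt n) (\<phi> h (pt m)) x0"
    have S: "L + K + H < S" using big by (simp add: S_def)
    have S_le: "S \<le> dist x0 (pt n)" "S \<le> dist x0 (\<phi> h (pt m))"
      unfolding S_def using gprod_le_dist[of "pt n" "\<phi> h (pt m)" x0] by (auto simp: dist_commute)
    \<comment> \<open>A point of the translated axis at distance about \<open>S\<close> from
      \<open>x0\<close>. Up to this distance the two directions agree, so the point is also near a
      geodesic from \<open>x0\<close> to \<open>pt n\<close>.\<close>
    have "\<exists>j. \<bar>dist x0 (\<phi> h (pt j)) - S\<bar> \<le> K \<and>
        gprod x0 (\<phi> h (pt m)) (\<phi> h (pt j)) \<le> C + 2 * H + \<delta>"
    proof (rule axis_point_at_distance[OF h(1)])
      show "gprod x0 (\<phi> h (pt m)) (\<phi> h (pt 0)) \<le> H"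
        using gprod_le_dist(1)[of x0 "\<phi> h (pt m)" "\<phi> h x0"] by (simp add: H_def)
      show "gprod x0 (\<phi> h (pt m)) (\<phi> h (pt m)) \<le> H" using H0 by (simp add: gprod_def)
      show "dist x0 (\<phi> h (pt 0)) \<le> S" using S L(1) K_ge_1 by (simp add: H_def)
      show "S \<le> dist x0 (\<phi> h (pt m))" by (rule S_le)
    qed
    then obtain j where j: "\<bar>dist x0 (\<phi> h (pt j)) - S\<bar> \<le> K"
        "gprod x0 (\<phi> h (pt m)) (\<phi> h (pt j)) \<le> C + 2 * H + \<delta>" by blast
    define y where "y = \<phi> h (pt j)"
    have "S - K - C - 2 * H - \<delta> \<le> gprod y (\<phi> h (pt m)) x0"
      using j gprod_switch[of y "\<phi> h (pt m)" x0] unfolding y_def[symmetric] by linarith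
    then have "S - K - C - 2 * H - 2 * \<delta> \<le> gprod y (pt n) x0"
      using gprod_hyp[of y "\<phi> h (pt m)" x0 "pt n"] K_ge_1 C_nonneg H0 delta_ge_1
      unfolding S_def by (simp add: gprod_commute min_def split: if_splits)
    then have gy: "gprod x0 (pt n) y \<le> B"
      using gprod_switch[of x0 "pt n" y] j(1) unfolding y_def[symmetric] B_def
      by (simp add: dist_commute)
    have "inv \<one> \<otimes> h \<in> elementary"
    proof (rule L(2)[unfolded overlap_bound_def, rule_format, of \<one> h x0 "pt n" 0 n 0 j])
      show "gprod x0 (pt n) (\<phi> h (pt 0)) \<le> B"
        using gprod_le_dist(1)[of x0 "pt n" "\<phi> h x0"] B0 by (simp add: H_def)
      show "gprod x0 (pt n) (\<phi> h (pt j)) \<le> B" using gy by (simp add: y_def)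
      show "L \<le> min (dist x0 (\<phi> \<one> (pt n))) (dist x0 (\<phi> h (pt j)))
          - max (dist x0 (\<phi> \<one> (pt 0))) (dist x0 (\<phi> h (pt 0)))"
        using S S_le j(1) H0 K_ge_1 by (simp add: act_one H_def[symmetric])
    qed (use h B0 in \<open>auto simp: act_one gprod_def dist_commute\<close>)
    then show False using h by simp
  qed
  moreover have "0 \<le> L + K + H" using L(1) K_ge_1 H0 by simp
  ultimately show ?thesis by blast
qed

text \<open>If \<open>u\<close> commutes with \<open>g [^] l\<close>, it moves \<open>pt l\<close>
  exactly as far as \<open>x0\<close>. For a multiple \<open>l\<close> of \<open>k\<close> beyond
  \<open>int N\<close>, fellow travelling bounds the displacement of \<open>pt (int N)\<close> too,
  and \<open>wpd\<close> leaves finitely many \<open>u\<close>.\<close>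

lemma finite_centralizing:
  "finite {u \<in> carrier G. dist x0 (\<phi> u x0) \<le> B \<and>
    (\<exists>k>0. \<forall>m::int. u \<otimes> g [^] (k * m) = g [^] (k * m) \<otimes> u)}" (is "finite ?S")
proof (cases "0 \<le> B")
  case False
  then have "\<not> dist x0 y \<le> B" for y using zero_le_dist[of x0 y] by linarith
  then show ?thesis by auto
next
  case True
  define B' where "B' = 5 * B + 2 * C + 2 * \<delta>"
  have B': "0 < B'" "B \<le> B'" using True C_nonneg delta_ge_1 by (auto simp: B'_def)
  obtain N :: nat where N: "0 < N" "finite {u \<in> carrier G.
      dist x0 (\<phi> u x0) \<le> B' \<and> dist (\<phi> (g [^] N) x0) (\<phi> u (\<phi> (g [^] N) x0)) \<le> B'}"
    using wpd[OF B'(1)] by auto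
  have "dist (pt (int N)) (\<phi> u (pt (int N))) \<le> B'" if "u \<in> ?S" for u
  proof -
    obtain k where k: "k > 0" "\<And>m::int. u \<otimes> g [^] (k * m) = g [^] (k * m) \<otimes> u"
      using \<open>u \<in> ?S\<close> by blast
    have u: "u \<in> carrier G" "dist x0 (\<phi> u x0) \<le> B" using \<open>u \<in> ?S\<close> by auto
    define l where "l = k * int N"
    have "\<phi> u (pt l) = \<phi> (g [^] l) (\<phi> u x0)"
      unfolding pt_def l_def using k(2)[of "int N"] u g_in by (simp add: act_mult[symmetric])
    then have "dist (pt l) (\<phi> u (pt l)) = dist x0 (\<phi> u x0)"
      using act_dist[of "g [^] l" x0 "\<phi> u x0"] g_in by (simp add: pt_def)
    moreover have "int N \<le> l" unfolding l_def using k(1) by (simp add: mult_le_cancel_right1)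
    ultimately show ?thesis
      using fellow_travel[of u B l l 1 "int N"] u unfolding B'_def by simp
  qed
  then have "?S \<subseteq> {u \<in> carrier G.
      dist x0 (\<phi> u x0) \<le> B' \<and> dist (\<phi> (g [^] N) x0) (\<phi> u (\<phi> (g [^] N) x0)) \<le> B'}"
    using B' by (auto simp: pt_def int_pow_int)
  then show ?thesis using N(2) finite_subset by blast
qed

text \<open>Two elements that invert powers of \<open>g\<close> differ by one that commutes with a
  power. The reversing elements therefore lie in a single translate of \<open>P (2 * B)\<close>,
  with \<open>2 * B\<close> from the triangle inequality.\<close>

lemma finite_elementary_ball: "finite {u \<in> elementary. dist x0 (\<phi> u x0) \<le> B}" (is "finite ?S")
proof -
  define P where "P B = {u \<in> carrier G. dist x0 (\<phi> u x0) \<le> B \<and>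
    (\<exists>k>0. \<forall>m::int. u \<otimes> g [^] (k * m) = g [^] (k * m) \<otimes> u)}" for B
  have P: "finite (P B)" for B unfolding P_def by (rule finite_centralizing)
  show ?thesis
  proof (cases "?S \<subseteq> P B")
    case True
    then show ?thesis using P finite_subset by blast
  next
    case False
    then obtain a where a: "a \<in> ?S" "a \<notin> P B" by blast
    have flip: "\<exists>k>0. \<forall>m::int. b \<otimes> g [^] (k * m) = g [^] (- (k * m)) \<otimes> b"
      if "b \<in> ?S" "b \<notin> P B" for b
    proof -
      obtain k \<epsilon> :: int where k: "0 < k" "\<epsilon> \<in> {1, -1}"
        "\<And>m::int. b \<otimes> g [^] (k * m) = g [^] (\<epsilon> * k * m) \<otimes> b"
        using \<open>b \<in> ?S\<close> unfolding elementary_def by blast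
      have "\<epsilon> \<noteq> 1"
      proof
        assume "\<epsilon> = 1"
        then have "b \<in> P B" using that(1) k elementary_closed unfolding P_def by auto
        then show False using that by simp
      qed
      then show ?thesis using k by auto
    qed
    obtain k where k: "0 < k" "\<And>m::int. a \<otimes> g [^] (k * m) = g [^] (- (k * m)) \<otimes> a"
      using flip[OF a] by blast
    have aG: "a \<in> carrier G" using a elementary_closed by blast
    have inva: "inv a \<otimes> g [^] (- (k * m)) = g [^] (k * m) \<otimes> inv a" for m
      using inv_intertwine[OF aG _ _ k(2)] g_in by simp
    have "b \<in> (\<lambda>c. a \<otimes> c) ` P (2 * B)" if b: "b \<in> ?S" "b \<notin> P B" for b
    proof -
      obtain l where l: "0 < l" "\<And>m::int. b \<otimes> g [^] (l * m) = g [^] (- (l * m)) \<otimes> b"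
        using flip[OF b] by blast
      have bG: "b \<in> carrier G" using b elementary_closed by blast
      define c where "c = inv a \<otimes> b"
      have c: "c \<in> carrier G" using aG bG by (simp add: c_def)
      have "dist x0 (\<phi> c x0) = dist (\<phi> a x0) (\<phi> b x0)"
        using act_dist_inv[of a "\<phi> b x0" x0] aG bG by (simp add: c_def act_mult dist_commute)
      also have "\<dots> \<le> 2 * B"
        using a b dist_triangle[of "\<phi> a x0" "\<phi> b x0" x0] by (simp add: dist_commute)
      finally have "dist x0 (\<phi> c x0) \<le> 2 * B" .
      moreover have "c \<otimes> g [^] ((k * l) * m) = g [^] ((k * l) * m) \<otimes> c" for m
      proof -
        have "c \<otimes> g [^] ((k * l) * m) = inv a \<otimes> (b \<otimes> g [^] (l * (k * m)))"
          using aG bG g_in by (simp add: c_def m_assoc ac_simps)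
        also have "\<dots> = (inv a \<otimes> g [^] (- (k * (l * m)))) \<otimes> b"
          unfolding l(2) using aG bG g_in by (simp add: m_assoc ac_simps)
        also have "\<dots> = g [^] ((k * l) * m) \<otimes> c"
          unfolding inva using aG bG g_in by (simp add: c_def m_assoc ac_simps)
        finally show ?thesis .
      qed
      moreover have "0 < k * l" using k(1) l(1) by simp
      ultimately have "c \<in> P (2 * B)" unfolding P_def using c by blast
      moreover have "b = a \<otimes> c" using aG bG by (simp add: c_def m_assoc[symmetric])
      ultimately show ?thesis by blast
    qed
    then have "?S \<subseteq> P B \<union> (\<lambda>c. a \<otimes> c) ` P (2 * B)" by blast
    then show ?thesis using P by (meson finite_UnI finite_imageI finite_subset)
  qed
qed

text \<open>Intertwining puts \<open>\<phi> u (pt (\<sigma> * p))\<close> within \<open>b\<close> of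
  \<open>pt (\<epsilon> * \<sigma> * p)\<close>, however large \<open>p\<close> is. For
  \<open>p\<close> large compared with \<open>b\<close>, these two points are seen from
  \<open>\<phi> u x0\<close> in the same direction, so this point is near a geodesic between axis
  points and, by stability, near the axis. The choice of \<open>p\<close> depends on
  \<open>u\<close>, the resulting bound does not.\<close>

lemma elementary_orbit_near_axis:
  "\<exists>B. \<forall>u\<in>elementary. \<exists>i. dist (pt i) (\<phi> u x0) \<le> B"
proof -
  obtain C' where C': "0 \<le> C'" "\<And>(a::nat \<Rightarrow> 'x) n y. quasi_chain K a n \<Longrightarrow>
      \<exists>k\<le>n. dist y (a k) \<le> 4 * gprod (a 0) (a n) y + C'"
    using morse[OF K_ge_1] by blast
  have "\<exists>i. dist (pt i) (\<phi> u x0) \<le> 4 * (C + 2 * \<delta>) + C'" if u: "u \<in> elementary" for u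
  proof -
    obtain k \<epsilon> :: int where k: "u \<in> carrier G" "0 < k" "\<epsilon> \<in> {1, -1}"
      "\<And>m::int. u \<otimes> g [^] (k * m) = g [^] (\<epsilon> * k * m) \<otimes> u"
      using u unfolding elementary_def by blast
    define y where "y = \<phi> u x0"
    define b where "b = dist x0 y"
    define n where "n = nat \<lceil>K * (C + 2 * \<delta> + b + 1) + K\<rceil>"
    define p where "p = k * int n"
    have "K * (C + 2 * \<delta> + b + 1) + K \<le> real n" unfolding n_def by linarith
    also have "real n \<le> real_of_int p"
      unfolding p_def using k(2) by (metis mult_le_cancel_right1 of_int_le_iff of_int_of_nat_eq
        of_nat_0_le_iff zle_add1_eq_le add_0 less_irrefl linorder_not_less)
    finally have p: "K * (C + 2 * \<delta> + b + 1) + K \<le> real_of_int p" .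
    have far: "C + 2 * \<delta> + b < dist x0 (pt (\<sigma> * p))" if "\<sigma> \<in> {1, -1}" for \<sigma>
    proof -
      have "real_of_int p \<le> \<bar>real_of_int 0 - real_of_int (\<sigma> * p)\<bar>" using that by auto
      also have "\<dots> \<le> K * dist x0 (pt (\<sigma> * p)) + K" using pt_growth[of 0 "\<sigma> * p"] by simp
      finally have "K * (C + 2 * \<delta> + b + 1) \<le> K * dist x0 (pt (\<sigma> * p))" using p by linarith
      then show ?thesis using K_ge_1 by simp
    qed
    have shift: "dist (\<phi> u (pt (\<sigma> * p))) (pt (\<epsilon> * \<sigma> * p)) = b" for \<sigma>
    proof -
      have "\<phi> u (pt (\<sigma> * p)) = \<phi> (g [^] (\<epsilon> * \<sigma> * p)) y"
        using k(4)[of "\<sigma> * int n"] k(1) g_in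
        by (simp add: pt_def y_def p_def act_mult[symmetric] ac_simps)
      then show ?thesis using act_dist[of "g [^] (\<epsilon> * \<sigma> * p)" y x0] g_in
        by (simp add: pt_def b_def dist_commute)
    qed
    have near: "C + 2 * \<delta> < gprod (\<phi> u (pt (\<sigma> * p))) (pt (\<epsilon> * \<sigma> * p)) y" if "\<sigma> \<in> {1, -1}" for \<sigma>
    proof -
      have "dist y (\<phi> u (pt (\<sigma> * p))) = dist x0 (pt (\<sigma> * p))"
        unfolding y_def using act_dist[OF k(1)] by simp
      then show ?thesis
        using far[OF that] shift[of \<sigma>]
          dist_triangle[of "\<phi> u (pt (\<sigma> * p))" y "pt (\<epsilon> * \<sigma> * p)"]
        by (simp add: gprod_def dist_commute)
    qed
    have "0 \<le> p" using k(2) by (simp add: p_def)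
    then have "gprod (pt (- p)) (pt p) x0 \<le> C" using pt_gprod[of "- p" 0 p] by simp
    then have "gprod (\<phi> u (pt (- p))) (\<phi> u (pt p)) y \<le> C"
      unfolding y_def using act_gprod[OF k(1)] by simp
    then have "gprod (pt (- (\<epsilon> * p))) (pt (\<epsilon> * p)) y \<le> C + 2 * \<delta>"
      using near[of 1] near[of "-1"] delta_ge_1
        gprod_hyp[of "\<phi> u (pt (- p))" "pt (- (\<epsilon> * p))" y "\<phi> u (pt p)"]
        gprod_hyp[of "pt (- (\<epsilon> * p))" "pt (\<epsilon> * p)" y "\<phi> u (pt p)"]
      by (simp add: gprod_commute min_def split: if_splits)
    then have *: "gprod (pt (- p)) (pt p) y \<le> C + 2 * \<delta>" using k(3) by (auto simp: gprod_commute)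
    define a where "a l = pt (- p + int l)" for l
    have "quasi_chain K a (nat (2 * p))"
      unfolding quasi_chain_def a_def
    proof (intro conjI allI impI)
      fix l m :: nat assume "l \<le> m"
      then show "real (m - l) \<le> K * dist (pt (- p + int l)) (pt (- p + int m)) + K"
        using pt_growth[of "- p + int l" "- p + int m"] by (simp add: of_nat_diff)
    next
      fix l show "dist (pt (- p + int l)) (pt (- p + int (Suc l))) \<le> K"
        using pt_lipschitz[of "- p + int l" "- p + int (Suc l)"] by simp
    qed
    from C'(2)[OF this, of y] obtain l where
      "dist y (a l) \<le> 4 * gprod (a 0) (a (nat (2 * p))) y + C'" by blast
    then have "dist y (a l) \<le> 4 * (C + 2 * \<delta>) + C'" using * \<open>0 \<le> p\<close> by (simp add: a_def)
    then show ?thesis unfolding y_def a_def by (metis dist_commute)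
  qed
  then show ?thesis by blast
qed

text \<open>If every element were elementary, each right coset of the cyclic group \<open>Z\<close>
  would contain an element moving \<open>x0\<close> by at most \<open>B\<close>, obtained by
  shifting the orbit point back along the axis. There are only finitely many such elements, so
  \<open>Z\<close> would have finite index.\<close>

lemma nonelementary_exists:
  assumes "\<not> virtually_cyclic G"
  shows "\<exists>h\<in>carrier G. h \<notin> elementary"
proof (rule ccontr)
  assume "\<not> (\<exists>h\<in>carrier G. h \<notin> elementary)"
  then have all: "u \<in> elementary" if "u \<in> carrier G" for u using that by blast
  define Z where "Z = range (\<lambda>i::int. g [^] i)"
  have Z: "subgroup Z G"
  proof (rule subgroupI)
    show "Z \<subseteq> carrier G" using g_in by (auto simp: Z_def)
    show "Z \<noteq> {}" by (auto simp: Z_def)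
    show "inv a \<in> Z" if "a \<in> Z" for a
    proof -
      obtain i :: int where "a = g [^] i" using \<open>a \<in> Z\<close> by (auto simp: Z_def)
      then have "inv a = g [^] (- i)" using int_pow_neg[OF g_in, of i] by simp
      then show ?thesis unfolding Z_def by (metis rangeI)
    qed
    show "a \<otimes> b \<in> Z" if "a \<in> Z" "b \<in> Z" for a b
      using that by (auto simp: Z_def g_pow_simps)
  qed
  have "cyclic_group (G\<lparr>carrier := Z\<rparr>)"
  proof -
    interpret Z: group "G\<lparr>carrier := Z\<rparr>" using subgroup.subgroup_is_group[OF Z] group_axioms by simp
    have gZ: "g \<in> Z" unfolding Z_def using int_pow_1[OF g_in] by (metis rangeI)
    have "g [^]\<^bsub>G\<lparr>carrier := Z\<rparr>\<^esub> i = g [^] i" for i :: int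
      using int_pow_consistent[OF Z gZ] by simp
    then have "carrier (G\<lparr>carrier := Z\<rparr>) = range (\<lambda>i::int. g [^]\<^bsub>G\<lparr>carrier := Z\<rparr>\<^esub> i)"
      by (simp add: Z_def)
    then show ?thesis unfolding Z.cyclic_group using gZ by (intro bexI[of _ g]) auto
  qed
  moreover have "finite (rcosets Z)"
  proof -
    obtain B where B: "\<And>u. u \<in> elementary \<Longrightarrow> \<exists>i. dist (pt i) (\<phi> u x0) \<le> B"
      using elementary_orbit_near_axis by blast
    have "Z #> u \<in> (\<lambda>u. Z #> u) ` {u \<in> elementary. dist x0 (\<phi> u x0) \<le> B}"
      if u: "u \<in> carrier G" for u
    proof -
      obtain i where i: "dist (pt i) (\<phi> u x0) \<le> B" using B all[OF u] by blast
      define u' where "u' = g [^] (- i) \<otimes> u"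
      have u': "u' \<in> carrier G" using u g_in by (simp add: u'_def)
      have "dist x0 (\<phi> u' x0) \<le> B"
        using i act_dist[of "g [^] (- i)" "pt i" "\<phi> u x0"] u g_in by (simp add: u'_def act_mult)
      moreover have "u' \<in> Z #> u" unfolding u'_def r_coset_def Z_def by blast
      then have "Z #> u = Z #> u'" using repr_independence u Z by blast
      ultimately show ?thesis using all[OF u'] by blast
    qed
    then have "rcosets Z \<subseteq> (\<lambda>u. Z #> u) ` {u \<in> elementary. dist x0 (\<phi> u x0) \<le> B}"
      unfolding RCOSETS_def by blast
    then show ?thesis using finite_elementary_ball by (meson finite_imageI finite_subset)
  qed
  ultimately show False using assms Z unfolding virtually_cyclic_def by blast
qed

end

section \<open>Counting quasi-homomorphisms\<close>

definition unit_path :: "'x::metric_space list \<Rightarrow> 'x \<Rightarrow> 'x \<Rightarrow> bool"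
  where "unit_path as x z \<longleftrightarrow> as \<noteq> [] \<and> hd as = x \<and> last as = z \<and>
    successively (\<lambda>u v. dist u v \<le> 1) as"

lemma unit_path_append:
  "unit_path as x y \<Longrightarrow> unit_path bs y' z \<Longrightarrow> dist y y' \<le> 1 \<Longrightarrow> unit_path (as @ bs) x z"
  by (auto simp: unit_path_def successively_append_iff)

lemma unit_path_replace:
  assumes "unit_path (us @ bs @ vs) x z" "unit_path bs a b" "unit_path cs a b"
  shows "unit_path (us @ cs @ vs) x z"
  using assms by (auto simp: unit_path_def successively_append_iff hd_append last_append)

lemma unit_path_length: "unit_path as x z \<Longrightarrow> dist x z + 1 \<le> real (length as)"
proof (induction as arbitrary: x)
  case (Cons a as)
  show ?case
  proof (cases as)
    case Nil
    then show ?thesis using Cons.prems by (auto simp: unit_path_def)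
  next
    case (Cons b bs)
    then have "unit_path as b z" "dist x b \<le> 1"
      using Cons.prems by (auto simp: unit_path_def successively_Cons)
    then show ?thesis using Cons.IH[of b] dist_triangle[of x z b] by simp
  qed
qed (simp add: unit_path_def)

lemma successively_nth:
  "successively P as \<Longrightarrow> Suc i < length as \<Longrightarrow> P (as ! i) (as ! Suc i)"
proof (induction as arbitrary: i)
  case (Cons a as)
  then show ?case by (cases i) (auto simp: successively_Cons hd_conv_nth)
qed simp

lemma unit_path_slice:
  assumes "unit_path as x z" "i \<le> j" "j < length as"
  shows "unit_path (take (Suc j - i) (drop i as)) (as ! i) (as ! j)"
    and "as = take i as @ take (Suc j - i) (drop i as) @ drop (Suc j) as"
proof -
  show eq: "as = take i as @ take (Suc j - i) (drop i as) @ drop (Suc j) as"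
    using assms by (metis append_take_drop_id drop_drop le_SucI le_add_diff_inverse2)
  define bs where "bs = take (Suc j - i) (drop i as)"
  have len: "length bs = Suc j - i" using assms by (simp add: bs_def)
  then have "bs \<noteq> []" using assms by auto
  moreover have "hd bs = as ! i"
    using assms by (simp add: bs_def hd_drop_conv_nth)
  moreover have "last bs = as ! j"
    using assms len \<open>bs \<noteq> []\<close> by (simp add: last_conv_nth) (simp add: bs_def)
  moreover have "successively (\<lambda>u v. dist u v \<le> 1) bs"
    using assms(1) eq unfolding bs_def[symmetric] unit_path_def
    by (metis successively_append_iff)
  ultimately show "unit_path (take (Suc j - i) (drop i as)) (as ! i) (as ! j)"
    unfolding bs_def[symmetric] unit_path_def by blast
qed

context hyperbolic_space
begin

text \<open>The 5 consists of the additive error 4 of a coarse geodesic and of 1, because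
  \<open>n\<close> steps list \<open>n + 1\<close> points.\<close>

lemma unit_path_exists: "\<exists>as. unit_path as x (z::'x) \<and> real (length as) \<le> dist x z + 5"
proof -
  obtain c n where c: "c 0 = x" "c n = z" "coarse_geod c n" by (rule coarse_geodE)
  define as where "as = map c [0..<Suc n]"
  have succ: "successively (\<lambda>u v. dist u v \<le> 1) (map c [0..<Suc m])" if "m \<le> n" for m
    using that
  proof (induction m)
    case (Suc m)
    have "dist (c m) (c (Suc m)) \<le> 1" using coarse_geodD[OF c(3), of m "Suc m"] Suc.prems by simp
    then show ?case using Suc by (simp add: successively_append_iff last_map)
  qed simp
  have "successively (\<lambda>u v. dist u v \<le> 1) as" unfolding as_def by (rule succ) simp
  moreover have "as \<noteq> []" by (simp add: as_def)
  moreover have "hd as = x" using c by (simp add: as_def hd_map upt_conv_Cons del: upt_Suc)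
  moreover have "last as = z" using c by (simp add: as_def)
  ultimately have "unit_path as x z" unfolding unit_path_def by blast
  moreover have "real (length as) \<le> dist x z + 5"
    using coarse_geodD[OF c(3), of 0 n] c by (simp add: as_def)
  ultimately show ?thesis by blast
qed

text \<open>The centre is the point of a coarse geodesic from \<open>x\<close> to \<open>y\<close>
  at distance about \<open>gprod y z x\<close> from \<open>x\<close>, where the approximating tripod
  branches.\<close>

lemma tripod_centre:
  "\<exists>m. gprod x y m \<le> 19 + \<delta> \<and> gprod y z m \<le> 19 + \<delta> \<and> gprod x z m \<le> 19 + \<delta>"
  for x y z :: 'x
proof -
  obtain c n where c: "c 0 = x" "c n = y" "coarse_geod c n" by (rule coarse_geodE)
  define p where "p = gprod y z x"
  have p: "0 \<le> p" "p \<le> real n"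
    using gprod_nonneg[of y z x] gprod_le_dist(1)[of y z x] coarse_geodD[OF c(3), of 0 n] c
    by (auto simp: p_def dist_commute)
  define i where "i = nat \<lfloor>p\<rfloor>"
  have i: "real i \<le> p" "p \<le> real i + 1" "i \<le> n" using p unfolding i_def by linarith+
  define m where "m = c i"
  have xm: "\<bar>dist x m - p\<bar> \<le> 5"
    using coarse_geodD[OF c(3), of 0 i] i c by (auto simp: m_def)
  have xym: "gprod x y m \<le> 2"
    using coarse_geod_gprod[OF c(3), of 0 i n] i c by (simp add: m_def)
  have "p - 7 \<le> gprod m y x"
    using gprod_switch[of m y x] xym xm by (simp add: dist_commute)
  then have "p - 7 - \<delta> \<le> gprod m z x"
    using gprod_hyp[of m y x z] p_def by (simp add: min_def split: if_splits)
  then have xzm: "gprod x z m \<le> 12 + \<delta>"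
    using gprod_switch[of x z m] xm by (simp add: dist_commute)
  moreover have "gprod y z m \<le> 19 + \<delta>"
    using xm xym xzm p_def by (simp add: gprod_def dist_commute field_simps)
  ultimately show ?thesis using xym delta_ge_1 by (intro exI[of _ m]) auto
qed

end

context hyperbolic_action
begin

lemma unit_path_act:
  "a \<in> carrier G \<Longrightarrow> unit_path as x z \<Longrightarrow> unit_path (map (\<phi> a) as) (\<phi> a x) (\<phi> a z)"
  by (auto simp: unit_path_def hd_map last_map successively_map act_dist)

text \<open>The copies are disjoint, so the length of the list bounds their number. A relation is
  used instead of a maximal count because a list can be cut up in many ways; the minimum in
  \<open>wdist\<close> selects the best one.\<close>

inductive occ :: "'x list \<Rightarrow> 'x list \<Rightarrow> nat \<Rightarrow> bool" for ps
  where
    occ_Nil: "occ ps [] 0"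
  | occ_skip: "occ ps as k \<Longrightarrow> occ ps (x # as) k"
  | occ_copy: "a \<in> carrier G \<Longrightarrow> occ ps as k \<Longrightarrow> occ ps (map (\<phi> a) ps @ as) (Suc k)"

lemma occ_0: "occ ps as 0"
  by (induction as) (auto intro: occ.intros)

lemma occ_append: "occ ps as k \<Longrightarrow> occ ps bs l \<Longrightarrow> occ ps (as @ bs) (k + l)"
  by (induction rule: occ.induct) (auto intro: occ.intros)

text \<open>At most one of the disjoint copies straddles the cut, whence the 1.\<close>

lemma occ_split:
  "occ ps (as @ bs) k \<Longrightarrow> \<exists>k1 k2. occ ps as k1 \<and> occ ps bs k2 \<and> k \<le> k1 + k2 + 1"
proof (induction "as @ bs" k arbitrary: as bs rule: occ.induct)
  case occ_Nil
  then show ?case by (auto intro: occ.intros)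
next
  case (occ_skip cs k x)
  show ?case
  proof (cases as)
    case Nil
    then show ?thesis using occ.occ_skip[OF occ_skip(1), of x] occ_skip(3)
      by (intro exI[of _ 0] exI[of _ k]) (auto intro: occ_0)
  next
    case (Cons a as')
    then have "cs = as' @ bs" using occ_skip by simp
    then obtain k1 k2 where "occ ps as' k1" "occ ps bs k2" "k \<le> k1 + k2 + 1"
      using occ_skip(2) by blast
    then show ?thesis using Cons by (auto intro: occ.occ_skip)
  qed
next
  case (occ_copy a cs k)
  from occ_copy(4) obtain us where
    "(map (\<phi> a) ps = as @ us \<and> us @ cs = bs) \<or> (map (\<phi> a) ps @ us = as \<and> cs = us @ bs)"
    by (auto simp: append_eq_append_conv2)
  then show ?case
  proof
    assume *: "map (\<phi> a) ps = as @ us \<and> us @ cs = bs"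
    have "occ ps bs k" using occ_append[OF occ_0[of ps us] occ_copy(2)] * by simp
    then show ?thesis by (intro exI[of _ 0] exI[of _ k]) (auto intro: occ_0)
  next
    assume *: "map (\<phi> a) ps @ us = as \<and> cs = us @ bs"
    then obtain k1 k2 where "occ ps us k1" "occ ps bs k2" "k \<le> k1 + k2 + 1"
      using occ_copy(3) by blast
    then show ?thesis using * occ.occ_copy[OF occ_copy(1), of ps us k1]
      by (intro exI[of _ "Suc k1"] exI[of _ k2]) auto
  qed
qed

lemma occ_length: "occ ps as k \<Longrightarrow> k * length ps \<le> length as"
  by (induction rule: occ.induct) auto

lemma occ_act:
  assumes "occ ps as k" and b: "b \<in> carrier G"
  shows "occ ps (map (\<phi> b) as) k"
  using assms(1)
proof (induction rule: occ.induct)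
  case (occ_copy a as k)
  have eq: "map (\<phi> b) (map (\<phi> a) ps) = map (\<phi> (b \<otimes> a)) ps"
    using b occ_copy by (simp add: act_mult)
  show ?case unfolding map_append eq using b occ_copy by (intro occ.occ_copy) auto
qed (auto intro: occ.intros)

lemma occ_ex: "occ ps as k \<Longrightarrow> 0 < k \<Longrightarrow> \<exists>a\<in>carrier G. \<exists>us vs. as = us @ map (\<phi> a) ps @ vs"
proof (induction rule: occ.induct)
  case (occ_skip as k x)
  then obtain a us vs where "a \<in> carrier G" "as = us @ map (\<phi> a) ps @ vs" by blast
  then show ?case by (intro bexI[of _ a] exI[of _ "x # us"] exI[of _ vs]) auto
next
  case (occ_copy a as k)
  then show ?case by (intro bexI[of _ a] exI[of _ "[]"] exI[of _ as]) auto
qed simp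

text \<open>An asymmetric distance: the least length of a path, where every translate of the list \<open>ps\<close>
  inside the path is rewarded by \<open>lam\<close>.\<close>

definition wdist :: "nat \<Rightarrow> 'x list \<Rightarrow> 'x \<Rightarrow> 'x \<Rightarrow> nat"
  where "wdist lam ps x z =
    (LEAST n. \<exists>as k. unit_path as x z \<and> occ ps as k \<and> n + lam * k = length as)"

text \<open>The second condition caps the total reward at half the length of a path. It keeps length
  minus reward nonnegative and makes optimal paths quasi-geodesic uniformly in the pattern.\<close>

definition pattern :: "nat \<Rightarrow> 'x list \<Rightarrow> bool"
  where "pattern lam ps \<longleftrightarrow> ps \<noteq> [] \<and> 2 * lam \<le> length ps"

definition optimal :: "nat \<Rightarrow> 'x list \<Rightarrow> 'x list \<Rightarrow> nat \<Rightarrow> 'x \<Rightarrow> 'x \<Rightarrow> bool"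
  where "optimal lam ps as k x z \<longleftrightarrow>
    unit_path as x z \<and> occ ps as k \<and> wdist lam ps x z + lam * k = length as"

lemma occ_pattern:
  assumes "pattern lam ps" "occ ps as k"
  shows "2 * (lam * k) \<le> length as"
proof -
  have "2 * lam \<le> length ps" using assms(1) by (simp add: pattern_def)
  then have "2 * lam * k \<le> length ps * k" by (rule mult_right_mono) simp
  also have "\<dots> \<le> length as" using occ_length[OF assms(2)] by (simp only: mult.commute)
  finally show ?thesis by (simp only: mult.assoc)
qed

lemma wdist_le:
  assumes "pattern lam ps" "unit_path as x z" "occ ps as k"
  shows "wdist lam ps x z + lam * k \<le> length as"
proof -
  have "wdist lam ps x z \<le> length as - lam * k"
    unfolding wdist_def using assms occ_pattern[OF assms(1,3)]
    by (intro Least_le exI[of _ as] exI[of _ k]) auto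
  then show ?thesis using occ_pattern[OF assms(1,3)] by simp
qed

lemma optimal_exists:
  assumes "pattern lam ps"
  shows "\<exists>as k. optimal lam ps as k x z"
proof -
  obtain as where as: "unit_path as x z" using unit_path_exists by blast
  have "\<exists>n as k. unit_path as x z \<and> occ ps as k \<and> n + lam * k = length as"
    using as occ_0[of ps as] by (intro exI[of _ "length as"] exI[of _ as] exI[of _ 0]) auto
  then have "\<exists>as k. unit_path as x z \<and> occ ps as k \<and> wdist lam ps x z + lam * k = length as"
    unfolding wdist_def by (rule LeastI_ex)
  then show ?thesis unfolding optimal_def .
qed

lemma wdist_triangle:
  assumes "pattern lam ps"
  shows "wdist lam ps x z \<le> wdist lam ps x y + wdist lam ps y z"
proof -
  obtain as k bs l where "optimal lam ps as k x y" "optimal lam ps bs l y z"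
    using optimal_exists[OF assms] by metis
  then have *: "unit_path as x y" "occ ps as k" "wdist lam ps x y + lam * k = length as"
    "unit_path bs y z" "occ ps bs l" "wdist lam ps y z + lam * l = length bs"
    by (auto simp: optimal_def)
  have "wdist lam ps x z + lam * (k + l) \<le> length (as @ bs)"
    using * by (intro wdist_le[OF assms] unit_path_append[of as x y] occ_append) auto
  then show ?thesis using * by (simp add: algebra_simps)
qed

lemma wdist_le_dist:
  assumes "pattern lam ps"
  shows "real (wdist lam ps x z) \<le> dist x z + 5"
proof -
  obtain as where as: "unit_path as x z" "real (length as) \<le> dist x z + 5"
    using unit_path_exists by blast
  then show ?thesis using wdist_le[OF assms as(1) occ_0] by simp
qed

lemma wdist_act:
  assumes "pattern lam ps" "b \<in> carrier G"
  shows "wdist lam ps (\<phi> b x) (\<phi> b z) = wdist lam ps x z"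
proof -
  have *: "wdist lam ps (\<phi> b x) (\<phi> b z) \<le> wdist lam ps x z"
    if b: "b \<in> carrier G" for b x z
  proof -
    obtain as k where as: "optimal lam ps as k x z" using optimal_exists[OF assms(1)] by blast
    then have "wdist lam ps (\<phi> b x) (\<phi> b z) + lam * k \<le> length (map (\<phi> b) as)"
      using b by (intro wdist_le assms unit_path_act occ_act) (auto simp: optimal_def)
    then show ?thesis using as by (simp add: optimal_def)
  qed
  show ?thesis
    using *[OF assms(2), of x z] *[of "inv b" "\<phi> b x" "\<phi> b z"] assms(2) by simp
qed

text \<open>Compare with the path whose slice is replaced by an almost geodesic one. Only the copies
  inside the slice and at most two cut by its ends are lost; the former are worth at most half of
  the slice, which is moved to the other side and produces the factor 2.\<close>

lemma optimal_slice_length: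
  assumes ps: "pattern lam ps" and opt: "optimal lam ps (us @ bs @ vs) k x z"
    and bs: "unit_path bs a b"
  shows "real (length bs) \<le> 2 * dist a b + (4 * real lam + 10)"
proof -
  obtain cs where cs: "unit_path cs a b" "real (length cs) \<le> dist a b + 5"
    using unit_path_exists by blast
  obtain k1 k' where k1: "occ ps us k1" "occ ps (bs @ vs) k'" "k \<le> k1 + k' + 1"
    using opt occ_split unfolding optimal_def by blast
  obtain k2 k3 where k2: "occ ps bs k2" "occ ps vs k3" "k' \<le> k2 + k3 + 1"
    using occ_split[OF k1(2)] by blast
  have path: "unit_path (us @ cs @ vs) x z"
    using opt unit_path_replace[OF _ bs cs(1)] by (auto simp: optimal_def)
  have "occ ps (us @ cs @ vs) (k1 + (0 + k3))"
    by (intro occ_append k1 k2 occ_0)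
  from wdist_le[OF ps path this]
  have 1: "wdist lam ps x z + lam * (k1 + k3) \<le> length us + length cs + length vs" by simp
  have 2: "wdist lam ps x z + lam * k = length us + length bs + length vs"
    using opt by (simp add: optimal_def)
  have "lam * k \<le> lam * (k1 + k3 + (k2 + 2))" using k1 k2 by (intro mult_left_mono) auto
  then have "lam * k \<le> lam * (k1 + k3) + (lam * k2 + 2 * lam)" by (simp add: algebra_simps)
  then have "length bs \<le> length cs + lam * k2 + 2 * lam" using 1 2 by linarith
  then have "2 * length bs \<le> 2 * length cs + length bs + 4 * lam"
    using occ_pattern[OF ps k2(1)] by linarith
  then have "real (length bs) \<le> 2 * real (length cs) + 4 * real lam" by linarith
  then show ?thesis using cs(2) by linarith
qed

lemma optimal_quasi_chain:
  assumes ps: "pattern lam ps" and opt: "optimal lam ps as k x z"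
  shows "quasi_chain (4 * real lam + 10) (\<lambda>i. as ! i) (length as - 1)"
  unfolding quasi_chain_def
proof (intro conjI allI impI)
  have path: "unit_path as x z" using opt by (simp add: optimal_def)
  then have len: "0 < length as" by (auto simp: unit_path_def)
  fix i assume "i < length as - 1"
  then have "dist (as ! i) (as ! Suc i) \<le> 1"
    using path successively_nth[of "\<lambda>u v. dist u v \<le> 1" as i] by (auto simp: unit_path_def)
  then show "dist (as ! i) (as ! Suc i) \<le> 4 * real lam + 10" by linarith
next
  have path: "unit_path as x z" using opt by (simp add: optimal_def)
  then have len: "0 < length as" by (auto simp: unit_path_def)
  fix i j assume ij: "i \<le> j" "j \<le> length as - 1"
  then have j: "j < length as" using len by linarith
  define bs where "bs = take (Suc j - i) (drop i as)"
  have "unit_path bs (as ! i) (as ! j)" "as = take i as @ bs @ drop (Suc j) as"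
    using unit_path_slice[OF path ij(1) j] by (simp_all add: bs_def)
  then have "real (length bs) \<le> 2 * dist (as ! i) (as ! j) + (4 * real lam + 10)"
    using optimal_slice_length[OF ps, of "take i as" bs "drop (Suc j) as"] opt by simp
  moreover have "length bs = Suc j - i" using ij j by (simp add: bs_def)
  moreover have "2 * dist (as ! i) (as ! j) \<le> (4 * real lam + 10) * dist (as ! i) (as ! j)"
    by (intro mult_right_mono) auto
  ultimately show "real (j - i) \<le> (4 * real lam + 10) * dist (as ! i) (as ! j) + (4 * real lam + 10)"
    using ij by linarith
qed

text \<open>The constant does not depend on the pattern \<open>ps\<close>, only on the reward \<open>lam\<close>.\<close>

definition tracking :: "nat \<Rightarrow> real \<Rightarrow> bool"
  where "tracking lam C \<longleftrightarrow> 0 \<le> C \<and>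
    (\<forall>ps as k x z. pattern lam ps \<longrightarrow> optimal lam ps as k x z \<longrightarrow>
      (\<forall>i j l. i \<le> j \<longrightarrow> j \<le> l \<longrightarrow> l < length as \<longrightarrow> gprod (as ! i) (as ! l) (as ! j) \<le> C) \<and>
      (\<forall>y. \<exists>j<length as. dist y (as ! j) \<le> 4 * gprod x z y + C))"

lemma trackingD:
  assumes "tracking lam C" "pattern lam ps" "optimal lam ps as k x z"
  shows "i \<le> j \<Longrightarrow> j \<le> l \<Longrightarrow> l < length as \<Longrightarrow> gprod (as ! i) (as ! l) (as ! j) \<le> C"
    and "\<exists>j<length as. dist y (as ! j) \<le> 4 * gprod x z y + C"
  using assms unfolding tracking_def by blast+

lemma tracking_exists: "\<exists>C. tracking lam C"
proof -
  define K where "K = 4 * real lam + 10"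
  have "1 \<le> K" by (simp add: K_def)
  then obtain C where C: "0 \<le> C" "\<forall>(a::nat \<Rightarrow> 'x) n. quasi_chain K a n \<longrightarrow>
    (\<forall>k\<le>n. gprod (a 0) (a n) (a k) \<le> C) \<and>
    (\<forall>y. \<exists>k\<le>n. dist y (a k) \<le> 4 * gprod (a 0) (a n) y + C)"
    using morse by blast
  have qc: "quasi_chain K (\<lambda>i. as ! i) (length as - 1)"
    if "pattern lam ps" "optimal lam ps as k x z" for ps as k x z
    unfolding K_def using that by (rule optimal_quasi_chain)
  have "tracking lam C"
    unfolding tracking_def
  proof (intro conjI allI impI C(1))
    fix ps as k x z and i j l :: nat
    assume *: "pattern lam ps" "optimal lam ps as k x z" "i \<le> j" "j \<le> l" "l < length as"
    have "quasi_chain K (\<lambda>k. as ! (i + k)) (l - i)"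
      using quasi_chain_sub[OF qc[OF *(1,2)], of i l] * by simp
    from C(2)[rule_format, OF this]
    have "\<forall>k\<le>l - i. gprod (as ! (i + 0)) (as ! (i + (l - i))) (as ! (i + k)) \<le> C" by blast
    then show "gprod (as ! i) (as ! l) (as ! j) \<le> C" using * by (auto dest: spec[of _ "j - i"])
  next
    fix ps as k x z y
    assume *: "pattern lam ps" "optimal lam ps as k x z"
    have ne: "as \<noteq> []" and ends: "as ! 0 = x" "as ! (length as - 1) = z"
      using * by (auto simp: optimal_def unit_path_def hd_conv_nth last_conv_nth)
    from C(2)[rule_format, OF qc[OF *]] obtain k where
      k: "k \<le> length as - 1" "dist y (as ! k) \<le> 4 * gprod x z y + C"
      unfolding ends by blast
    then have "k < length as" using ne by (cases as) auto
    then show "\<exists>j<length as. dist y (as ! j) \<le> 4 * gprod x z y + C" using k by blast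
  qed
  then show ?thesis by blast
qed

text \<open>A path without copies has more than \<open>dist x z\<close> points, so
  \<open>wdist\<close> can fall below the distance only if an optimal path contains a translate of
  the pattern. By tracking, its ends are near the geodesic; the last two products record the order
  in which they come.\<close>

lemma pattern_occurrence:
  "\<exists>C\<ge>0. \<forall>ps x z. pattern lam ps \<longrightarrow> dist x z \<le> real (wdist lam ps x z) \<or>
    (\<exists>a\<in>carrier G. gprod x z (\<phi> a (hd ps)) \<le> C \<and> gprod x z (\<phi> a (last ps)) \<le> C \<and>
      gprod x (\<phi> a (last ps)) (\<phi> a (hd ps)) \<le> C \<and> gprod (\<phi> a (hd ps)) z (\<phi> a (last ps)) \<le> C)"
proof -
  obtain C where C: "tracking lam C" using tracking_exists by blast
  have "dist x z \<le> real (wdist lam ps x z) \<or>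
    (\<exists>a\<in>carrier G. gprod x z (\<phi> a (hd ps)) \<le> C \<and> gprod x z (\<phi> a (last ps)) \<le> C \<and>
      gprod x (\<phi> a (last ps)) (\<phi> a (hd ps)) \<le> C \<and> gprod (\<phi> a (hd ps)) z (\<phi> a (last ps)) \<le> C)"
    if ps: "pattern lam ps" for ps x z
  proof -
    obtain as k where opt: "optimal lam ps as k x z" using optimal_exists[OF ps] by blast
    then have as: "unit_path as x z" "occ ps as k" "wdist lam ps x z + lam * k = length as"
      by (auto simp: optimal_def)
    show ?thesis
    proof (cases "k = 0")
      case True
      then show ?thesis using unit_path_length[OF as(1)] as(3) by simp
    next
      case False
      then obtain a us vs where a: "a \<in> carrier G" "as = us @ map (\<phi> a) ps @ vs"
        using occ_ex[OF as(2)] by blast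
      have ne: "ps \<noteq> []" using ps by (simp add: pattern_def)
      define i l where "i = length us" and "l = length us + (length ps - 1)"
      have "0 < length ps" using ne by simp
      then have "length ps - 1 < length ps + length vs" by linarith
      then have il: "i \<le> l" "l < length as" unfolding a(2) i_def l_def by auto
      have i: "as ! i = \<phi> a (hd ps)"
        unfolding a(2) i_def using ne by (simp add: nth_append hd_conv_nth)
      have l: "as ! l = \<phi> a (last ps)"
        unfolding a(2) l_def using ne by (simp add: nth_append last_conv_nth)
      have ends: "as ! 0 = x" "as ! (length as - 1) = z"
        using as(1) by (auto simp: unit_path_def hd_conv_nth last_conv_nth)
      note gp = trackingD(1)[OF C ps opt]
      have "i \<le> length as - 1" "l \<le> length as - 1" "length as - 1 < length as" using il by linarith+
      then show ?thesis
        using gp[of 0 i "length as - 1"] gp[of 0 l "length as - 1"] gp[of 0 i l]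
          gp[of i l "length as - 1"] il a(1) unfolding i l ends by auto
    qed
  qed
  then show ?thesis using C unfolding tracking_def by blast
qed

text \<open>Cut an optimal path at a point \<open>y\<close> near \<open>m\<close>: at most one copy
  is destroyed, and \<open>y\<close> is counted twice. The detours between \<open>y\<close> and
  \<open>m\<close> are bounded by tracking.\<close>

lemma wdist_split:
  assumes ps: "pattern lam ps"
  shows "\<exists>B'. \<forall>x z m. gprod x z m \<le> B \<longrightarrow>
    real (wdist lam ps x m) + real (wdist lam ps m z) \<le> real (wdist lam ps x z) + B'"
proof -
  obtain C where C: "tracking lam C" using tracking_exists by blast
  have "real (wdist lam ps x m) + real (wdist lam ps m z)
      \<le> real (wdist lam ps x z) + (11 + real lam + 2 * (4 * B + C))"
    if m: "gprod x z m \<le> B" for x z m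
  proof -
    obtain as k where opt: "optimal lam ps as k x z" using optimal_exists[OF ps] by blast
    then have as: "unit_path as x z" "occ ps as k" "wdist lam ps x z + lam * k = length as"
      by (auto simp: optimal_def)
    obtain j where j: "j < length as" "dist m (as ! j) \<le> 4 * B + C"
      using trackingD(2)[OF C ps opt, of m] m by force
    define y where "y = as ! j"
    have ends: "as ! 0 = x" "as ! (length as - 1) = z"
      using as(1) by (auto simp: unit_path_def hd_conv_nth last_conv_nth)
    have pre: "unit_path (take (Suc j) as) x y"
      using unit_path_slice(1)[OF as(1), of 0 j] j ends by (simp add: y_def)
    have post: "unit_path (drop j as) y z"
      using unit_path_slice(1)[OF as(1), of j "length as - 1"] j ends by (simp add: y_def)
    obtain k1 k2 where k: "occ ps (take j as) k1" "occ ps (drop j as) k2" "k \<le> k1 + k2 + 1"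
      using occ_split[of ps "take j as" "drop j as" k] as(2) by auto
    have "occ ps (take (Suc j) as) (k1 + 0)"
      unfolding take_Suc_conv_app_nth[OF j(1)] using k(1) occ_0 by (rule occ_append)
    then have "wdist lam ps x y + lam * k1 \<le> Suc j"
      using wdist_le[OF ps pre] j by fastforce
    moreover have "wdist lam ps y z + lam * k2 \<le> length as - j"
      using wdist_le[OF ps post k(2)] by simp
    moreover have "lam * k \<le> lam * (k1 + k2 + 1)" using k(3) by (rule mult_left_mono) simp
    then have "lam * k \<le> lam * k1 + lam * k2 + lam" by (simp add: algebra_simps)
    ultimately have "wdist lam ps x y + wdist lam ps y z
        \<le> wdist lam ps x z + lam + 1"
      using as(3) j(1) by linarith
    then have "real (wdist lam ps x y) + real (wdist lam ps y z)
        \<le> real (wdist lam ps x z) + real lam + 1" by linarith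
    moreover have "real (wdist lam ps u w)
        \<le> real (wdist lam ps u v) + real (wdist lam ps v w)" for u v w
      using wdist_triangle[OF ps, of u w v] by linarith
    note this[of x m y] this[of m z y]
    moreover have "real (wdist lam ps y m) \<le> 4 * B + C + 5"
      "real (wdist lam ps m y) \<le> 4 * B + C + 5"
      using wdist_le_dist[OF ps, of y m] wdist_le_dist[OF ps, of m y] j(2)
      by (simp_all add: y_def dist_commute)
    moreover have "p + q \<le> r + (11 + e + 2 * (4 * B + C))"
      if "s + t \<le> r + e + 1" "p \<le> s + u" "q \<le> v + t" "u \<le> 4 * B + C + 5" "v \<le> 4 * B + C + 5"
      for p q r s t u v e :: real
      using that by (simp add: algebra_simps)
    ultimately show ?thesis by blast
  qed
  then show ?thesis by blast
qed

definition counting_qhom :: "nat \<Rightarrow> 'x list \<Rightarrow> 'x \<Rightarrow> 'g \<Rightarrow> real"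
  where "counting_qhom lam ps x a =
    real (wdist lam ps x (\<phi> a x)) - real (wdist lam ps (\<phi> a x) x)"

text \<open>Up to a bounded error the weights of the three sides of a triangle decompose at its centre
  \<open>m\<close>; the contributions then cancel.\<close>

lemma counting_qhom_defect:
  assumes ps: "pattern lam ps"
  shows "\<exists>D. \<forall>a\<in>carrier G. \<forall>b\<in>carrier G. \<bar>counting_qhom lam ps x (a \<otimes> b)
    - counting_qhom lam ps x a - counting_qhom lam ps x b\<bar> \<le> D"
proof -
  obtain B' where B': "\<And>x z m. gprod x z m \<le> 19 + \<delta> \<Longrightarrow> real (wdist lam ps x m)
      + real (wdist lam ps m z) \<le> real (wdist lam ps x z) + B'"
    using wdist_split[OF ps] by blast
  let ?d = "\<lambda>x y. real (wdist lam ps x y)"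
  have near: "\<bar>?d u v - ?d u m - ?d m v\<bar> \<le> B'" if "gprod u v m \<le> 19 + \<delta>" for u v m
    using B'[OF that] wdist_triangle[OF ps, of u v m] by linarith
  have "\<bar>counting_qhom lam ps x (a \<otimes> b) - counting_qhom lam ps x a - counting_qhom lam ps x b\<bar>
      \<le> 6 * B'" if ab: "a \<in> carrier G" "b \<in> carrier G" for a b
  proof -
    define y z where "y = \<phi> a x" and "z = \<phi> (a \<otimes> b) x"
    have z: "z = \<phi> a (\<phi> b x)" using ab by (simp add: z_def act_mult)
    have b: "counting_qhom lam ps x b = ?d y z - ?d z y"
      unfolding counting_qhom_def y_def z using wdist_act[OF ps ab(1)] by simp
    obtain m where m: "gprod x y m \<le> 19 + \<delta>" "gprod y z m \<le> 19 + \<delta>" "gprod x z m \<le> 19 + \<delta>"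
      using tripod_centre by blast
    show ?thesis
      unfolding b unfolding counting_qhom_def z_def[symmetric] y_def[symmetric]
      using near[of x y m] near[of y x m] near[of y z m] near[of z y m] near[of x z m]
        near[of z x m] m by (simp add: gprod_commute)
  qed
  then show ?thesis by blast
qed

end

section \<open>Independent elements\<close>

text \<open>An interval around a cut point \<open>\<mu>\<close> of \<open>[p, q]\<close> cannot overlap both halves, and neither half
  overlaps two adjacent intervals; hence \<open>\<mu>\<close> is close to some \<open>t\<close> whose two adjacent intervals
  almost cover the two halves.\<close>

lemma interval_domination:
  fixes t :: "nat \<Rightarrow> real" and p q \<mu> L :: real
  defines "ov \<equiv> \<lambda>p q k. L \<le> min q (t (Suc k)) - max p (t k)"
  assumes L: "0 < L" and steps: "\<And>k. k < T \<Longrightarrow> t k + 2 * L \<le> t (Suc k)"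
    and p: "p + 3 * L \<le> \<mu>" "\<mu> + 3 * L \<le> q" "t 0 \<le> p + L" "q \<le> t T + L"
    and N1: "\<And>k. Suc k < T \<Longrightarrow> \<not> (ov p \<mu> k \<and> ov p \<mu> (Suc k))"
    and N2: "\<And>k. Suc k < T \<Longrightarrow> \<not> (ov \<mu> q k \<and> ov \<mu> q (Suc k))"
    and N3: "\<And>k. k < T \<Longrightarrow> \<not> (ov p \<mu> k \<and> ov \<mu> q k)"
  shows "\<exists>k. Suc k < T \<and> \<mu> - p - 3 * L \<le> t (Suc k) - t k \<and>
    q - \<mu> - 3 * L \<le> t (Suc (Suc k)) - t (Suc k)"
proof -
  define k where "k = (LEAST k. \<mu> < t k)"
  have ex: "\<mu> < t T" using p L by linarith
  have k: "\<mu> < t k" "k \<le> T" unfolding k_def using ex by (rule LeastI, rule Least_le)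
  have "k \<noteq> 0" using k(1) p L by (intro notI) simp
  then obtain l where l: "k = Suc l" by (cases k) auto
  then have "\<not> \<mu> < t l" using not_less_Least[of l "\<lambda>k. \<mu> < t k"] unfolding k_def by simp
  then have tl: "t l \<le> \<mu>" "l < T" using l k by auto
  have "\<exists>\<kappa>. Suc \<kappa> < T \<and> \<bar>t (Suc \<kappa>) - \<mu>\<bar> < L"
  proof (cases "t (Suc l) - \<mu> < L")
    case True
    then have "Suc l \<noteq> T" using p L by (intro notI) auto
    then show ?thesis using True k l by (intro exI[of _ l]) auto
  next
    case False
    then have "\<mu> - t l < L" using N3[OF tl(2)] tl p L unfolding ov_def by (auto simp: min_def max_def split: if_splits)
    moreover from this have "l \<noteq> 0" using p L by (intro notI) auto
    ultimately show ?thesis using tl by (intro exI[of _ "l - 1"]) auto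
  qed
  then obtain \<kappa> where \<kappa>: "Suc \<kappa> < T" "\<bar>t (Suc \<kappa>) - \<mu>\<bar> < L" by blast
  have s1: "t \<kappa> + 2 * L \<le> t (Suc \<kappa>)" and s2: "t (Suc \<kappa>) + 2 * L \<le> t (Suc (Suc \<kappa>))"
    using steps \<kappa> by auto
  have ov1: "ov p \<mu> \<kappa>" unfolding ov_def using s1 \<kappa>(2) p L by (auto simp: min_def max_def abs_less_iff)
  have ov2: "ov \<mu> q (Suc \<kappa>)" unfolding ov_def using s2 \<kappa>(2) p L
    by (auto simp: min_def max_def abs_less_iff)
  have "t \<kappa> \<le> p + L"
  proof (cases \<kappa>)
    case 0
    then show ?thesis using p by simp
  next
    case (Suc m)
    then have "\<not> ov p \<mu> m" using N1[of m] ov1 \<kappa> by auto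
    moreover have "t m + 2 * L \<le> t \<kappa>" using steps[of m] Suc \<kappa> by auto
    ultimately show ?thesis using Suc s1 \<kappa>(2) p L unfolding ov_def
      by (auto simp: min_def max_def abs_less_iff split: if_splits)
  qed
  moreover have "q - L \<le> t (Suc (Suc \<kappa>))"
  proof (cases "Suc (Suc \<kappa>) < T")
    case False
    then have "T = Suc (Suc \<kappa>)" using \<kappa> by simp
    then show ?thesis using p by simp
  next
    case True
    then have "\<not> ov \<mu> q (Suc (Suc \<kappa>))" using N2[of "Suc \<kappa>"] ov2 by auto
    moreover have "t (Suc (Suc \<kappa>)) + 2 * L \<le> t (Suc (Suc (Suc \<kappa>)))" using steps True by auto
    ultimately show ?thesis using s2 \<kappa>(2) p L unfolding ov_def
      by (auto simp: min_def max_def abs_less_iff split: if_splits)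
  qed
  ultimately show ?thesis using \<kappa> by (intro exI[of _ \<kappa>]) (auto simp: abs_less_iff)
qed

section \<open>Words in \<open>g\<close> and \<open>h\<close> as broken geodesics\<close>

locale nonelementary_axis = hyperbolic_axis T \<delta> G \<phi> g x0 K C
  for T :: "'x::metric_space itself" and \<delta> :: real and G (structure)
    and \<phi> :: "'g \<Rightarrow> 'x \<Rightarrow> 'x" and g :: 'g and x0 :: 'x and K C :: real +
  fixes h :: 'g and C1 :: real
  assumes h_in: "h \<in> carrier G" and h_nonelementary: "h \<notin> elementary" and C1_nonneg: "0 \<le> C1"
    and corner: "gprod (pt i) (\<phi> h (pt j)) x0 \<le> C1"
    and corner_inv: "gprod (pt i) (\<phi> (inv h) (pt j)) x0 \<le> C1"
begin

lemma mult_inv_cancel: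
  "a \<in> carrier G \<Longrightarrow> b \<in> carrier G \<Longrightarrow> a \<otimes> (inv a \<otimes> b) = b"
  "a \<in> carrier G \<Longrightarrow> b \<in> carrier G \<Longrightarrow> inv a \<otimes> (a \<otimes> b) = b"
  by (simp_all add: m_assoc[symmetric])

definition H :: real where "H = dist x0 (\<phi> h x0)"

definition len :: "int \<Rightarrow> real" where "len i = dist x0 (pt i)"

text \<open>The exponents of one period add up to 0 and \<open>eta\<close> alternates between \<open>h\<close> and its inverse, so
  that every homomorphism to the reals vanishes on \<open>word n 4\<close>. The longest syllable is preceded
  by one of length about \<open>2 * n\<close> and followed by one of length about \<open>n\<close>; this is what
  distinguishes \<open>word n 4\<close> from its inverse.\<close>

definition expo :: "int \<Rightarrow> nat \<Rightarrow> int"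
  where "expo n k = (if k mod 4 = 3 then - 4 * n else if k mod 4 = 2 then 2 * n else n)"

definition eta :: "nat \<Rightarrow> 'g" where "eta k = (if even k then h else inv h)"

primrec word :: "int \<Rightarrow> nat \<Rightarrow> 'g"
  where
    "word n 0 = \<one>"
  | "word n (Suc k) = word n k \<otimes> (g [^] expo n k \<otimes> eta k)"

definition vert :: "int \<Rightarrow> nat \<Rightarrow> 'x" where "vert n k = \<phi> (word n k) x0"

lemma H_nonneg: "0 \<le> H" by (simp add: H_def)

lemma len_minus [simp]: "len (- i) = len i" by (simp add: len_def dist_pt_minus)

lemma eta_in [simp]: "eta k \<in> carrier G" using h_in by (simp add: eta_def)

lemma word_in [simp]: "word n k \<in> carrier G" using g_in by (induction k) auto

lemma dist_eta: "dist x0 (\<phi> (eta k) x0) = H"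
  using act_dist_inv[OF h_in, of x0 x0] by (simp add: eta_def H_def dist_commute)

lemma eta_nonelementary: "eta k \<notin> elementary"
  using h_nonelementary elementary_inv[of "inv h"] h_in by (auto simp: eta_def)

lemma corner_eta: "gprod (pt i) (\<phi> (inv (eta k)) (pt j)) x0 \<le> C1"
  using corner corner_inv h_in by (simp add: eta_def)

lemma vert_0 [simp]: "vert n 0 = x0" by (simp add: vert_def act_one)

lemma vert_Suc: "vert n (Suc k) = \<phi> (word n k) (\<phi> (g [^] expo n k) (\<phi> (eta k) x0))"
  using g_in by (simp add: vert_def act_mult)

lemma dist_axis_vert: "dist (\<phi> (word n k) (pt (expo n k))) (vert n (Suc k)) = H"
proof -
  have "dist (\<phi> (word n k) (pt (expo n k))) (vert n (Suc k))
      = dist (\<phi> (g [^] expo n k) x0) (\<phi> (g [^] expo n k) (\<phi> (eta k) x0))"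
    unfolding vert_Suc pt_def by (rule act_dist) simp
  also have "\<dots> = H" using act_dist g_in dist_eta by simp
  finally show ?thesis .
qed

lemma edge_length: "\<bar>dist (vert n k) (vert n (Suc k)) - len (expo n k)\<bar> \<le> H"
proof -
  have "dist (vert n k) (\<phi> (word n k) (pt (expo n k))) = len (expo n k)"
    unfolding vert_def len_def by (rule act_dist) simp
  then show ?thesis
    using dist_axis_vert[of n k] dist_triangle[of "vert n k" "vert n (Suc k)" "\<phi> (word n k) (pt (expo n k))"]
      dist_triangle[of "vert n k" "\<phi> (word n k) (pt (expo n k))" "vert n (Suc k)"]
    by (simp add: dist_commute abs_if)
qed

text \<open>Translating the corner to \<open>x0\<close> turns its neighbours into an axis point
  moved by \<open>inv (eta k)\<close> and, up to \<open>H\<close>, a point of the axis itself. This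
  is the situation of \<open>corner_eta\<close>.\<close>

lemma vert_corner: "gprod (vert n k) (vert n (Suc (Suc k))) (vert n (Suc k)) \<le> C1 + H"
proof -
  define u where "u = word n (Suc k)"
  have u: "u \<in> carrier G" unfolding u_def by (rule word_in)
  define y where "y = \<phi> (g [^] expo n (Suc k)) (\<phi> (eta (Suc k)) x0)"
  have "u \<otimes> (inv (eta k) \<otimes> g [^] (- expo n k)) = word n k"
  proof -
    show ?thesis
      unfolding u_def word.simps using g_in by (simp add: m_assoc mult_inv_cancel g_pow_simps)
  qed
  then have "vert n k = \<phi> u (\<phi> (inv (eta k)) (pt (- expo n k)))"
    using u g_in by (simp add: vert_def pt_def act_mult[symmetric])
  moreover have "vert n (Suc (Suc k)) = \<phi> u y" unfolding y_def u_def by (rule vert_Suc)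
  moreover have "vert n (Suc k) = \<phi> u x0" by (simp add: u_def vert_def)
  ultimately have "gprod (vert n k) (vert n (Suc (Suc k))) (vert n (Suc k))
      = gprod (\<phi> (inv (eta k)) (pt (- expo n k))) y x0"
    using act_gprod[OF u] by simp
  also have "\<dots> \<le> gprod (\<phi> (inv (eta k)) (pt (- expo n k))) (pt (expo n (Suc k))) x0 + H"
  proof -
    have "dist y (pt (expo n (Suc k))) = H"
      unfolding y_def pt_def using act_dist[of "g [^] expo n (Suc k)"] g_in dist_eta[of "Suc k"]
      by (simp add: dist_commute)
    then show ?thesis
      using gprod_perturb(2)[of "\<phi> (inv (eta k)) (pt (- expo n k))" y x0 "pt (expo n (Suc k))"]
      by linarith
  qed
  also have "\<dots> \<le> C1 + H"
    using corner_eta[of "expo n (Suc k)" k "- expo n k"] by (simp add: gprod_commute)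
  finally show ?thesis .
qed

definition C3 :: real where "C3 = C1 + H + 2 * \<delta>"

text \<open>Up to sign, \<open>n\<close>, \<open>2 * n\<close> and \<open>4 * n\<close> are the only
  values of \<open>expo n\<close>, so one threshold controls all syllables.\<close>

definition long :: "int \<Rightarrow> real \<Rightarrow> bool"
  where "long n l \<longleftrightarrow> l \<le> len n \<and> l \<le> len (2 * n) \<and> l \<le> len (4 * n)"

lemma long_expo: "long n l \<Longrightarrow> l \<le> len (expo n k)"
  using len_minus[of "4 * n"] by (auto simp: long_def expo_def)

lemma C3_nonneg: "0 \<le> C3" "C1 + H \<le> C3"
  using C1_nonneg H_nonneg delta_ge_1 by (auto simp: C3_def)

lemma vert_long:
  assumes "long n l" "3 * H + 2 * C1 + 3 * \<delta> < l"
  shows "2 * (C1 + H) + 3 * \<delta> < dist (vert n k) (vert n (Suc k))"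
  using edge_length[of n k] long_expo[OF assms(1), of k] assms(2) by (simp add: abs_le_iff)

lemma vert_gprod:
  assumes "long n l" "3 * H + 2 * C1 + 3 * \<delta> < l" "i \<le> k" "k \<le> j"
  shows "gprod (vert n i) (vert n j) (vert n k) \<le> C3"
proof -
  have "gprod (vert n i) (vert n j) (vert n k) \<le> C1 + H + 2 * \<delta>"
    using C1_nonneg H_nonneg assms
    by (intro broken_geodesic[where b = "vert n" and n = j, OF vert_corner vert_long[OF assms(1,2)]]) auto
  then show ?thesis by (simp add: C3_def)
qed

lemma vert_length:
  assumes "long n l" "3 * H + 2 * C1 + 3 * \<delta> < l"
  shows "(\<Sum>k<j. dist (vert n k) (vert n (Suc k)) - 2 * C3) \<le> dist x0 (vert n j)"
  using broken_geodesic_length[where b = "vert n" and n = j and j = j,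
      OF vert_corner vert_long[OF assms]] C1_nonneg H_nonneg by (simp add: C3_def)

text \<open>Membership of \<open>inv a \<otimes> b\<close> in \<open>elementary\<close> says that
  \<open>a\<close> and \<open>b\<close> lie in the same left coset, an equivalence relation by
  closure under products and inverses.\<close>

lemma elementary_div:
  assumes "a \<in> carrier G" "b \<in> carrier G" "c \<in> carrier G"
  shows "inv a \<otimes> b \<in> elementary \<Longrightarrow> inv a \<otimes> c \<in> elementary \<Longrightarrow> inv b \<otimes> c \<in> elementary"
    and "inv a \<otimes> c \<in> elementary \<Longrightarrow> inv b \<otimes> c \<in> elementary \<Longrightarrow> inv a \<otimes> b \<in> elementary"
proof -
  assume "inv a \<otimes> b \<in> elementary" "inv a \<otimes> c \<in> elementary"
  then have "inv (inv a \<otimes> b) \<otimes> (inv a \<otimes> c) \<in> elementary"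
    using elementary_mult[OF elementary_inv] by blast
  then show "inv b \<otimes> c \<in> elementary"
    using assms by (simp add: inv_mult_group m_assoc mult_inv_cancel)
next
  assume "inv a \<otimes> c \<in> elementary" "inv b \<otimes> c \<in> elementary"
  then have "(inv a \<otimes> c) \<otimes> inv (inv b \<otimes> c) \<in> elementary"
    using elementary_mult[OF _ elementary_inv] by blast
  then show "inv a \<otimes> b \<in> elementary"
    using assms by (simp add: inv_mult_group m_assoc mult_inv_cancel)
qed

lemma word_Suc_nonelementary: "inv (word n k) \<otimes> word n (Suc k) \<notin> elementary"
proof
  assume "inv (word n k) \<otimes> word n (Suc k) \<in> elementary"
  moreover have "inv (word n k) \<otimes> word n (Suc k) = g [^] expo n k \<otimes> eta k"
    using g_in by (simp add: m_assoc[symmetric])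
  ultimately have "g [^] (- expo n k) \<otimes> (g [^] expo n k \<otimes> eta k) \<in> elementary"
    using elementary_mult[OF g_pow_elementary] by simp
  then show False using eta_nonelementary g_in by (simp add: g_pow_simps)
qed

text \<open>The two segments will be the two long syllables of a copy of the pattern, in either
  order. What matters is that they are matched by consecutive syllables \<open>k\<close> and
  \<open>Suc k\<close> in the same order, since this later separates a word from its
  inverse.\<close>

definition domination_bound :: "real \<Rightarrow> real \<Rightarrow> bool"
  where "domination_bound B L \<longleftrightarrow> (\<forall>n T a1 a2 i1 j1 i2 j2. long n (2 * L + 2 * C3 + H) \<longrightarrow>
    a1 \<in> carrier G \<longrightarrow> a2 \<in> carrier G \<longrightarrow> inv a1 \<otimes> a2 \<notin> elementary \<longrightarrow>
    gprod x0 (vert n T) (\<phi> a1 (pt i1)) \<le> B \<longrightarrow> gprod x0 (vert n T) (\<phi> a1 (pt j1)) \<le> B \<longrightarrow>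
    gprod x0 (vert n T) (\<phi> a2 (pt i2)) \<le> B \<longrightarrow> gprod x0 (vert n T) (\<phi> a2 (pt j2)) \<le> B \<longrightarrow>
    dist (\<phi> a1 (pt j1)) (\<phi> a2 (pt i2)) \<le> H \<longrightarrow>
    dist x0 (\<phi> a1 (pt i1)) + 3 * L \<le> dist x0 (\<phi> a1 (pt j1)) \<longrightarrow>
    dist x0 (\<phi> a1 (pt j1)) + 3 * L \<le> dist x0 (\<phi> a2 (pt j2)) \<longrightarrow>
    (\<exists>k. dist x0 (\<phi> a1 (pt j1)) - dist x0 (\<phi> a1 (pt i1)) - 3 * L \<le> len (expo n k) + H \<and>
      dist x0 (\<phi> a2 (pt j2)) - dist x0 (\<phi> a1 (pt j1)) - 3 * L \<le> len (expo n (Suc k)) + H))"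

text \<open>Record the syllables of the word and the two segments as intervals of distances from
  \<open>x0\<close>. A long overlap puts a segment and a syllable into one coset, whereas
  neighbouring syllables, and the two segments, belong to different cosets. These are the exclusions
  required by \<open>interval_domination\<close>, with the junction of the segments as cut point
  \<open>\<mu>\<close>.\<close>

lemma occurrence_domination: "\<exists>L>0. domination_bound B L"
proof -
  define B1 where "B1 = max B (C3 + H)"
  have B1: "B \<le> B1" "C3 + H \<le> B1" "C3 \<le> B1" using H_nonneg by (auto simp: B1_def)
  obtain L0 where L0: "0 < L0" "overlap_bound B1 L0" using overlap_along_geodesic by blast
  \<comment> \<open>Replacing ends of syllables by vertices, and the start of the second segment by
    \<open>\<mu>\<close>, costs at most \<open>2 * H\<close> of overlap. The other terms make the
    corner estimates applicable and let \<open>q\<close> overshoot the last vertex by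
    \<open>2 * B\<close>.\<close>
  define L where "L = L0 + 3 * H + 2 * \<bar>B\<bar> + 2 * C1 + 3 * \<delta>"
  have L: "0 < L" "L0 + 2 * H \<le> L" "2 * B \<le> L" "3 * H + 2 * C1 + 3 * \<delta> < L"
    using L0(1) H_nonneg C1_nonneg delta_ge_1 unfolding L_def by auto
  have "\<exists>k. dist x0 (\<phi> a1 (pt j1)) - dist x0 (\<phi> a1 (pt i1)) - 3 * L \<le> len (expo n k) + H \<and>
      dist x0 (\<phi> a2 (pt j2)) - dist x0 (\<phi> a1 (pt j1)) - 3 * L \<le> len (expo n (Suc k)) + H"
    if lng: "long n (2 * L + 2 * C3 + H)"
      and a: "a1 \<in> carrier G" "a2 \<in> carrier G" "inv a1 \<otimes> a2 \<notin> elementary"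
      and gp: "gprod x0 (vert n T) (\<phi> a1 (pt i1)) \<le> B" "gprod x0 (vert n T) (\<phi> a1 (pt j1)) \<le> B"
        "gprod x0 (vert n T) (\<phi> a2 (pt i2)) \<le> B" "gprod x0 (vert n T) (\<phi> a2 (pt j2)) \<le> B"
      and mid: "dist (\<phi> a1 (pt j1)) (\<phi> a2 (pt i2)) \<le> H"
      and far: "dist x0 (\<phi> a1 (pt i1)) + 3 * L \<le> dist x0 (\<phi> a1 (pt j1))"
        "dist x0 (\<phi> a1 (pt j1)) + 3 * L \<le> dist x0 (\<phi> a2 (pt j2))"
    for n T a1 a2 i1 j1 i2 j2
  proof -
    define t where "t k = dist x0 (vert n k)" for k
    define p \<mu> q where "p = dist x0 (\<phi> a1 (pt i1))" and "\<mu> = dist x0 (\<phi> a1 (pt j1))"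
      and "q = dist x0 (\<phi> a2 (pt j2))"
    have big: "3 * H + 2 * C1 + 3 * \<delta> < 2 * L + 2 * C3 + H"
      using L C3_nonneg H_nonneg by linarith
    have t_step: "t k + dist (vert n k) (vert n (Suc k)) - 2 * C3 \<le> t (Suc k)" for k
      using vert_gprod[OF lng big, of 0 k "Suc k"]
      by (simp add: gprod_def t_def dist_commute field_simps)
    have t_up: "t (Suc k) - t k \<le> len (expo n k) + H" for k
      using edge_length[of n k] dist_triangle[of x0 "vert n (Suc k)" "vert n k"]
      unfolding t_def by linarith
    define W where "W k = \<phi> (word n k) (pt (expo n k))" for k
    have W: "\<bar>dist x0 (W k) - t (Suc k)\<bar> \<le> H" for k
      using dist_axis_vert[of n k] dist_triangle[of x0 "W k" "vert n (Suc k)"]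
        dist_triangle[of x0 "vert n (Suc k)" "W k"] unfolding t_def W_def
      by (simp add: dist_commute abs_le_iff)
    have Wgp: "gprod x0 (vert n T) (W k) \<le> B1" if "k < T" for k
      using gprod_perturb(3)[of x0 "vert n T" "W k" "vert n (Suc k)"] dist_axis_vert[of n k]
        vert_gprod[OF lng big, of 0 "Suc k" T] that B1 unfolding W_def by simp
    have vgp: "gprod x0 (vert n T) (vert n k) \<le> B1" if "k < T" for k
      using vert_gprod[OF lng big, of 0 k T] that B1 by simp
    have mid': "\<bar>dist x0 (\<phi> a2 (pt i2)) - \<mu>\<bar> \<le> H"
      using mid dist_triangle[of x0 "\<phi> a1 (pt j1)" "\<phi> a2 (pt i2)"]
        dist_triangle[of x0 "\<phi> a2 (pt i2)" "\<phi> a1 (pt j1)"]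
      unfolding \<mu>_def by (simp add: dist_commute abs_le_iff)
    have E1: "inv a1 \<otimes> word n k \<in> elementary"
      if k: "k < T" and ov: "L \<le> min \<mu> (t (Suc k)) - max p (t k)" for k
    proof -
      have "L0 \<le> min (dist x0 (\<phi> a1 (pt j1))) (dist x0 (W k))
          - max (dist x0 (\<phi> a1 (pt i1))) (dist x0 (\<phi> (word n k) (pt 0)))"
        using ov W[of k] L H_nonneg unfolding p_def \<mu>_def t_def vert_def by (auto simp: abs_le_iff)
      then show ?thesis
        using L0(2)[unfolded overlap_bound_def, rule_format, of a1 "word n k" x0 "vert n T" i1 j1 0 "expo n k"]
          a(1) gp(1,2) B1(1) vgp[OF k] Wgp[OF k] unfolding W_def vert_def by simp
    qed
    have E2: "inv a2 \<otimes> word n k \<in> elementary"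
      if k: "k < T" and ov: "L \<le> min q (t (Suc k)) - max \<mu> (t k)" for k
    proof -
      have "L0 \<le> min (dist x0 (\<phi> a2 (pt j2))) (dist x0 (W k))
          - max (dist x0 (\<phi> a2 (pt i2))) (dist x0 (\<phi> (word n k) (pt 0)))"
        using ov W[of k] mid' L H_nonneg unfolding q_def t_def vert_def by (auto simp: abs_le_iff)
      then show ?thesis
        using L0(2)[unfolded overlap_bound_def, rule_format, of a2 "word n k" x0 "vert n T" i2 j2 0 "expo n k"]
          a(2) gp(3,4) B1(1) vgp[OF k] Wgp[OF k] unfolding W_def vert_def by simp
    qed
    have "\<exists>k. Suc k < T \<and> \<mu> - p - 3 * L \<le> t (Suc k) - t k \<and>
      q - \<mu> - 3 * L \<le> t (Suc (Suc k)) - t (Suc k)"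
    proof (rule interval_domination[OF L(1)])
      show "t k + 2 * L \<le> t (Suc k)" for k
        using t_step[of k] edge_length[of n k] long_expo[OF lng, of k] by (simp add: abs_le_iff)
      show "p + 3 * L \<le> \<mu>" "\<mu> + 3 * L \<le> q" using far by (simp_all add: p_def \<mu>_def q_def)
      show "t 0 \<le> p + L" using L by (simp add: t_def p_def add_nonneg_nonneg)
      have "dist x0 (\<phi> a2 (pt j2)) + dist (vert n T) (\<phi> a2 (pt j2))
          \<le> 2 * B + dist x0 (vert n T)"
        using gp(4) by (simp add: gprod_def field_simps)
      then show "q \<le> t T + L"
        using L(3) zero_le_dist[of "vert n T" "\<phi> a2 (pt j2)"] unfolding q_def t_def by linarith
      show "\<not> (L \<le> min \<mu> (t (Suc k)) - max p (t k) \<and>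
          L \<le> min \<mu> (t (Suc (Suc k))) - max p (t (Suc k)))" if "Suc k < T" for k
        using E1[of k] E1[of "Suc k"] that a word_Suc_nonelementary[of n k]
          elementary_div(1)[of a1 "word n k" "word n (Suc k)"] by (meson Suc_lessD word_in)
      show "\<not> (L \<le> min q (t (Suc k)) - max \<mu> (t k) \<and>
          L \<le> min q (t (Suc (Suc k))) - max \<mu> (t (Suc k)))" if "Suc k < T" for k
        using E2[of k] E2[of "Suc k"] that a word_Suc_nonelementary[of n k]
          elementary_div(1)[of a2 "word n k" "word n (Suc k)"] by (meson Suc_lessD word_in)
      show "\<not> (L \<le> min \<mu> (t (Suc k)) - max p (t k) \<and> L \<le> min q (t (Suc k)) - max \<mu> (t k))"
        if "k < T" for k
        using E1[OF that] E2[OF that] a elementary_div(2)[of a1 a2 "word n k"] by (meson word_in)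
    qed
    then obtain k where "\<mu> - p - 3 * L \<le> t (Suc k) - t k"
      "q - \<mu> - 3 * L \<le> t (Suc (Suc k)) - t (Suc k)" by blast
    then show ?thesis using t_up[of k] t_up[of "Suc k"] unfolding p_def \<mu>_def q_def
      by (intro exI[of _ k]) auto
  qed
  then show ?thesis using L(1) unfolding domination_bound_def by blast
qed

end

lemma sum_lessThan_4: "(\<Sum>k<4::nat. f k) = f 0 + f 1 + f 2 + (f 3 :: real)"
  by (simp add: eval_nat_numeral)

lemma two_segments:
  fixes x P M R :: "'x::metric_space"
  assumes "gprod x R P \<le> c" "gprod P R M \<le> c'"
  shows "dist x P + dist P M - 2 * c - 2 * c' \<le> dist x M"
    and "dist x M + dist M R - 2 * c - 2 * c' \<le> dist x R"
proof -
  have 1: "dist x P + dist R P \<le> dist x R + 2 * c" "dist P M + dist R M \<le> dist P R + 2 * c'"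
    using assms by (auto simp: gprod_def field_simps)
  show "dist x P + dist P M - 2 * c - 2 * c' \<le> dist x M"
    using 1 dist_triangle[of x R M] dist_commute[of P R] dist_commute[of M R] by linarith
  show "dist x M + dist M R - 2 * c - 2 * c' \<le> dist x R"
    using 1 dist_triangle[of x M P] dist_commute[of P R] dist_commute[of M R] by linarith
qed

section \<open>Copies of the pattern in powers of the words\<close>

context nonelementary_axis
begin

text \<open>The path of the pattern starts at \<open>x0\<close> and ends here; \<open>mid\<close> is
  the base point of its second syllable, reached after the letter \<open>h\<close>.\<close>

definition tip :: "int \<Rightarrow> 'x" where "tip n = \<phi> (g [^] (2 * n) \<otimes> h) (pt (- 4 * n))"

definition mid :: "int \<Rightarrow> 'x" where "mid n = \<phi> (g [^] (2 * n) \<otimes> h) x0"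

lemma dist_pt_mid: "dist (pt (2 * n)) (mid n) = H"
proof -
  have "dist (pt (2 * n)) (mid n) = dist (\<phi> (g [^] (2 * n)) x0) (\<phi> (g [^] (2 * n)) (\<phi> h x0))"
    using g_in h_in by (simp add: mid_def pt_def act_mult)
  then show ?thesis using act_dist g_in by (simp add: H_def)
qed

lemma dist_mid_tip: "dist (mid n) (tip n) = len (4 * n)"
  using act_dist[of "g [^] (2 * n) \<otimes> h" x0 "pt (- 4 * n)"] g_in h_in dist_pt_minus[of "4 * n"]
  by (simp add: mid_def tip_def len_def)

lemma gprod_tip_mid: "gprod x0 (tip n) (mid n) \<le> C1"
proof -
  define u where "u = g [^] (2 * n) \<otimes> h"
  have u: "u \<in> carrier G" using g_in h_in by (simp add: u_def)
  have "u \<otimes> (inv h \<otimes> g [^] (- (2 * n))) = \<one>"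
    unfolding u_def using g_in h_in by (simp add: m_assoc mult_inv_cancel g_pow_simps)
  then have "\<phi> u (\<phi> (inv h) (pt (- (2 * n)))) = x0"
    using u g_in h_in act_one by (simp add: pt_def act_mult[symmetric])
  then have "gprod x0 (tip n) (mid n) = gprod (\<phi> (inv h) (pt (- (2 * n)))) (pt (- 4 * n)) x0"
    using act_gprod[OF u, of "\<phi> (inv h) (pt (- (2 * n)))" "pt (- 4 * n)" x0]
    unfolding tip_def mid_def u_def[symmetric] by simp
  then show ?thesis using corner_inv by (simp add: gprod_commute)
qed

lemma gprod_tip_pt: "gprod x0 (tip n) (pt (2 * n)) \<le> C1 + H"
  using gprod_tip_mid[of n] gprod_perturb(3)[of x0 "tip n" "pt (2 * n)" "mid n"] dist_pt_mid[of n]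
  by linarith

definition dominated :: "real \<Rightarrow> int \<Rightarrow> int \<Rightarrow> int \<Rightarrow> bool"
  where "dominated W m i j \<longleftrightarrow>
    (\<exists>k. len i \<le> len (expo m k) + W \<and> len j \<le> len (expo m (Suc k)) + W)"

text \<open>\<open>W\<close> is fixed before \<open>n\<close>, \<open>m\<close>, \<open>T\<close>
  and the pattern. In the second half the path runs from \<open>vert m T\<close> to
  \<open>x0\<close>; seen from \<open>x0\<close> a copy is then read backwards, with the syllable of
  exponent \<open>- 4 * n\<close> coming first.\<close>

definition occurrence_bound :: "nat \<Rightarrow> real \<Rightarrow> bool"
  where "occurrence_bound lam W \<longleftrightarrow> (\<forall>n m T ps. long m W \<longrightarrow> long n W \<longrightarrow> pattern lam ps \<longrightarrow> hd ps = x0 \<longrightarrow>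
    last ps = tip n \<longrightarrow>
    (dist x0 (vert m T) \<le> real (wdist lam ps x0 (vert m T)) \<or>
      dominated W m (2 * n) (4 * n)) \<and>
    (dist x0 (vert m T) \<le> real (wdist lam ps (vert m T) x0) \<or>
      dominated W m (4 * n) (2 * n)))"

text \<open>If the weighted distance beats the distance, \<open>pattern_occurrence\<close> yields a
  copy along the geodesic. Its two syllables lie on the translates of the axis by \<open>a\<close>
  and \<open>a \<otimes> u\<close>, in different cosets because \<open>u\<close> is not elementary,
  so \<open>occurrence_domination\<close> matches them with consecutive syllables of the
  word.\<close>

lemma no_occurrence: "\<exists>W\<ge>0. occurrence_bound lam W"
proof -
  obtain Cm where Cm: "0 \<le> Cm" "\<forall>ps x z. pattern lam ps \<longrightarrow>
    dist x z \<le> real (wdist lam ps x z) \<or>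
    (\<exists>a\<in>carrier G. gprod x z (\<phi> a (hd ps)) \<le> Cm \<and> gprod x z (\<phi> a (last ps)) \<le> Cm \<and>
      gprod x (\<phi> a (last ps)) (\<phi> a (hd ps)) \<le> Cm \<and> gprod (\<phi> a (hd ps)) z (\<phi> a (last ps)) \<le> Cm)"
    using pattern_occurrence[of lam] by blast
  define B where "B = C1 + H + 2 * Cm + \<delta>"
  obtain L where L: "0 < L" "domination_bound B L" using occurrence_domination by blast
  \<comment> \<open>What a syllable of the copy may lose against \<open>len\<close> when measured by
    distances from \<open>x0\<close>: the errors of two products, and \<open>H\<close> for the
    letter between the syllables.\<close>
  define V where "V = 2 * Cm + 2 * (C1 + H) + H"
  define W where "W = 5 * L + 2 * C3 + 2 * H + V"
  have V0: "0 \<le> V" using Cm(1) C1_nonneg H_nonneg by (simp add: V_def)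
  have W: "0 \<le> W" "2 * L + 2 * C3 + H \<le> W" "3 * L + V \<le> W" "3 * L + V + H \<le> W"
    using L(1) C3_nonneg H_nonneg V0 unfolding W_def by linarith+
  have B_ge: "Cm \<le> B" "C1 + 2 * Cm + \<delta> \<le> B" "C1 + H + 2 * Cm + \<delta> \<le> B"
    using Cm(1) C1_nonneg H_nonneg delta_ge_1 by (auto simp: B_def)
  have main: "(dist x0 (vert m T) \<le> real (wdist lam ps x0 (vert m T)) \<or>
      dominated W m (2 * n) (4 * n)) \<and>
    (dist x0 (vert m T) \<le> real (wdist lam ps (vert m T) x0) \<or>
      dominated W m (4 * n) (2 * n))"
    if lng: "long m W" "long n W" and ps: "pattern lam ps" "hd ps = x0" "last ps = tip n"
    for n m T ps
  proof -
    define z where "z = vert m T"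
    have lngm: "long m (2 * L + 2 * C3 + H)" using lng(1) W(2) unfolding long_def by linarith
    have lens: "3 * L + V \<le> len (2 * n)" "3 * L + V \<le> len (4 * n)"
      using lng(2) W(3) unfolding long_def by linarith+
    define u where "u = g [^] (2 * n) \<otimes> h"
    have u: "u \<in> carrier G" "u \<notin> elementary"
    proof -
      show "u \<in> carrier G" using g_in h_in by (simp add: u_def)
      show "u \<notin> elementary"
      proof
        assume "u \<in> elementary"
        then have "g [^] (- (2 * n)) \<otimes> u \<in> elementary" by (rule elementary_mult[OF g_pow_elementary])
        then show False using h_nonelementary h_in g_in by (simp add: u_def g_pow_simps)
      qed
    qed
    have common: "gprod x0 z (\<phi> a (pt (2 * n))) \<le> B \<and> gprod x0 z (\<phi> a (mid n)) \<le> B \<and>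
        gprod (\<phi> a x0) (\<phi> a (tip n)) (\<phi> a (pt (2 * n))) \<le> C1 + H \<and>
        gprod (\<phi> a (tip n)) (\<phi> a x0) (\<phi> a (mid n)) \<le> C1 \<and>
        dist (\<phi> a x0) (\<phi> a (pt (2 * n))) = len (2 * n) \<and>
        dist (\<phi> a (pt (2 * n))) (\<phi> a (mid n)) = H \<and>
        dist (\<phi> a (mid n)) (\<phi> a (tip n)) = len (4 * n) \<and>
        a \<otimes> u \<in> carrier G \<and> inv a \<otimes> (a \<otimes> u) = u \<and> \<phi> (a \<otimes> u) (pt (- 4 * n)) = \<phi> a (tip n) \<and>
        \<phi> (a \<otimes> u) (pt 0) = \<phi> a (mid n)"
      if a: "a \<in> carrier G" and gp: "gprod x0 z (\<phi> a x0) \<le> Cm" "gprod x0 z (\<phi> a (tip n)) \<le> Cm"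
      for a
    proof -
      have c: "gprod (\<phi> a x0) (\<phi> a (tip n)) (\<phi> a (pt (2 * n))) \<le> C1 + H"
        "gprod (\<phi> a x0) (\<phi> a (tip n)) (\<phi> a (mid n)) \<le> C1"
        using gprod_tip_pt gprod_tip_mid act_gprod[OF a] by simp_all
      then have "gprod x0 z (\<phi> a (pt (2 * n))) \<le> B" "gprod x0 z (\<phi> a (mid n)) \<le> B"
        using gprod_between[OF gp] B_ge by fastforce+
      then show ?thesis using c a u act_dist[OF a] dist_pt_mid dist_mid_tip
        by (simp add: len_def mult_inv_cancel act_mult tip_def mid_def u_def gprod_commute)
    qed
    have "dist x0 z \<le> real (wdist lam ps x0 z) \<or>
      dominated W m (2 * n) (4 * n)"
    proof (rule disj_commute[THEN iffD1, OF disjCI])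
      assume "\<not> dist x0 z \<le> real (wdist lam ps x0 z)"
      then obtain a where a: "a \<in> carrier G" and gp: "gprod x0 z (\<phi> a x0) \<le> Cm"
        "gprod x0 z (\<phi> a (tip n)) \<le> Cm" "gprod x0 (\<phi> a (tip n)) (\<phi> a x0) \<le> Cm"
        using Cm(2)[rule_format, OF ps(1), of x0 z] unfolding ps(2,3) by blast
      note s = common[OF a gp(1,2)]
      then have au: "\<phi> (a \<otimes> u) (pt (- 4 * n)) = \<phi> a (tip n)" "\<phi> (a \<otimes> u) x0 = \<phi> a (mid n)"
        and corner_pt: "gprod (\<phi> a x0) (\<phi> a (tip n)) (\<phi> a (pt (2 * n))) \<le> C1 + H"
        by auto
      have far: "dist x0 (\<phi> a x0) + (len (2 * n) - V) \<le> dist x0 (\<phi> a (pt (2 * n)))"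
        "dist x0 (\<phi> a (pt (2 * n))) + (len (4 * n) - V) \<le> dist x0 (\<phi> a (tip n))"
        using two_segments[OF gp(3) corner_pt] s H_nonneg
          dist_triangle[of "\<phi> a (mid n)" "\<phi> a (tip n)" "\<phi> a (pt (2 * n))"]
        unfolding V_def by (simp_all add: dist_commute)
      \<comment> \<open>The first segment is the translate by \<open>a\<close> from
        \<open>pt 0\<close> to \<open>pt (2 * n)\<close>, the second the translate by
        \<open>a \<otimes> u\<close> from \<open>pt 0\<close> to \<open>pt (- 4 * n)\<close>; the
        letter \<open>h\<close> joins them.\<close>
      have "\<exists>k. dist x0 (\<phi> a (pt (2 * n))) - dist x0 (\<phi> a (pt 0)) - 3 * L \<le> len (expo m k) + H \<and>
        dist x0 (\<phi> (a \<otimes> u) (pt (- 4 * n))) - dist x0 (\<phi> a (pt (2 * n))) - 3 * L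
          \<le> len (expo m (Suc k)) + H"
        by (rule L(2)[unfolded domination_bound_def, rule_format, where T = T and ?i2.0 = 0])
          (use lngm a u(2) gp s B_ge far lens in \<open>auto simp: z_def\<close>)
      then obtain k where "dist x0 (\<phi> a (pt (2 * n))) - dist x0 (\<phi> a x0) - 3 * L \<le> len (expo m k) + H"
        "dist x0 (\<phi> a (tip n)) - dist x0 (\<phi> a (pt (2 * n))) - 3 * L \<le> len (expo m (Suc k)) + H"
        unfolding pt_0 au by blast
      then show "dominated W m (2 * n) (4 * n)"
        using far W(4) unfolding dominated_def by (intro exI[of _ k]) auto
    qed
    moreover have "dist x0 z \<le> real (wdist lam ps z x0) \<or>
      dominated W m (4 * n) (2 * n)"
    proof (rule disj_commute[THEN iffD1, OF disjCI])
      assume "\<not> dist x0 z \<le> real (wdist lam ps z x0)"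
      then obtain a where a: "a \<in> carrier G" and gp: "gprod x0 z (\<phi> a x0) \<le> Cm"
        "gprod x0 z (\<phi> a (tip n)) \<le> Cm" "gprod x0 (\<phi> a x0) (\<phi> a (tip n)) \<le> Cm"
        using Cm(2)[rule_format, OF ps(1), of z x0] unfolding ps(2,3)
        by (auto simp: dist_commute gprod_commute)
      note s = common[OF a gp(1,2)]
      then have au: "\<phi> (a \<otimes> u) (pt (- 4 * n)) = \<phi> a (tip n)" "\<phi> (a \<otimes> u) x0 = \<phi> a (mid n)"
        and corner_mid: "gprod (\<phi> a (tip n)) (\<phi> a x0) (\<phi> a (mid n)) \<le> C1"
        by auto
      have "inv (a \<otimes> u) \<otimes> a = inv u"
        using a u by (simp add: inv_mult_group m_assoc)
      then have au': "inv (a \<otimes> u) \<otimes> a \<notin> elementary"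
        using u elementary_inv[of "inv u"] by auto
      have far: "dist x0 (\<phi> a (tip n)) + (len (4 * n) - V) \<le> dist x0 (\<phi> a (mid n))"
        "dist x0 (\<phi> a (mid n)) + (len (2 * n) - V) \<le> dist x0 (\<phi> a x0)"
        using two_segments[OF gp(3) corner_mid] s H_nonneg
          dist_triangle[of "\<phi> a x0" "\<phi> a (pt (2 * n))" "\<phi> a (mid n)"]
        unfolding V_def by (simp_all add: dist_commute)
      \<comment> \<open>Read backwards: the translate by \<open>a \<otimes> u\<close> from
        \<open>pt (- 4 * n)\<close> to \<open>pt 0\<close>, then the translate by \<open>a\<close>
        from \<open>pt (2 * n)\<close> to \<open>pt 0\<close>.\<close>
      have "\<exists>k. dist x0 (\<phi> (a \<otimes> u) (pt 0)) - dist x0 (\<phi> (a \<otimes> u) (pt (- 4 * n))) - 3 * L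
          \<le> len (expo m k) + H \<and>
        dist x0 (\<phi> a (pt 0)) - dist x0 (\<phi> (a \<otimes> u) (pt 0)) - 3 * L \<le> len (expo m (Suc k)) + H"
        by (rule L(2)[unfolded domination_bound_def, rule_format, where T = T and ?i2.0 = "2 * n"])
          (use lngm a au' gp s B_ge far lens in \<open>auto simp: z_def dist_commute[of "\<phi> a (mid n)"]\<close>)
      then obtain k where "dist x0 (\<phi> a (mid n)) - dist x0 (\<phi> a (tip n)) - 3 * L \<le> len (expo m k) + H"
        "dist x0 (\<phi> a x0) - dist x0 (\<phi> a (mid n)) - 3 * L \<le> len (expo m (Suc k)) + H"
        unfolding pt_0 au by blast
      then show "dominated W m (4 * n) (2 * n)"
        using far W(4) unfolding dominated_def by (intro exI[of _ k]) auto
    qed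
    ultimately show ?thesis unfolding z_def by blast
  qed
  show ?thesis unfolding occurrence_bound_def
    by (intro exI[of _ W] conjI W(1) allI impI main[THEN conjunct1] main[THEN conjunct2])
qed

lemma len_upper: "len i \<le> K * \<bar>real_of_int i\<bar>"
  using pt_lipschitz[of 0 i] by (simp add: len_def)

lemma len_lower: "\<bar>real_of_int i\<bar> \<le> K * (len i + 1)"
  using pt_growth[of 0 i] by (simp add: len_def algebra_simps)

lemma len_double: "0 \<le> i \<Longrightarrow> 2 * len i - 2 * C \<le> len (2 * i)"
  using pt_gprod[of 0 i "2 * i"] dist_pt[of i "2 * i"]
  by (simp add: gprod_def len_def dist_commute field_simps)

lemma expo_add4: "expo n (4 + k) = expo n k" "eta (4 + k) = eta k"
  by (auto simp: expo_def eta_def)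

lemma word_add4: "word n (4 + k) = word n 4 \<otimes> word n k"
proof (induction k)
  case (Suc k)
  have "word n (4 + Suc k) = word n (4 + k) \<otimes> (g [^] expo n (4 + k) \<otimes> eta (4 + k))"
    by (simp only: add_Suc_right word.simps)
  then show ?case using Suc g_in by (simp add: expo_add4 m_assoc)
qed simp

lemma word_mult4: "word n (4 * N + k) = word n 4 [^] N \<otimes> word n k"
proof (induction N)
  case (Suc N)
  have "word n (4 * Suc N + k) = word n 4 \<otimes> word n (4 * N + k)"
    using word_add4[of n "4 * N + k"] by (simp only: mult_Suc_right add.assoc)
  also have "\<dots> = word n 4 [^] Suc N \<otimes> word n k"
    unfolding Suc nat_pow_Suc2[OF word_in] by (simp add: m_assoc)
  finally show ?case .
qed simp

lemma vert_mult4: "vert n (4 * N + k) = \<phi> (word n 4 [^] N) (vert n k)"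
  by (simp add: vert_def word_mult4 act_mult)

lemma sum_edges:
  "(\<Sum>k<4 * N. dist (vert n k) (vert n (Suc k)) - c)
    = real N * ((\<Sum>k<4. dist (vert n k) (vert n (Suc k))) - 4 * c)"
proof (induction N)
  case (Suc N)
  have *: "dist (vert n (4 * N + k)) (vert n (Suc (4 * N + k))) = dist (vert n k) (vert n (Suc k))"
    for k
    using vert_mult4[of n N k] vert_mult4[of n N "Suc k"]
      act_dist[of "word n 4 [^] N" "vert n k" "vert n (Suc k)"] by simp
  have "4 * Suc N = Suc (Suc (Suc (Suc (4 * N))))" by simp
  then show ?case
    using Suc *[of 0] *[of 1] *[of 2] *[of 3]
    by (simp add: algebra_simps eval_nat_numeral)
qed simp

lemma wdist_power:
  assumes "pattern lam ps" "f \<in> carrier G"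
  shows "wdist lam ps x (\<phi> (f [^] (N::nat)) x)
    \<le> N * wdist lam ps x (\<phi> f x) + wdist lam ps x x"
proof (induction N)
  case (Suc N)
  have "wdist lam ps x (\<phi> (f [^] Suc N) x)
      \<le> wdist lam ps x (\<phi> (f [^] N) x) + wdist lam ps (\<phi> (f [^] N) x) (\<phi> (f [^] N) (\<phi> f x))"
    using wdist_triangle[OF assms(1), of x "\<phi> (f [^] Suc N) x" "\<phi> (f [^] N) x"] assms(2)
    by (simp add: act_mult)
  then show ?case using Suc wdist_act[OF assms(1), of "f [^] N" x "\<phi> f x"] assms(2) by simp
qed (simp add: act_one)

text \<open>Within one period, the stretch from \<open>vert n 2\<close> to the point
  \<open>S\<close> just before the final letter can follow a translate of the pattern, which earns
  the reward once. The four pieces cost an extra 5 each, and the final letter contributes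
  \<open>H\<close> twice.\<close>

lemma wdist_word:
  assumes ps: "pattern lam ps" "unit_path ps x0 (tip n)" "real (length ps) \<le> dist x0 (tip n) + 5"
  shows "real (wdist lam ps x0 (vert n 4))
    \<le> (\<Sum>k<4. dist (vert n k) (vert n (Suc k))) + 2 * H + 20 - real lam"
proof -
  let ?w = "\<lambda>x y. real (wdist lam ps x y)"
  define S where "S = \<phi> (word n 3) (pt (expo n 3))"
  have "word n (Suc 2) = word n 2 \<otimes> (g [^] expo n 2 \<otimes> eta 2)" by (rule word.simps(2))
  then have w3: "word n 3 = word n 2 \<otimes> (g [^] (2 * n) \<otimes> h)"
    unfolding Suc_numeral by (simp add: expo_def eta_def)
  have S: "S = \<phi> (word n 2) (tip n)"
    using g_in h_in by (simp add: S_def w3 tip_def act_mult expo_def)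
  have v2: "vert n 2 = \<phi> (word n 2) x0" by (simp add: vert_def)
  have SH: "dist S (vert n 4) = H"
    using dist_axis_vert[of n 3] by (simp add: S_def)
  have "dist (vert n 3) S = len (expo n 3)"
    unfolding S_def vert_def len_def by (rule act_dist) simp
  then have d3: "dist (vert n 3) S \<le> dist (vert n 3) (vert n 4) + H"
    using edge_length[of n 3] by (simp add: abs_le_iff)
  have "occ ps (map (\<phi> \<one>) ps @ []) (Suc 0)" by (intro occ_copy occ_Nil) simp
  moreover have "map (\<phi> \<one>) ps = ps" by (simp add: act_one map_idI)
  ultimately have "occ ps ps 1" by simp
  then have "wdist lam ps x0 (tip n) + lam \<le> length ps"
    using wdist_le[OF ps(1,2), of 1] by simp
  then have "?w x0 (tip n) + real lam \<le> dist x0 (tip n) + 5" using ps(3) by linarith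
  moreover have "?w (vert n 2) S = ?w x0 (tip n)"
    unfolding S v2 using wdist_act[OF ps(1)] by simp
  moreover have "dist x0 (tip n) = dist (vert n 2) S" unfolding S v2 using act_dist by simp
  moreover have "dist (vert n 2) S \<le> dist (vert n 2) (vert n 3) + dist (vert n 3) S"
    by (rule dist_triangle)
  ultimately have w2: "?w (vert n 2) S
      \<le> dist (vert n 2) (vert n 3) + dist (vert n 3) (vert n 4) + H + 5 - real lam"
    using d3 by linarith
  have tri: "?w x z \<le> ?w x y + ?w y z" for x y z
    using wdist_triangle[OF ps(1), of x z y] by linarith
  have "?w x0 (vert n 4) \<le> ?w x0 (vert n 1) + (?w (vert n 1) (vert n 2)
      + (?w (vert n 2) S + ?w S (vert n 4)))"
    using tri[of x0 "vert n 4" "vert n 1"] tri[of "vert n 1" "vert n 4" "vert n 2"]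
      tri[of "vert n 2" "vert n 4" S] by linarith
  also have "\<dots> \<le> (dist x0 (vert n 1) + 5) + ((dist (vert n 1) (vert n 2) + 5)
      + ((dist (vert n 2) (vert n 3) + dist (vert n 3) (vert n 4) + H + 5 - real lam) + (H + 5)))"
    using wdist_le_dist[OF ps(1)] SH by (intro add_mono w2) (auto simp: SH[symmetric])
  also have "\<dots> = (\<Sum>k<4. dist (vert n k) (vert n (Suc k))) + 2 * H + 20 - real lam"
    unfolding sum_lessThan_4 by (simp add: numeral_2_eq_2[symmetric])
  finally show ?thesis .
qed

text \<open>Both weighted distances are compared with the distance from \<open>x0\<close> to the end
  of the power. For equal indices the reward wins in one direction and no copy fits in the other;
  for \<open>m\<close> much smaller than \<open>n\<close> no copy fits in either. The 5 is the
  additive error of \<open>wdist_le_dist\<close>.\<close>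

theorem counting_family:
  "\<exists>lam P n0 R. 0 < n0 \<and> (\<forall>n\<ge>n0. pattern lam (P n) \<and>
    (\<forall>N. counting_qhom lam (P n) x0 (word (int n) 4 [^] (N::nat)) \<le> 5 - real N) \<and>
    (\<forall>m\<ge>n0. R * m \<le> n \<longrightarrow>
      (\<forall>N. \<bar>counting_qhom lam (P n) x0 (word (int m) 4 [^] (N::nat))\<bar> \<le> 5)))"
proof -
  \<comment> \<open>\<open>8 * C3\<close> is the loss at the four corners of a period and
    \<open>2 * H + 20\<close> the overhead in \<open>wdist_word\<close>; the remaining 1 is the net
    gain per period.\<close>
  define lam where "lam = nat \<lceil>8 * C3 + 2 * H + 21\<rceil>"
  have lam: "8 * C3 + 2 * H + 21 \<le> real lam" unfolding lam_def by linarith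
  obtain W where W: "0 \<le> W" "occurrence_bound lam W" using no_occurrence by blast
  \<comment> \<open>The part \<open>W + 2 * C\<close> makes \<open>len\<close> grow by more than
    \<open>W\<close> when the exponent is doubled. The rest serves the broken geodesics and the
    minimal length of the pattern.\<close>
  define l where "l = W + 2 * C + (3 * H + 2 * C1 + 3 * \<delta>) + 1 + 2 * real lam + H + 2 * (C1 + H)"
  have l: "W + 2 * C < l" "W \<le> l" "3 * H + 2 * C1 + 3 * \<delta> < l" "2 * real lam + H + 2 * (C1 + H) \<le> l"
    "0 \<le> l"
    using W(1) C_nonneg H_nonneg C1_nonneg delta_ge_1 unfolding l_def by auto
  define n0 where "n0 = nat \<lceil>K * (l + 1)\<rceil> + 1"
  \<comment> \<open>For \<open>R * m \<le> n\<close> even the longest syllable of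
    \<open>word m\<close> falls short of the one with exponent \<open>4 * n\<close> by more than
    \<open>W\<close>.\<close>
  define R where "R = nat \<lceil>K * (4 * K + W + 1)\<rceil>"
  have lng: "long (int n) l" if "n0 \<le> n" for n
  proof -
    have "K * (l + 1) \<le> real n" using that unfolding n0_def by linarith
    moreover have "l \<le> len i" if "K * (l + 1) \<le> \<bar>real_of_int i\<bar>" for i
    proof -
      have "K * (l + 1) \<le> K * (len i + 1)" using that len_lower[of i] by linarith
      then show ?thesis using K_ge_1 by simp
    qed
    ultimately show ?thesis unfolding long_def by simp
  qed
  have mono: "long i a \<Longrightarrow> b \<le> a \<Longrightarrow> long i b" for i a b unfolding long_def by linarith
  define P where "P n = (SOME as. unit_path as x0 (tip (int n)) \<and>
    real (length as) \<le> dist x0 (tip (int n)) + 5)" for n :: nat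
  have P: "unit_path (P n) x0 (tip (int n))" "real (length (P n)) \<le> dist x0 (tip (int n)) + 5" for n
    using someI_ex[OF unit_path_exists[of x0 "tip (int n)"]] unfolding P_def by blast+
  have P_ends: "hd (P n) = x0" "last (P n) = tip (int n)" for n
    using P(1)[of n] by (auto simp: unit_path_def)
  have pat: "pattern lam (P n)" if n: "n0 \<le> n" for n
  proof -
    have "len (2 * int n) + dist (tip (int n)) (pt (2 * int n))
        \<le> dist x0 (tip (int n)) + 2 * (C1 + H)"
      using gprod_tip_pt[of "int n"] by (simp add: gprod_def len_def field_simps)
    moreover have "l \<le> len (2 * int n)" using lng[OF n] by (simp add: long_def)
    ultimately have "2 * real lam \<le> dist x0 (tip (int n))"
      using l(4) H_nonneg zero_le_dist[of "tip (int n)" "pt (2 * int n)"] by linarith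
    then have "2 * real lam \<le> real (length (P n))" using unit_path_length[OF P(1)[of n]] by linarith
    then show ?thesis using P(1)[of n] by (auto simp: pattern_def unit_path_def)
  qed
  have vert_word: "\<phi> (word i 4 [^] N) x0 = vert i (4 * N)" for i and N :: nat
    using vert_mult4[of i N 0] by simp
  have wd_upper: "real (wdist lam (P n) x y) \<le> dist x y + 5" if "n0 \<le> n" for n x y
    using wdist_le_dist[OF pat[OF that]] .
  have diag: "counting_qhom lam (P n) x0 (word (int n) 4 [^] N) \<le> 5 - real N" if n: "n0 \<le> n" for n and N :: nat
  proof -
    define d where "d = (\<Sum>k<4. dist (vert (int n) k) (vert (int n) (Suc k)))"
    have "real (wdist lam (P n) x0 (\<phi> (word (int n) 4 [^] N) x0))
        \<le> real N * real (wdist lam (P n) x0 (\<phi> (word (int n) 4) x0))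
          + real (wdist lam (P n) x0 x0)"
      using wdist_power[OF pat[OF n], of "word (int n) 4" x0 N]
      by (simp only: of_nat_add[symmetric] of_nat_mult[symmetric] of_nat_le_iff word_in)
    also have "\<dots> \<le> real N * (d + 2 * H + 20 - real lam) + 5"
      using wdist_word[OF pat[OF n] P] wd_upper[OF n, of x0 x0]
      by (intro add_mono mult_left_mono) (auto simp: d_def vert_def)
    also have "\<dots> \<le> real N * (d - 4 * (2 * C3) - 1) + 5"
      using lam by (intro add_mono mult_left_mono) auto
    also have "\<dots> = real N * (d - 4 * (2 * C3)) - real N + 5" by (simp add: algebra_simps)
    also have "real N * (d - 4 * (2 * C3)) \<le> dist x0 (vert (int n) (4 * N))"
      using vert_length[OF lng[OF n] l(3), of "4 * N"] sum_edges[of "int n" "2 * C3" N]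
      by (simp add: d_def)
    finally have "real (wdist lam (P n) x0 (\<phi> (word (int n) 4 [^] N) x0))
        \<le> dist x0 (vert (int n) (4 * N)) - real N + 5" by simp
    moreover have "dist x0 (vert (int n) (4 * N))
        \<le> real (wdist lam (P n) (vert (int n) (4 * N)) x0)"
    proof (rule ccontr)
      assume "\<not> ?thesis"
      then obtain k where k: "len (4 * int n) \<le> len (expo (int n) k) + W"
        "len (2 * int n) \<le> len (expo (int n) (Suc k)) + W"
        using W(2)[unfolded occurrence_bound_def, rule_format, of "int n" "int n" "P n" "4 * N"] mono[OF lng[OF n] l(2)]
          pat[OF n] P_ends[of n] unfolding dominated_def by blast
      have ln: "l \<le> len (int n)" "l \<le> len (2 * int n)" using lng[OF n] by (auto simp: long_def)
      have grow: "len (int n) + W < len (2 * int n)" "len (2 * int n) + W < len (4 * int n)"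
        using len_double[of "int n"] len_double[of "2 * int n"] ln l(1) by auto
      \<comment> \<open>Only the syllable with exponent \<open>- 4 * n\<close> is long enough for
        index \<open>k\<close>, and it is followed by one with exponent \<open>n\<close>, too short
        to match \<open>2 * n\<close>.\<close>
      have "k mod 4 = 3"
        using k(1) grow W(1) by (auto simp: expo_def split: if_splits)
      then have "Suc k mod 4 = 0" by presburger
      then show False using k(2) grow by (simp add: expo_def)
    qed
    ultimately show ?thesis unfolding counting_qhom_def vert_word by linarith
  qed
  have off: "\<bar>counting_qhom lam (P n) x0 (word (int m) 4 [^] N)\<bar> \<le> 5"
    if n: "n0 \<le> n" and m: "n0 \<le> m" and Rm: "R * m \<le> n" for n m and N :: nat
  proof -
    define z where "z = vert (int m) (4 * N)"
    have m1: "1 \<le> real m" using m unfolding n0_def by simp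
    have small: "len (expo (int m) k) + W < len (4 * int n)" for k
    proof -
      have "len (expo (int m) k) \<le> K * \<bar>real_of_int (expo (int m) k)\<bar>" by (rule len_upper)
      also have "\<dots> \<le> K * (4 * real m)"
        using K_ge_1 by (intro mult_left_mono) (auto simp: expo_def)
      also have "K * (4 * real m) = 4 * K * real m" by simp
      finally have "len (expo (int m) k) \<le> 4 * K * real m" .
      moreover have "(W + 1) * 1 \<le> (W + 1) * real m" using m1 W(1) by (intro mult_left_mono) auto
      ultimately have 1: "len (expo (int m) k) + W + 1 \<le> 4 * K * real m + (W + 1) * real m"
        by simp
      have "K * (4 * K * real m + (W + 1) * real m) = K * (4 * K + W + 1) * real m"
        by (simp add: algebra_simps)
      also have "\<dots> \<le> real R * real m"
        unfolding R_def by (intro mult_right_mono) (linarith, simp)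
      also have "\<dots> \<le> real n" using Rm by (simp only: of_nat_mult[symmetric] of_nat_le_iff)
      also have "\<dots> < \<bar>real_of_int (4 * int n)\<bar>" using n unfolding n0_def by simp
      also have "\<dots> \<le> K * (len (4 * int n) + 1)" by (rule len_lower)
      finally have "4 * K * real m + (W + 1) * real m < len (4 * int n) + 1"
        using K_ge_1 by simp
      then show ?thesis using 1 by linarith
    qed
    have "dist x0 z \<le> real (wdist lam (P n) x0 z) \<and> dist x0 z \<le> real (wdist lam (P n) z x0)"
      using W(2)[unfolded occurrence_bound_def, rule_format, of "int m" "int n" "P n" "4 * N"] mono[OF lng[OF n] l(2)]
        mono[OF lng[OF m] l(2)] pat[OF n] P_ends[of n] small unfolding z_def dominated_def by (meson not_le)
    moreover have "real (wdist lam (P n) x0 z) \<le> dist x0 z + 5"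
      "real (wdist lam (P n) z x0) \<le> dist x0 z + 5"
      using wd_upper[OF n, of x0 z] wd_upper[OF n, of z x0] by (simp_all add: dist_commute)
    ultimately show ?thesis unfolding counting_qhom_def vert_word z_def[symmetric] by linarith
  qed
  show ?thesis
  proof (intro exI conjI allI impI)
    show "0 < n0" by (simp add: n0_def)
  qed (fact pat diag off)+
qed

end

section \<open>Infinite dimension\<close>

text \<open>Evaluate at the elements belonging to the smallest index \<open>j\<close> with nonzero
  coefficient: the terms of larger index stay bounded there, whereas the term of index
  \<open>j\<close> grows linearly in \<open>N\<close>.\<close>

lemma triangular_independent:
  fixes F :: "nat \<Rightarrow> 'g \<Rightarrow> real" and f :: "nat \<Rightarrow> nat \<Rightarrow> 'g"
  assumes diag: "\<And>i N. F i (f i N) \<le> 5 - real N"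
    and off: "\<And>i j N. j < i \<Longrightarrow> \<bar>F i (f j N)\<bar> \<le> 5"
    and I: "finite I" and bdd: "\<And>j N. \<bar>\<Sum>i\<in>I. c i * F i (f j N)\<bar> \<le> D" and "i \<in> I"
  shows "c i = 0"
proof (rule ccontr)
  assume "c i \<noteq> 0"
  define j where "j = Min {i \<in> I. c i \<noteq> 0}"
  have fin: "finite {i \<in> I. c i \<noteq> 0}" and ne: "{i \<in> I. c i \<noteq> 0} \<noteq> {}"
    using I \<open>i \<in> I\<close> \<open>c i \<noteq> 0\<close> by auto
  have j: "j \<in> I" "c j \<noteq> 0" using Min_in[OF fin ne] by (auto simp: j_def)
  have less: "c k = 0" if "k \<in> I" "k < j" for k
    using Min_le[OF fin, of k] that by (fastforce simp: j_def)
  define E where "E = (\<Sum>i\<in>I - {j}. \<bar>c i\<bar> * 5)"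
  have "\<bar>c j\<bar> * (real N - 5) \<le> D + E" for N
  proof -
    have "\<bar>\<Sum>i\<in>I - {j}. c i * F i (f j N)\<bar> \<le> (\<Sum>i\<in>I - {j}. \<bar>c i * F i (f j N)\<bar>)"
      by (rule sum_abs)
    also have "\<dots> \<le> E"
      unfolding E_def
    proof (rule sum_mono)
      fix k assume k: "k \<in> I - {j}"
      show "\<bar>c k * F k (f j N)\<bar> \<le> \<bar>c k\<bar> * 5"
      proof (cases "k < j")
        case True
        then show ?thesis using less k by simp
      next
        case False
        then have "\<bar>F k (f j N)\<bar> \<le> 5" using k by (intro off) auto
        then show ?thesis by (simp add: abs_mult mult_left_mono)
      qed
    qed
    finally have "\<bar>\<Sum>i\<in>I - {j}. c i * F i (f j N)\<bar> \<le> E" .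
    moreover have "(\<Sum>i\<in>I. c i * F i (f j N)) = c j * F j (f j N) + (\<Sum>i\<in>I - {j}. c i * F i (f j N))"
      using I j(1) by (rule sum.remove)
    ultimately have "\<bar>c j * F j (f j N)\<bar> \<le> D + E" using bdd[of j N] by linarith
    moreover have "\<bar>c j\<bar> * (real N - 5) \<le> \<bar>c j\<bar> * \<bar>F j (f j N)\<bar>"
      using diag[of j N] by (intro mult_left_mono) auto
    ultimately show ?thesis by (simp add: abs_mult)
  qed
  then have "real N \<le> (D + E) / \<bar>c j\<bar> + 5" for N using j(2) by (simp add: field_simps)
  moreover obtain N :: nat where "(D + E) / \<bar>c j\<bar> + 5 < real N" using reals_Archimedean2 by blast
  ultimately show False by (meson not_le)
qed

lemma real_homs_one:
  assumes "group G" "\<chi> \<in> real_homs G"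
  shows "\<chi> \<one>\<^bsub>G\<^esub> = 0"
proof -
  interpret group G by fact
  have "\<chi> (\<one>\<^bsub>G\<^esub> \<otimes>\<^bsub>G\<^esub> \<one>\<^bsub>G\<^esub>) = \<chi> \<one>\<^bsub>G\<^esub> + \<chi> \<one>\<^bsub>G\<^esub>" using assms(2) unfolding real_homs_def by blast
  then show ?thesis by simp
qed

lemma real_homs_inv:
  assumes "group G" "\<chi> \<in> real_homs G" "a \<in> carrier G"
  shows "\<chi> (inv\<^bsub>G\<^esub> a) = - \<chi> a"
proof -
  interpret group G by fact
  have "\<chi> (a \<otimes>\<^bsub>G\<^esub> inv\<^bsub>G\<^esub> a) = \<chi> a + \<chi> (inv\<^bsub>G\<^esub> a)"
    using assms(2,3) inv_closed[OF assms(3)] unfolding real_homs_def by blast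
  then show ?thesis using assms real_homs_one[OF assms(1,2)] by simp
qed

lemma real_homs_pow:
  assumes "group G" "\<chi> \<in> real_homs G" "a \<in> carrier G"
  shows "\<chi> (a [^]\<^bsub>G\<^esub> (n::nat)) = real n * \<chi> a"
proof -
  interpret group G by fact
  show ?thesis
  proof (induction n)
    case (Suc n)
    have "\<chi> (a [^]\<^bsub>G\<^esub> n \<otimes>\<^bsub>G\<^esub> a) = \<chi> (a [^]\<^bsub>G\<^esub> n) + \<chi> a"
      using assms(2,3) by (simp add: real_homs_def)
    then show ?case using Suc by (simp add: algebra_simps)
  qed (simp add: real_homs_one[OF assms(1,2)])
qed

lemma real_homs_int_pow:
  assumes "group G" "\<chi> \<in> real_homs G" "a \<in> carrier G"
  shows "\<chi> (a [^]\<^bsub>G\<^esub> (i::int)) = real_of_int i * \<chi> a"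
proof -
  interpret group G by fact
  show ?thesis
  proof (cases i rule: int_cases2)
    case (nonneg n)
    then show ?thesis using real_homs_pow[OF assms] by (simp add: int_pow_int)
  next
    case (nonpos n)
    then show ?thesis
      using real_homs_pow[OF assms, of n] real_homs_inv[OF assms(1,2), of "a [^]\<^bsub>G\<^esub> n"] assms(3)
      by (simp add: int_pow_neg int_pow_int)
  qed
qed

lemma (in nonelementary_axis) real_homs_word:
  assumes \<chi>: "\<chi> \<in> real_homs G"
  shows "\<chi> (word n 4) = 0"
proof -
  have mult: "\<chi> (a \<otimes> b) = \<chi> a + \<chi> b" if "a \<in> carrier G" "b \<in> carrier G" for a b
    using \<chi> that by (simp add: real_homs_def)
  have step: "\<chi> (word n (Suc k)) = \<chi> (word n k) + (real_of_int (expo n k) * \<chi> g + \<chi> (eta k))" for k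
    using mult g_in real_homs_int_pow[OF is_group \<chi> g_in] by simp
  have "\<chi> (word n (Suc (Suc (Suc (Suc 0))))) = 0"
    unfolding step using real_homs_one[OF is_group \<chi>] real_homs_inv[OF is_group \<chi> h_in]
    by (simp add: expo_def eta_def)
  then show ?thesis by (simp add: eval_nat_numeral)
qed

text \<open>A function in \<open>U\<close> is bounded on all powers of the \<open>f j\<close>, since
  its homomorphism part vanishes there. A linear relation between the cosets \<open>X i\<close> puts
  a combination of the \<open>F i\<close> into \<open>U\<close>, which
  \<open>triangular_independent\<close> refutes.\<close>

lemma QH_tilde_not_fin_dim:
  fixes G :: "('g, 'm) monoid_scheme" (structure) and F :: "nat \<Rightarrow> 'g \<Rightarrow> real" and f :: "nat \<Rightarrow> 'g"
  assumes G: "group G" and F: "\<And>i. F i \<in> quasi_homs G" and f: "\<And>j. f j \<in> carrier G"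
    and hom: "\<And>\<chi> j. \<chi> \<in> real_homs G \<Longrightarrow> \<chi> (f j) = 0"
    and diag: "\<And>i N. F i (f i [^] (N::nat)) \<le> 5 - real N"
    and off: "\<And>i j N. j < i \<Longrightarrow> \<bar>F i (f j [^] (N::nat))\<bar> \<le> 5"
  shows "\<not> vectorspace.fin_dim (class_ring :: real ring) (QH_tilde G)"
proof
  assume fd: "vectorspace.fin_dim (class_ring :: real ring) (QH_tilde G)"
  interpret group G by fact
  interpret Q: vectorspace "class_ring :: real ring" "QH_tilde G"
    using G by (rule vectorspace_QH_tilde)
  interpret V: vectorspace "class_ring :: real ring" "quasi_hom_space G"
    using G by (rule vectorspace_quasi_hom_space)
  define U where "U = bounded_funs G <+>\<^bsub>quasi_hom_space G\<^esub> real_homs G"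
  have V_simps: "carrier (quasi_hom_space G) = quasi_homs G"
    "u \<oplus>\<^bsub>quasi_hom_space G\<^esub> v = restrict (\<lambda>x. u x + v x) (carrier G)"
    "c \<odot>\<^bsub>quasi_hom_space G\<^esub> v = restrict (\<lambda>x. c * v x) (carrier G)"
    "\<zero>\<^bsub>quasi_hom_space G\<^esub> = restrict (\<lambda>x. 0) (carrier G)" for u v c
    by (simp_all add: quasi_hom_space_def class_ring.func_space_def)
  have ext: "v \<in> carrier G \<rightarrow>\<^sub>E UNIV" if "v \<in> quasi_homs G" for v
    using that by (simp add: quasi_homs_iff)
  have zero_U: "restrict (\<lambda>x. 0) (carrier G) \<in> U"
  proof -
    define z :: "'g \<Rightarrow> real" where "z = restrict (\<lambda>x. 0) (carrier G)"
    have "z \<in> bounded_funs G" "z \<in> real_homs G"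
      by (auto simp: z_def bounded_funs_iff real_homs_def)
    moreover have "z = restrict (\<lambda>x. z x + z x) (carrier G)" by (auto simp: z_def)
    ultimately show ?thesis unfolding U_def set_add_def' V_simps z_def[symmetric] by blast
  qed
  have U_bdd: "\<exists>D. \<forall>j N. \<bar>w (f j [^] (N::nat))\<bar> \<le> D" if "w \<in> U" for w
  proof -
    obtain \<beta> \<chi> where w: "\<beta> \<in> bounded_funs G" "\<chi> \<in> real_homs G" "w = restrict (\<lambda>x. \<beta> x + \<chi> x) (carrier G)"
      using \<open>w \<in> U\<close> unfolding U_def set_add_def' V_simps by auto
    obtain D where "\<And>x. x \<in> carrier G \<Longrightarrow> \<bar>\<beta> x\<bar> \<le> D" using w(1) by (auto simp: bounded_funs_iff)
    then show ?thesis using w(3) f real_homs_pow[OF G w(2)] hom[OF w(2)]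
      by (intro exI[of _ D]) auto
  qed
  define X where "X i = U +>\<^bsub>quasi_hom_space G\<^esub> F i" for i
  have F_in_X: "F i \<in> X i" for i
  proof -
    have "F i = restrict (\<lambda>x. restrict (\<lambda>x. 0) (carrier G) x + F i x) (carrier G)"
      using ext[OF F[of i]] by (auto simp: PiE_def extensional_def)
    then show ?thesis using zero_U unfolding X_def a_r_coset_def' V_simps by blast
  qed
  have X_diff: "\<exists>u\<in>U. \<forall>x\<in>carrier G. v x = u x + F i x" if "v \<in> X i" for v i
    using that unfolding X_def a_r_coset_def' V_simps by auto
  have Q_simps: "carrier (QH_tilde G) = a_rcosets\<^bsub>quasi_hom_space G\<^esub> U"
    "Y \<oplus>\<^bsub>QH_tilde G\<^esub> Z = Y <+>\<^bsub>quasi_hom_space G\<^esub> Z"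
    "c \<odot>\<^bsub>QH_tilde G\<^esub> Y = (\<Union>y\<in>Y. U +>\<^bsub>quasi_hom_space G\<^esub> (c \<odot>\<^bsub>quasi_hom_space G\<^esub> y))"
    "\<zero>\<^bsub>QH_tilde G\<^esub> = U" for Y Z c
    by (simp_all add: QH_tilde_def quotient_space_def U_def)
  have X_in: "X i \<in> carrier (QH_tilde G)" for i
    unfolding Q_simps A_RCOSETS_def' X_def using F V_simps(1) by auto
  \<comment> \<open>Independence is a property of the set \<open>range X\<close>, so different
    indices must first be shown to give different cosets. This is the triangular argument with
    coefficients 1 and -1.\<close>
  have inj: "inj X"
  proof -
    have "X i \<noteq> X j" if "j < i" for i j
    proof
      assume "X i = X j"
      then obtain u where u: "u \<in> U" "\<And>x. x \<in> carrier G \<Longrightarrow> F i x = u x + F j x"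
        using X_diff[of "F i" j] F_in_X[of i] by auto
      obtain D where D: "\<And>k N. \<bar>u (f k [^] (N::nat))\<bar> \<le> D" using U_bdd[OF u(1)] by blast
      define c where "c k = (if k = i then 1 else - 1 :: real)" for k
      have "c i = 0"
      proof (rule triangular_independent[where f = "\<lambda>j N. f j [^] N" and F = F and I = "{i, j}"])
        show "\<bar>\<Sum>k\<in>{i, j}. c k * F k (f l [^] N)\<bar> \<le> D" for l and N :: nat
          using D[of l N] u(2)[of "f l [^] N"] f that by (simp add: c_def)
      qed (use diag off in auto)
      then show False by (simp add: c_def)
    qed
    then show ?thesis by (metis injI linorder_neqE_nat)
  qed
  define idx where "idx = inv_into UNIV X"
  have idx: "idx (X i) = i" for i unfolding idx_def using inj by simp
  \<comment> \<open>Instead of computing the linear combination of cosets, an explicit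
    representative of it is carried through the induction.\<close>
  have comb: "restrict (\<lambda>x. \<Sum>Y\<in>A. a Y * F (idx Y) x) (carrier G) \<in> Q.lincomb a A"
    if "finite A" "A \<subseteq> range X" for a A
    using that
  proof (induction A)
    case empty
    show ?case
      unfolding Q.lincomb_def Q.finsum_empty Q_simps(4) sum.empty by (rule zero_U)
  next
    case (insert Y A)
    obtain i where i: "Y = X i" using insert.prems by auto
    define w where "w = restrict (\<lambda>x. \<Sum>Y\<in>A. a Y * F (idx Y) x) (carrier G)"
    have w: "w \<in> Q.lincomb a A" unfolding w_def using insert.IH insert.prems by blast
    have A_sub: "A \<subseteq> carrier (QH_tilde G)" "Y \<in> carrier (QH_tilde G)" using insert.prems X_in by auto
    have "Q.lincomb a (insert Y A) = (a Y \<odot>\<^bsub>QH_tilde G\<^esub> Y) \<oplus>\<^bsub>QH_tilde G\<^esub> Q.lincomb a A"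
      unfolding Q.lincomb_def using insert.hyps A_sub
      by (intro Q.finsum_insert) (auto intro!: Q.smult_closed)
    moreover have "restrict (\<lambda>x. a Y * F i x) (carrier G) \<in> a Y \<odot>\<^bsub>QH_tilde G\<^esub> Y"
    proof -
      have "restrict (\<lambda>x. a Y * F i x) (carrier G) \<in> U +>\<^bsub>quasi_hom_space G\<^esub> (restrict (\<lambda>x. a Y * F i x) (carrier G))"
        unfolding a_r_coset_def' V_simps using zero_U
        by (intro UN_I[of "restrict (\<lambda>x. 0) (carrier G)"]) auto
      then show ?thesis unfolding Q_simps V_simps using F_in_X[of i] i by blast
    qed
    ultimately have "restrict (\<lambda>x. restrict (\<lambda>x. a Y * F i x) (carrier G) x + w x) (carrier G)
        \<in> Q.lincomb a (insert Y A)"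
      using w unfolding Q_simps set_add_def' V_simps by blast
    moreover have "restrict (\<lambda>x. restrict (\<lambda>x. a Y * F i x) (carrier G) x + w x) (carrier G)
        = restrict (\<lambda>x. \<Sum>Y\<in>insert Y A. a Y * F (idx Y) x) (carrier G)"
      using insert.hyps by (auto simp: w_def i idx)
    ultimately show ?case by metis
  qed
  have "Q.lin_indpt (range X)"
  proof
    assume "Q.lin_dep (range X)"
    then obtain A a Y where A: "finite A" "A \<subseteq> range X" "Q.lincomb a A = U" "Y \<in> A" "a Y \<noteq> 0"
      unfolding Q.lin_dep_def Q_simps by auto
    have "restrict (\<lambda>x. \<Sum>Y\<in>A. a Y * F (idx Y) x) (carrier G) \<in> U"
      using comb[OF A(1,2), of a] unfolding A(3) .
    then obtain D where "\<And>j N. \<bar>restrict (\<lambda>x. \<Sum>Y\<in>A. a Y * F (idx Y) x) (carrier G) (f j [^] (N::nat))\<bar> \<le> D"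
      using U_bdd by blast
    then have D: "\<bar>\<Sum>Y\<in>A. a Y * F (idx Y) (f j [^] N)\<bar> \<le> D" for j and N :: nat using f by simp
    have inj_idx: "inj_on idx A" using A(2) idx by (metis inj_onI rangeE subsetD)
    have X_idx: "X (idx Z) = Z" if "Z \<in> A" for Z using A(2) that idx by (metis rangeE subsetD)
    have "a (X (idx Y)) = 0"
    proof (rule triangular_independent[where f = "\<lambda>j N. f j [^] N" and F = F and I = "idx ` A"])
      show "\<bar>\<Sum>i\<in>idx ` A. a (X i) * F i (f j [^] N)\<bar> \<le> D" for j and N :: nat
        using D[of j N] by (simp add: sum.reindex[OF inj_idx] X_idx)
    qed (use diag off A in auto)
    then show False using A(4,5) X_idx by simp
  qed
  then have "finite (range X)" using fd X_in by (intro Q.fin_dim_li_fin) auto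
  then show False using inj by (simp add: finite_image_iff)
qed

lemma (in hyperbolic_action) QH_tilde_not_fin_dim_of_WPD:
  assumes "WPD G \<phi>"
  shows "\<not> vectorspace.fin_dim (class_ring :: real ring) (QH_tilde G)"
proof -
  obtain g where g: "g \<in> carrier G" "hyperbolic_isometry (\<phi> g)" using assms unfolding WPD_def by blast
  then have "\<exists>x0 K C. hyperbolic_axis \<delta> G \<phi> g x0 K C"
    using assms unfolding WPD_def by (intro hyperbolic_axis_exists) blast+
  then obtain x0 K C where "hyperbolic_axis \<delta> G \<phi> g x0 K C" by blast
  then interpret A: hyperbolic_axis T \<delta> G \<phi> g x0 K C .
  obtain h where h: "h \<in> carrier G" "h \<notin> A.elementary"
    using A.nonelementary_exists assms unfolding WPD_def by blast
  then have h': "inv h \<in> carrier G" "inv h \<notin> A.elementary"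
    using A.elementary_inv[of "inv h"] by auto
  obtain c1 where c1: "0 \<le> c1" "\<And>n m. gprod (A.pt n) (\<phi> h (A.pt m)) x0 \<le> c1"
    using A.corner_bounded[OF h] by blast
  obtain c2 where c2: "0 \<le> c2" "\<And>n m. gprod (A.pt n) (\<phi> (inv h) (A.pt m)) x0 \<le> c2"
    using A.corner_bounded[OF h'] by blast
  interpret B: nonelementary_axis T \<delta> G \<phi> g x0 K C h "max c1 c2"
    by unfold_locales (use h c1 c2 in \<open>auto simp: le_max_iff_disj\<close>)
  obtain lam P n0 R where fam: "0 < n0"
    "\<And>n. n0 \<le> n \<Longrightarrow> pattern lam (P n)"
    "\<And>n N. n0 \<le> n \<Longrightarrow> counting_qhom lam (P n) x0 (B.word (int n) 4 [^] (N::nat)) \<le> 5 - real N"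
    "\<And>n m N. n0 \<le> n \<Longrightarrow> n0 \<le> m \<Longrightarrow> R * m \<le> n \<Longrightarrow>
      \<bar>counting_qhom lam (P n) x0 (B.word (int m) 4 [^] (N::nat))\<bar> \<le> 5"
    using B.counting_family by metis
  \<comment> \<open>Every later term is at least \<open>R + 1\<close> times an earlier one, as
    \<open>counting_family\<close> requires. The base \<open>R + 1\<close> also keeps all terms at
    least \<open>n0\<close> when \<open>R\<close> is 0.\<close>
  define s where "s i = n0 * (R + 1) ^ i" for i
  have s: "n0 \<le> s i" for i unfolding s_def by simp
  have s_mono: "R * s j \<le> s i" if "j < i" for i j
  proof -
    have "R * s j \<le> n0 * (R + 1) ^ Suc j" by (simp add: s_def)
    also have "\<dots> \<le> s i" unfolding s_def using that by (intro mult_left_mono power_increasing) auto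
    finally show ?thesis .
  qed
  define F where "F i = restrict (counting_qhom lam (P (s i)) x0) (carrier G)" for i
  show ?thesis
  proof (rule QH_tilde_not_fin_dim[where F = F and f = "\<lambda>j. B.word (int (s j)) 4"])
    show "group G" by (rule is_group)
    show "F i \<in> quasi_homs G" for i
      using counting_qhom_defect[OF fam(2)[OF s[of i]], of x0] by (auto simp: F_def quasi_homs_iff)
    show "B.word (int (s j)) 4 \<in> carrier G" for j by (rule B.word_in)
    show "\<chi> (B.word (int (s j)) 4) = 0" if "\<chi> \<in> real_homs G" for \<chi> j
      using B.real_homs_word[OF that] .
    show "F i (B.word (int (s i)) 4 [^] N) \<le> 5 - real N" for i and N :: nat
      using fam(3)[OF s[of i]] by (simp add: F_def)
    show "\<bar>F i (B.word (int (s j)) 4 [^] N)\<bar> \<le> 5" if "j < i" for i j and N :: nat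
      using fam(4)[OF s s s_mono[OF that]] by (simp add: F_def)
  qed
qed

theorem theorem7:
  fixes G :: "('g, 'm) monoid_scheme"
    and V :: "'x::metric_space set"
    and E :: "'e set"
    and \<chi> :: "'e \<Rightarrow> real \<Rightarrow> 'x"
    and \<phi> :: "'g \<Rightarrow> 'x \<Rightarrow> 'x"
    and \<delta> :: real
  assumes "metric_graph V E \<chi>"
    and "delta_hyperbolic TYPE('x) \<delta>"
    and "isometric_action G \<phi>"
    and "WPD G \<phi>"
  shows "\<not> vectorspace.fin_dim (class_ring :: real ring) (QH_tilde G)"
proof -
  interpret X: hyperbolic_space "TYPE('x)" "3 * \<bar>\<delta>\<bar> + 8"
    using metric_graph.hyperbolic_space_metric_graph[OF assms(1,2)] .
  have act: "group_action G UNIV \<phi>" and iso: "\<And>g. g \<in> carrier G \<Longrightarrow> isometry (\<phi> g)"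
    using assms(3) by (auto simp: isometric_action_def)
  interpret act: group_action G UNIV \<phi> by fact
  interpret group_hom G "BijGroup UNIV" \<phi> by (rule act.group_hom)
  interpret hyperbolic_action "TYPE('x)" "3 * \<bar>\<delta>\<bar> + 8" G \<phi>
  proof
    show "\<phi> \<one>\<^bsub>G\<^esub> x = x" for x using act.id_eq_one by (metis UNIV_I restrict_apply)
    show "\<phi> (a \<otimes>\<^bsub>G\<^esub> b) x = \<phi> a (\<phi> b x)" if "a \<in> carrier G" "b \<in> carrier G" for a b x
      using act.composition_rule that by blast
    show "dist (\<phi> a x) (\<phi> a y) = dist x y" if "a \<in> carrier G" for a x y
      using iso[OF that] by (simp add: isometry_def)
  qed
  show ?thesis using QH_tilde_not_fin_dim_of_WPD[OF assms(4)] .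
qed

end
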